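(* Let $\Pi=\mathbb{R}/\mathbb{Z}$ be the circle. Let $a\in C^2(\Pi)$ with $a>0$ and $b\in C^1(\Pi)$. Assume that $b$ changes sign on $\Pi$ (it takes both positive and negative values), and that the zero set of $b$ consists of finitely many isolated zeros $x_1,\dots,x_n$ and finitely many maximal (non-degenerate) intervals $I_1,\dots,I_m$ on which $b$ vanishes. Then: (1) For every probability measure $\mu$ on $\Pi$ of the form $$\mu=\sum_{i=1}^n a_i\,\delta_{x_i}+\sum_{j=1}^m b_j\,\mu_j,\qquad a_i,b_j\ge0,\quad \sum_{i=1}^n a_i+\sum_{j=1}^m b_j=1,$$ where each $\mu_j$ is a probability measure with $\operatorname{supp}\mu_j\subset I_j$, one has $$J(\mu)=\sum_{i=1}^n a_i\,\max(0,b'(x_i)).$$ (2) For every probability measure $\mu$ on $\Pi$ with $\operatorname{supp}\mu\not\subset\{x:\,b(x)=0\}$, one has $J(\mu)=+\infty$.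
   Context: For $c\in C^0(\Pi)$ and $\epsilon>0$, let $\lambda_\epsilon^c$ be the principal eigenvalue (the eigenvalue with maximal real part) of the operator $u\mapsto \epsilon\,a\,u''+b\,u'+c\,u$ on $\Pi$. Let $\Lambda(c):=\lim_{\epsilon\to0}\lambda_\epsilon^c$ (this limit exists under the present assumptions). For a probability measure $\mu$ on $\Pi$, $$J(\mu):=\sup_{c\in C^0(\Pi)}\Bigl\{\int_\Pi c\,d\mu-\Lambda(c)\Bigr\}\in[0,+\infty].$$ *)

theory Defs
  imports "HOL-Probability.Probability"
begin

section \<open>The circle as a quotient of the real line by the integers\<close>

quotient_type circle = real / "\<lambda>x y :: real. x - y \<in> \<int>"
proof (rule equivpI)
  show "reflp (\<lambda>x y :: real. x - y \<in> \<int>)"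
    by (simp add: reflp_def)
  show "symp (\<lambda>x y :: real. x - y \<in> \<int>)"
    by (simp add: symp_def) (metis Ints_minus minus_diff_eq)
  show "transp (\<lambda>x y :: real. x - y \<in> \<int>)"
    unfolding transp_def by (metis Ints_add add_diff_eq diff_add_cancel)
qed

lemma abs_circle_eq_iff: "abs_circle s = abs_circle t \<longleftrightarrow> s - t \<in> \<int>"
  by (rule circle.abs_eq_iff)

lemma abs_rep_circle [simp]: "abs_circle (rep_circle p) = p"
  by (rule Quotient3_abs_rep[OF Quotient3_circle])

text \<open>The quotient topology. The Borel sigma-algebra \<open>borel :: circle measure\<close> is the one
  generated by it.\<close>

instantiation circle :: topological_space
begin

definition open_circle :: "circle set \<Rightarrow> bool"
  where "open_circle U \<longleftrightarrow> open (abs_circle -` U)"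

instance
  by standard (auto simp: open_circle_def vimage_Union intro: open_Int)

end

lemma continuous_on_circle_iff:
  fixes f :: "circle \<Rightarrow> 'a::topological_space"
  shows "continuous_on UNIV f \<longleftrightarrow> continuous_on UNIV (\<lambda>t. f (abs_circle t))"
  by (simp add: continuous_on_open_vimage open_circle_def vimage_def)


section \<open>Differentiation on the circle\<close>

text \<open>The function \<open>rep_circle\<close> picks an arbitrary real representative of a point. The derivative
  does not depend on the choice, see \<open>circle_deriv_abs\<close>. The codomain is kept general because
  coefficients are real-valued while eigenfunctions are complex-valued.\<close>

definition circle_deriv :: "(circle \<Rightarrow> 'a::real_normed_vector) \<Rightarrow> circle \<Rightarrow> 'a"
  where "circle_deriv f p = vector_derivative (\<lambda>t. f (abs_circle t)) (at (rep_circle p))"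

lemma circle_deriv_abs:
  "circle_deriv f (abs_circle t) = vector_derivative (\<lambda>s. f (abs_circle s)) (at t)"
proof -
  define r where "r = rep_circle (abs_circle t)"
  define k where "k = r - t"
  have "abs_circle r = abs_circle t"
    by (simp add: r_def)
  then have k: "k \<in> \<int>"
    by (simp add: abs_circle_eq_iff k_def)
  have per: "f (abs_circle (s + k)) = f (abs_circle s)" for s
    using k by (intro arg_cong[where f = f]) (simp add: abs_circle_eq_iff)
  have "((\<lambda>s. f (abs_circle s)) has_vector_derivative D) (at (t + k)) \<longleftrightarrow>
        ((\<lambda>s. f (abs_circle s)) has_vector_derivative D) (at t)" for D
  proof -
    have "((\<lambda>s. f (abs_circle s)) has_vector_derivative D) (at (t + k)) \<longleftrightarrow>
          ((\<lambda>s. f (abs_circle (s + k))) has_vector_derivative D) (at t)"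
      by (simp add: has_vector_derivative_def has_derivative_at LIM_offset_zero_iff algebra_simps)
    then show ?thesis
      by (simp add: per)
  qed
  moreover have "r = t + k"
    by (simp add: k_def)
  ultimately show ?thesis
    by (simp add: circle_deriv_def vector_derivative_def flip: r_def)
qed

definition C_k_circle :: "nat \<Rightarrow> (circle \<Rightarrow> 'a::real_normed_vector) \<Rightarrow> bool"
  where "C_k_circle k f \<longleftrightarrow>
    (\<forall>j<k. \<forall>t. (\<lambda>s. (circle_deriv ^^ j) f (abs_circle s)) differentiable (at t)) \<and>
    continuous_on UNIV ((circle_deriv ^^ k) f)"


section \<open>The principal eigenvalue and the functional\<close>

definition circle_eigenvalue ::
  "(circle \<Rightarrow> real) \<Rightarrow> (circle \<Rightarrow> real) \<Rightarrow> (circle \<Rightarrow> real) \<Rightarrow> real \<Rightarrow> complex \<Rightarrow> bool"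
  where "circle_eigenvalue a b c \<epsilon> z \<longleftrightarrow>
    (\<exists>u :: circle \<Rightarrow> complex. C_k_circle 2 u \<and> (\<exists>p. u p \<noteq> 0) \<and>
      (\<forall>p. of_real (\<epsilon> * a p) * (circle_deriv ^^ 2) u p
         + of_real (b p) * circle_deriv u p + of_real (c p) * u p = z * u p))"

definition principal_eigenvalue ::
  "(circle \<Rightarrow> real) \<Rightarrow> (circle \<Rightarrow> real) \<Rightarrow> (circle \<Rightarrow> real) \<Rightarrow> real \<Rightarrow> complex"
  where "principal_eigenvalue a b c \<epsilon> =
    (THE z. circle_eigenvalue a b c \<epsilon> z \<and>
       (\<forall>w. circle_eigenvalue a b c \<epsilon> w \<longrightarrow> Re w \<le> Re z))"

text \<open>The principal eigenvalue is real, so taking real parts only adjusts the type.\<close>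

definition Lambda_limit ::
  "(circle \<Rightarrow> real) \<Rightarrow> (circle \<Rightarrow> real) \<Rightarrow> (circle \<Rightarrow> real) \<Rightarrow> real"
  where "Lambda_limit a b c = Lim (at_right 0) (\<lambda>\<epsilon>. Re (principal_eigenvalue a b c \<epsilon>))"

definition circle_prob :: "circle measure \<Rightarrow> bool"
  where "circle_prob \<mu> \<longleftrightarrow> prob_space \<mu> \<and> sets \<mu> = sets borel"

definition J_functional ::
  "(circle \<Rightarrow> real) \<Rightarrow> (circle \<Rightarrow> real) \<Rightarrow> circle measure \<Rightarrow> ereal"
  where "J_functional a b \<mu> =
    (SUP c \<in> {c. continuous_on UNIV c}. ereal ((\<integral>p. c p \<partial>\<mu>) - Lambda_limit a b c))"

definition measure_support :: "'a::topological_space measure \<Rightarrow> 'a set"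
  where "measure_support \<mu> = {x. \<forall>U. open U \<and> x \<in> U \<longrightarrow> emeasure \<mu> U > 0}"


section \<open>The zero set\<close>

definition zero_set :: "(circle \<Rightarrow> real) \<Rightarrow> circle set"
  where "zero_set b = {p. b p = 0}"

definition isolated_zeros :: "(circle \<Rightarrow> real) \<Rightarrow> circle set"
  where "isolated_zeros b = {p. \<exists>U. open U \<and> U \<inter> zero_set b = {p}}"

definition nondegenerate_interval :: "circle set \<Rightarrow> bool"
  where "nondegenerate_interval I \<longleftrightarrow>
    (\<exists>S :: real set. is_interval S \<and> (\<exists>s\<in>S. \<exists>t\<in>S. s < t) \<and> I = abs_circle ` S)"

definition zero_intervals :: "(circle \<Rightarrow> real) \<Rightarrow> circle set set"
  where "zero_intervals b =
    {I. nondegenerate_interval I \<and> I \<subseteq> zero_set b \<and>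
        (\<forall>I'. nondegenerate_interval I' \<and> I' \<subseteq> zero_set b \<and> I \<subseteq> I' \<longrightarrow> I' = I)}"

end

theory Submission
  imports Defs
begin

text \<open>
  The limit of the principal eigenvalue is
  \<open>\<Lambda>(c) = sup {c(p) - max 0 (b'(p)) | b(p) = 0}\<close>, from which both claims follow: if \<open>\<mu>\<close> lives on
  the zero set, the supremum defining \<open>J(\<mu>)\<close> is attained at \<open>c = max 0 b'\<close>, and otherwise
  \<open>c = K b\<^sup>2\<close> with \<open>K\<close> tending to infinity has \<open>\<Lambda>(c) \<le> 0\<close> and unbounded integral.

  The upper bound for \<open>\<Lambda>\<close> comes from the supersolution \<open>exp (- \<Theta> / \<epsilon>)\<close> with
  \<open>\<Theta>' = \<theta> b / a\<close> and \<open>0 < \<theta> < 1\<close>: applying the operator and dividing by the function gives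
  \<open>c - a (\<theta> b / a)' - \<theta> (1 - \<theta>) b\<^sup>2 / (\<epsilon> a)\<close>, which is very negative away from the zeros of \<open>b\<close> and
  equals \<open>c - \<theta> b'\<close> at the zeros. The lower bound comes from subsolutions
  supported in an interval of size \<open>sqrt \<epsilon>\<close> around a zero of \<open>b\<close>. Both are compared with a
  positive eigenfunction, which is found by a shooting argument.
\<close>

section \<open>Linear ordinary differential equations\<close>

text \<open>The weight \<open>\<theta>\<close> in the supersolution cannot simply be a constant. At
  a zero of \<open>b\<close> the loss \<open>\<theta> b'\<close> has to be close to
  \<open>max 0 b'\<close>, so \<open>\<theta>\<close> must be near 1 where \<open>b' > 0\<close> and
  near 0 where \<open>b' < 0\<close>; and \<open>\<Theta>\<close> must be periodic, so
  \<open>\<theta> b / a\<close> must have mean zero. A logistic function of \<open>K q + s b\<close>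
  with \<open>q\<close> close to \<open>b'\<close> meets both demands: the term \<open>s b\<close>
  disappears at the zeros of \<open>b\<close>, so \<open>s\<close> remains free, and since
  \<open>b\<close> takes both signs, some \<open>s\<close> gives mean zero. The scale
  \<open>sqrt \<epsilon>\<close> of the subsolutions is the one on which diffusion and linearised
  drift have the same order; a large multiple of it makes the Dirichlet cost small. The principal
  eigenvalue is defined through complex eigenfunctions, so the positive eigenfunction must also
  dominate every complex eigenvalue and exclude others with the same real part. Isolated zeros and
  zero intervals are treated alike until the end, where \<open>b' = 0\<close> on an interval removes
  its contribution.\<close>

lemma antiderivative_exists:
  fixes g :: "real \<Rightarrow> 'a::euclidean_space"
  assumes "continuous_on UNIV g"
  shows "\<exists>G. G 0 = 0 \<and> (\<forall>t. (G has_vector_derivative g t) (at t))"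
proof -
  have "\<exists>F. \<forall>x. - \<infinity> < ereal x \<longrightarrow> ereal x < \<infinity> \<longrightarrow> (F has_vector_derivative g x) (at x)"
    by (rule einterval_antiderivative)
       (use assms in \<open>auto simp: continuous_on_eq_continuous_at\<close>)
  then obtain F where "\<And>x. (F has_vector_derivative g x) (at x)"
    by auto
  then have "((\<lambda>t. F t - F 0) has_vector_derivative g t) (at t)" for t
    using has_vector_derivative_diff_const by blast
  then show ?thesis
    by (intro exI[of _ "\<lambda>t. F t - F 0"]) auto
qed

text \<open>One Picard step: for positive arguments the derivative of the claimed bound is exactly
  the bound assumed for \<open>g\<close>, so integration passes from one term of the exponential
  series to the next. Negative \<open>t\<close> is handled by reflection.\<close>

lemma norm_le_power_fact_of_derivative:
  fixes G :: "real \<Rightarrow> 'a::euclidean_space"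
  assumes G: "\<And>t. (G has_vector_derivative g t) (at t)" and G0: "G 0 = 0"
    and g: "\<And>t. norm (g t) \<le> K * (C * (K * \<bar>t\<bar>) ^ n / fact n)"
  shows "norm (G t) \<le> C * (K * \<bar>t\<bar>) ^ Suc n / fact (Suc n)"
proof -
  have pos: "norm (H t) \<le> C * (K * \<bar>t\<bar>) ^ Suc n / fact (Suc n)"
    if "0 < t" and H: "\<And>s. (H has_vector_derivative h s) (at s)" and "H 0 = 0"
      and h: "\<And>s. norm (h s) \<le> K * (C * (K * \<bar>s\<bar>) ^ n / fact n)"
    for H h :: "real \<Rightarrow> 'a" and t
  proof -
    let ?\<phi> = "\<lambda>s. C * (K * s) ^ Suc n / fact (Suc n)"
    have \<phi>: "(?\<phi> has_vector_derivative K * (C * (K * s) ^ n / fact n)) (at s)" for s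
    proof -
      have "((\<lambda>s. (K * s) ^ Suc n) has_real_derivative (1 + real n) * (K * s) ^ n * K) (at s)"
        using DERIV_power_Suc[OF DERIV_cmult_Id[of K s UNIV], of n]
        by (simp only: mult_ac)
      from DERIV_cdivide[OF DERIV_cmult[OF this, of C], of "fact (Suc n)"] show ?thesis
        by (simp add: has_real_derivative_iff_has_vector_derivative field_simps
            del: of_nat_Suc power_Suc flip: of_nat_Suc)
    qed
    have "norm (H t - H 0) \<le> ?\<phi> t - ?\<phi> 0"
    proof (rule differentiable_bound_general[OF \<open>0 < t\<close>, where f' = h and \<phi>' = "\<lambda>s. K * (C * (K * s) ^ n / fact n)"])
      show "continuous_on {0..t} H" "continuous_on {0..t} ?\<phi>"
        using H \<phi> by (auto intro!: continuous_at_imp_continuous_on has_vector_derivative_continuous)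
      show "norm (h x) \<le> K * (C * (K * x) ^ n / fact n)" if "0 < x" "x < t" for x
        using h[of x] that by simp
    qed (use H \<phi> in auto)
    then show ?thesis
      using that by simp
  qed
  consider "t = 0" | "t > 0" | "t < 0" by linarith
  then show ?thesis
  proof cases
    case 3
    have "((\<lambda>s. G (- s)) has_vector_derivative - g (- s)) (at s)" for s
      using vector_diff_chain_at[OF has_vector_derivative_minus[OF has_vector_derivative_id] G, of s]
      by (simp add: o_def)
    moreover have "norm (- g (- s)) \<le> K * (C * (K * \<bar>s\<bar>) ^ n / fact n)" for s
      using g[of "- s"] by simp
    ultimately show ?thesis
      using pos[of "- t" "\<lambda>s. G (- s)" "\<lambda>s. - g (- s)"] G0 3 by simp
  qed (use G0 pos[OF _ G G0 g] in auto)
qed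

text \<open>Picard iteration written through its increments \<open>d n\<close>: each is the
  antiderivative of \<open>F\<close> applied to the previous one and is dominated by a term of the
  series of \<open>exp (K |t|)\<close>. The sum therefore exists on the whole line and may be
  differentiated term by term.\<close>

lemma linear_ode_exists:
  fixes F :: "real \<Rightarrow> 'a::euclidean_space \<Rightarrow> 'a" and y0 :: 'a
  assumes lin: "\<And>t. bounded_linear (F t)"
    and bound: "\<And>t y. norm (F t y) \<le> K * norm y"
    and cont: "\<And>y. continuous_on UNIV y \<Longrightarrow> continuous_on UNIV (\<lambda>t. F t (y t))"
    and K: "K \<ge> 0"
  shows "\<exists>y. y 0 = y0 \<and> (\<forall>t. (y has_vector_derivative F t (y t)) (at t))"
proof -
  define A where "A g = (SOME G. G 0 = 0 \<and> (\<forall>t. (G has_vector_derivative g t) (at t)))"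
    for g :: "real \<Rightarrow> 'a"
  have A: "A g 0 = 0" "(A g has_vector_derivative g t) (at t)" if "continuous_on UNIV g" for g t
    using someI_ex[OF antiderivative_exists[OF that]] unfolding A_def by blast+
  define d where "d = rec_nat (\<lambda>_. y0) (\<lambda>_ e. A (\<lambda>t. F t (e t)))"
  have d0: "d 0 = (\<lambda>_. y0)" and dS: "d (Suc n) = A (\<lambda>t. F t (d n t))" for n
    by (simp_all add: d_def)
  have dc: "continuous_on UNIV (d n)" for n
  proof (induction n)
    case (Suc n)
    show ?case
      unfolding dS using A(2)[OF cont[OF Suc]]
      by (auto intro!: continuous_at_imp_continuous_on has_vector_derivative_continuous)
  qed (simp add: d0)
  note AS = A[OF cont[OF dc]]
  have db: "norm (d n t) \<le> norm y0 * (K * \<bar>t\<bar>) ^ n / fact n" for n t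
  proof (induction n arbitrary: t)
    case (Suc n)
    show ?case
      unfolding dS
    proof (rule norm_le_power_fact_of_derivative[OF AS(2) AS(1)])
      show "norm (F t (d n t)) \<le> K * (norm y0 * (K * \<bar>t\<bar>) ^ n / fact n)" for t
        using bound[of t "d n t"] mult_left_mono[OF Suc[of t] K] by linarith
    qed
  qed (simp add: d0)
  define y where "y t = (\<Sum>n. d n t)" for t
  have summ: "summable (\<lambda>n. norm y0 * (K * T) ^ n / fact n)" for T
    using summable_mult[OF summable_exp[of "K * T"], of "norm y0"] by (simp add: divide_inverse mult_ac)
  have dbT: "norm (d n t) \<le> norm y0 * (K * T) ^ n / fact n" if "\<bar>t\<bar> \<le> T" for n t T
    by (rule order.trans[OF db])
       (use that K in \<open>auto intro!: divide_right_mono mult_left_mono power_mono\<close>)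
  have ds: "(\<lambda>n. d n t) sums y t" for t
    unfolding y_def
    by (rule summable_sums, rule summable_comparison_test'[OF summ[of "\<bar>t\<bar>"]]) (use dbT in auto)
  have y0: "y 0 = y0"
  proof -
    have "(\<lambda>n. d n 0) = (\<lambda>n. if n = 0 then y0 else 0)"
      by (auto simp: fun_eq_iff d0 dS AS gr0_conv_Suc)
    then have "(\<lambda>n. d n 0) sums y0"
      using sums_single[of 0 "\<lambda>_. y0"] by simp
    then show ?thesis
      using ds[of 0] sums_unique2 by blast
  qed
  have "(y has_vector_derivative F t (y t)) (at t)" for t
  proof -
    define S where "S = {- (\<bar>t\<bar> + 1) <..< \<bar>t\<bar> + 1}"
    have t: "t \<in> S" "open S" by (auto simp: S_def)
    \<comment> \<open>The derivative of increment \<open>Suc m\<close> is \<open>F\<close> applied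
      to increment \<open>m\<close>, and increment 0 is constant. The derivative series is thus the
      shifted series, which is why partial sums up to \<open>Suc n\<close> are compared
      below.\<close>
    define f' where "f' n s h = (case n of 0 \<Rightarrow> 0 | Suc m \<Rightarrow> h *\<^sub>R F s (d m s))" for n s and h :: real
    have "\<exists>g. \<forall>s\<in>S. (\<lambda>n. d n s) sums (g s) \<and> (g has_derivative (\<lambda>h. h *\<^sub>R F s (y s))) (at s within S)"
    proof (rule has_derivative_series[where f' = f'])
      show "convex S" by (simp add: S_def)
      show "(d n has_derivative f' n x) (at x within S)" for n x
      proof (cases n)
        case (Suc m)
        have "(d n has_vector_derivative F x (d m x)) (at x)"
          using AS(2)[of m x] by (simp add: Suc dS)
        then show ?thesis
          unfolding has_vector_derivative_def f'_def Suc
          by (auto intro: has_derivative_at_withinI)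
      next
        case 0
        have "f' 0 x = (\<lambda>_. 0)"
          by (auto simp: f'_def)
        then show ?thesis
          by (simp add: 0 d0)
      qed
      show "\<forall>\<^sub>F n in sequentially. \<forall>x\<in>S. \<forall>h. norm ((\<Sum>i<n. f' i x h) - h *\<^sub>R F x (y x)) \<le> e * norm h"
        if "0 < e" for e
      proof -
        have "uniform_limit S (\<lambda>n x. \<Sum>i<n. d i x) (\<lambda>x. \<Sum>i. d i x) sequentially"
          by (rule Weierstrass_m_test[OF _ summ[of "\<bar>t\<bar> + 1"]]) (auto simp: S_def intro!: dbT)
        \<comment> \<open>Dividing by \<open>K + 1\<close> covers the case
          \<open>K = 0\<close>.\<close>
        then have "\<forall>\<^sub>F n in sequentially. \<forall>x\<in>S. dist (\<Sum>i<n. d i x) (y x) < e / (K + 1)"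
          unfolding y_def using that K by (intro uniform_limitD) auto
        then have "\<forall>\<^sub>F n in sequentially. \<forall>x\<in>S. \<forall>h. norm ((\<Sum>i<Suc n. f' i x h) - h *\<^sub>R F x (y x)) \<le> e * norm h"
        proof (rule eventually_mono, intro ballI allI)
          fix n x and h :: real
          assume "\<forall>x\<in>S. dist (\<Sum>i<n. d i x) (y x) < e / (K + 1)" and x: "x \<in> S"
          then have *: "norm ((\<Sum>i<n. d i x) - y x) \<le> e / (K + 1)"
            by (auto simp: dist_norm intro: less_imp_le)
          have "(\<Sum>i<Suc n. f' i x h) = h *\<^sub>R F x (\<Sum>i<n. d i x)"
            unfolding sum.lessThan_Suc_shift
            by (simp add: f'_def scaleR_sum_right linear_sum[OF bounded_linear.linear[OF lin]])
          then have "norm ((\<Sum>i<Suc n. f' i x h) - h *\<^sub>R F x (y x)) = \<bar>h\<bar> * norm (F x ((\<Sum>i<n. d i x) - y x))"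
            by (simp add: linear_diff[OF bounded_linear.linear[OF lin]] flip: scaleR_diff_right)
          also have "\<dots> \<le> \<bar>h\<bar> * (K * norm ((\<Sum>i<n. d i x) - y x))"
            by (intro mult_left_mono bound) auto
          also have "\<dots> \<le> \<bar>h\<bar> * (K * (e / (K + 1)))"
            by (intro mult_left_mono * K) auto
          also have "\<dots> \<le> \<bar>h\<bar> * e"
            using K that by (intro mult_left_mono) (auto simp: field_simps)
          finally show "norm ((\<Sum>i<Suc n. f' i x h) - h *\<^sub>R F x (y x)) \<le> e * norm h"
            by (simp add: mult.commute)
        qed
        then show ?thesis
          by (subst eventually_sequentially_Suc[symmetric])
      qed
      show "t \<in> S" by fact
      show "(\<lambda>n. d n t) sums y t" by (rule ds)
    qed
    then obtain g where g: "\<And>s. s \<in> S \<Longrightarrow> (\<lambda>n. d n s) sums (g s)"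
      and g': "\<And>s. s \<in> S \<Longrightarrow> (g has_derivative (\<lambda>h. h *\<^sub>R F s (y s))) (at s within S)"
      by blast
    have gy: "y s = g s" if "s \<in> S" for s
      using g[OF that] ds[of s] sums_unique2 by blast
    have "(y has_derivative (\<lambda>h. h *\<^sub>R F t (y t))) (at t within S)"
      by (rule has_derivative_transform[OF t(1) gy g'[OF t(1)]])
    then show ?thesis
      by (simp add: has_vector_derivative_def at_within_open[OF t])
  qed
  with y0 show ?thesis by blast
qed

text \<open>The function \<open>exp (- (2 K + 1) t) |z|\<^sup>2 - g\<^sup>2 t\<close> is nonincreasing.\<close>

lemma gronwall_perturbation:
  fixes z :: "real \<Rightarrow> 'a::euclidean_space"
  assumes z: "\<And>t. (z has_vector_derivative z' t) (at t)" and z0: "z 0 = 0"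
    and bnd: "\<And>t. 0 \<le> t \<Longrightarrow> t \<le> T \<Longrightarrow> norm (z' t) \<le> K * norm (z t) + g"
    and K: "K \<ge> 0" and t: "0 \<le> t" "t \<le> T"
  shows "(norm (z t))\<^sup>2 \<le> g\<^sup>2 * t * exp ((2 * K + 1) * t)"
proof -
  let ?h = "\<lambda>s. exp (- (2 * K + 1) * s) * (z s \<bullet> z s) - g\<^sup>2 * s"
  have "?h t \<le> ?h 0"
  proof (rule DERIV_nonpos_imp_nonincreasing[OF t(1)])
    fix s assume s: "0 \<le> s" "s \<le> t"
    let ?D = "exp (- (2 * K + 1) * s) * (2 * (z s \<bullet> z' s) - (2 * K + 1) * (z s \<bullet> z s)) - g\<^sup>2"
    have ip: "((\<lambda>s. z s \<bullet> z s) has_real_derivative 2 * (z s \<bullet> z' s)) (at s)"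
      using bounded_bilinear.has_vector_derivative[OF bounded_bilinear_inner z z, of s]
      by (simp add: has_real_derivative_iff_has_vector_derivative inner_commute)
    have D: "(?h has_real_derivative ?D) (at s)"
      by (auto intro!: derivative_eq_intros ip simp: algebra_simps)
    have "2 * (z s \<bullet> z' s) \<le> 2 * (norm (z s) * norm (z' s))"
      by (simp add: norm_cauchy_schwarz)
    also have "\<dots> \<le> 2 * (norm (z s) * (K * norm (z s) + g))"
      using bnd[of s] s t by (intro mult_left_mono) auto
    \<comment> \<open>The inequality \<open>2 |z| g <= |z|^2 + g^2\<close> separates off the
      inhomogeneity; it is the origin of the extra 1 in the exponent.\<close>
    also have "\<dots> \<le> (2 * K + 1) * (norm (z s))\<^sup>2 + g\<^sup>2"
      using sum_squares_bound[of "norm (z s)" g] by (simp add: algebra_simps power2_eq_square)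
    finally have *: "2 * (z s \<bullet> z' s) - (2 * K + 1) * (z s \<bullet> z s) \<le> g\<^sup>2"
      by (simp add: power2_norm_eq_inner)
    have "exp (- (2 * K + 1) * s) * (2 * (z s \<bullet> z' s) - (2 * K + 1) * (z s \<bullet> z s))
        \<le> exp (- (2 * K + 1) * s) * g\<^sup>2"
      by (intro mult_left_mono *) auto
    also have "\<dots> \<le> 1 * g\<^sup>2"
      using s K by (intro mult_right_mono) (auto simp: mult_nonpos_nonneg)
    finally have "?D \<le> 0" by simp
    with D show "\<exists>y. (?h has_real_derivative y) (at s) \<and> y \<le> 0" by blast
  qed
  then have "exp (- (2 * K + 1) * t) * (norm (z t))\<^sup>2 \<le> g\<^sup>2 * t"
    using z0 by (simp add: power2_norm_eq_inner)
  then have "exp ((2 * K + 1) * t) * (exp (- (2 * K + 1) * t) * (norm (z t))\<^sup>2) \<le> exp ((2 * K + 1) * t) * (g\<^sup>2 * t)"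
    by (intro mult_left_mono) auto
  also have "exp ((2 * K + 1) * t) * (exp (- (2 * K + 1) * t) * (norm (z t))\<^sup>2) = (norm (z t))\<^sup>2"
    by (simp add: algebra_simps flip: mult.assoc exp_add)
  finally show ?thesis
    by (simp only: mult_ac)
qed

section \<open>Periodic coefficients\<close>

definition periodic :: "(real \<Rightarrow> 'a) \<Rightarrow> bool"
  where "periodic f \<longleftrightarrow> (\<forall>t. f (t + 1) = f t)"

lemma periodic_add_Ints:
  assumes "periodic f" "k \<in> \<int>"
  shows "f (t + k) = f t"
proof -
  have nat: "f (t + real n) = f t" for n t
  proof (induction n)
    case (Suc n)
    have "f (t + real (Suc n)) = f (t + real n + 1)"
      by (simp add: add_ac)
    then show ?case
      using assms(1) Suc by (simp add: periodic_def)
  qed simp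
  obtain i :: int where i: "k = of_int i"
    using assms(2) by (elim Ints_cases)
  show ?thesis
  proof (cases "i \<ge> 0")
    case True
    then show ?thesis using nat[of t "nat i"] i by simp
  next
    case False
    then show ?thesis using nat[of "t + k" "nat (- i)"] i by simp
  qed
qed

lemma periodic_frac: "periodic f \<Longrightarrow> f (frac t) = f t"
  using periodic_add_Ints[of f "- of_int \<lfloor>t\<rfloor>" t] by (simp add: frac_def)

lemma periodic_circle: "periodic (\<lambda>t. f (abs_circle t))"
  by (auto simp: periodic_def intro!: arg_cong[where f = f] simp: abs_circle_eq_iff)

lemma periodic_attains_sup:
  fixes f :: "real \<Rightarrow> real"
  assumes "periodic f" "continuous_on UNIV f"
  obtains p where "\<And>t. f t \<le> f p"
proof -
  have "continuous_on {0..1} f"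
    using assms(2) continuous_on_subset by blast
  then obtain p where p: "p \<in> {0..1}" "\<And>t. t \<in> {0..1} \<Longrightarrow> f t \<le> f p"
    using continuous_attains_sup[of "{0..1::real}" f] by auto
  have "f t \<le> f p" for t
    using p(2)[of "frac t"] periodic_frac[OF assms(1), of t] frac_lt_1[of t] by simp
  then show ?thesis using that by blast
qed

lemma periodic_bounded:
  fixes f :: "real \<Rightarrow> real"
  assumes "periodic f" "continuous_on UNIV f"
  obtains M where "M > 0" "\<And>t. \<bar>f t\<bar> \<le> M"
proof -
  obtain p where p: "\<And>t. \<bar>f t\<bar> \<le> \<bar>f p\<bar>"
    by (rule periodic_attains_sup[of "\<lambda>t. \<bar>f t\<bar>"])
       (use assms in \<open>auto simp: periodic_def intro: continuous_intros\<close>)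
  show ?thesis
    by (rule that[of "\<bar>f p\<bar> + 1"]) (use p in \<open>auto intro: add_increasing2\<close>)
qed

lemma periodic_has_derivative:
  fixes f :: "real \<Rightarrow> real"
  assumes "periodic f" and f': "\<And>t. (f has_real_derivative f' t) (at t)"
  shows "periodic f'"
proof -
  have "((\<lambda>s. f (s + 1)) has_real_derivative f' (t + 1)) (at t)" for t
    using f'[of "t + 1"] by (simp add: DERIV_shift)
  then have "(f has_real_derivative f' (t + 1)) (at t)" for t
    using assms(1) by (simp add: periodic_def)
  then show ?thesis
    unfolding periodic_def using f' DERIV_unique by blast
qed

lemma has_vector_derivative_Pair_real:
  assumes "(f has_real_derivative f') (at t)" "(g has_real_derivative g') (at t)"
  shows "((\<lambda>s. (f s, g s)) has_vector_derivative (f', g')) (at t)"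
  using assms unfolding has_real_derivative_iff_has_vector_derivative
  by (rule has_vector_derivative_Pair)

text \<open>The operator \<open>A u'' + B u' + C u\<close>; in \<open>solves l u v\<close> below, \<open>v\<close> is \<open>u'\<close>.\<close>

locale periodic_elliptic =
  fixes A B C :: "real \<Rightarrow> real"
  assumes cont: "continuous_on UNIV A" "continuous_on UNIV B" "continuous_on UNIV C"
    and per: "periodic A" "periodic B" "periodic C"
    and A_pos: "\<And>t. A t > 0"
begin

definition solves :: "real \<Rightarrow> (real \<Rightarrow> real) \<Rightarrow> (real \<Rightarrow> real) \<Rightarrow> bool"
  where "solves l u v \<longleftrightarrow> (\<forall>t. (u has_real_derivative v t) (at t) \<and>
     (v has_real_derivative ((l - C t) * u t - B t * v t) / A t) (at t))"

lemma coeff_bounds: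
  obtains m M where "m > 0" "M > 0" "\<And>t. m \<le> A t" "\<And>t. \<bar>B t\<bar> \<le> M" "\<And>t. \<bar>C t\<bar> \<le> M"
proof -
  obtain p where p: "\<And>t. - A t \<le> - A p"
    by (rule periodic_attains_sup[of "\<lambda>t. - A t"])
       (use cont per in \<open>auto simp: periodic_def intro: continuous_intros\<close>)
  obtain M1 where M1: "\<And>t. \<bar>B t\<bar> \<le> M1" "M1 > 0"
    using periodic_bounded[OF per(2) cont(2)] by metis
  obtain M2 where M2: "\<And>t. \<bar>C t\<bar> \<le> M2" "M2 > 0"
    using periodic_bounded[OF per(3) cont(3)] by metis
  show ?thesis
  proof (rule that)
    show "A p > 0" by (rule A_pos)
    show "max M1 M2 > 0" using M1(2) by simp
    show "A p \<le> A t" for t using p[of t] by simp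
    show "\<bar>B t\<bar> \<le> max M1 M2" "\<bar>C t\<bar> \<le> max M1 M2" for t
      using M1(1)[of t] M2(1)[of t] by auto
  qed
qed

text \<open>The bound is uniform for \<open>l\<close> within distance 1 of \<open>L\<close>, so that
  one Gronwall constant serves all nearby parameters.\<close>

lemma operator_bound:
  obtains m K where "m > 0" "K \<ge> 0" "\<And>t. m \<le> A t"
    "\<And>l t x y. \<bar>l - L\<bar> \<le> 1 \<Longrightarrow> norm (y, ((l - C t) * x - B t * y) / A t) \<le> K * norm (x, y)"
proof -
  obtain m M where m: "m > 0" "M > 0" "\<And>t. m \<le> A t" "\<And>t. \<bar>B t\<bar> \<le> M" "\<And>t. \<bar>C t\<bar> \<le> M"
    using coeff_bounds by metis
  define K where "K = 1 + ((\<bar>L\<bar> + 1 + M) + M) / m"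
  have K: "K \<ge> 0" using m by (simp add: K_def)
  have "norm (y, ((l - C t) * x - B t * y) / A t) \<le> K * norm (x, y)" if l: "\<bar>l - L\<bar> \<le> 1" for l t x y
  proof -
    have xy: "\<bar>x\<bar> \<le> norm (x, y)" "\<bar>y\<bar> \<le> norm (x, y)"
      by (simp_all add: norm_Pair real_le_rsqrt)
    have "\<bar>(l - C t) * x - B t * y\<bar> \<le> \<bar>l - C t\<bar> * \<bar>x\<bar> + \<bar>B t\<bar> * \<bar>y\<bar>"
      by (metis abs_mult abs_triangle_ineq4)
    also have "\<dots> \<le> (\<bar>L\<bar> + 1 + M) * norm (x, y) + M * norm (x, y)"
      using l m(4)[of t] m(5)[of t] by (intro add_mono mult_mono xy) auto
    finally have *: "\<bar>(l - C t) * x - B t * y\<bar> \<le> ((\<bar>L\<bar> + 1 + M) + M) * norm (x, y)"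
      by (simp add: algebra_simps)
    have "\<bar>((l - C t) * x - B t * y) / A t\<bar> \<le> (((\<bar>L\<bar> + 1 + M) + M) * norm (x, y)) / m"
      unfolding abs_divide using m * A_pos[of t] by (intro frac_le) auto
    then show ?thesis
      using norm_Pair_le[of y "((l - C t) * x - B t * y) / A t"] xy(2)
      by (simp add: K_def algebra_simps)
  qed
  then show ?thesis
    using that[of m K] m(1,3) K by metis
qed

lemma solves_exists: "\<exists>u v. u 0 = \<alpha> \<and> v 0 = \<beta> \<and> solves l u v"
proof -
  define F where "F t p = (snd p, ((l - C t) * fst p - B t * snd p) / A t)" for t and p :: "real \<times> real"
  obtain m K where K: "K \<ge> 0"
    "\<And>t x y. norm (y, ((l - C t) * x - B t * y) / A t) \<le> K * norm (x, y)"
    using operator_bound[of l] by (metis abs_zero diff_self zero_le_one)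
  have nz: "A t \<noteq> 0" for t
    using A_pos[of t] by simp
  have bnd: "norm (F t p) \<le> K * norm p" for t p
    using K(2) by (cases p) (simp add: F_def)
  have lin: "bounded_linear (F t)" for t
    by (rule bounded_linear_intro[where K = K])
       (use bnd nz in \<open>auto simp: F_def field_simps\<close>)
  have "continuous_on UNIV (\<lambda>t. F t (y t))" if "continuous_on UNIV y" for y
    unfolding F_def using that cont nz by (intro continuous_intros) auto
  from linear_ode_exists[OF lin bnd this K(1), of "(\<alpha>, \<beta>)"]
  obtain y where y: "y 0 = (\<alpha>, \<beta>)" "\<And>t. (y has_vector_derivative F t (y t)) (at t)"
    by blast
  have "((\<lambda>t. fst (y t)) has_real_derivative snd (y t)) (at t)"
    "((\<lambda>t. snd (y t)) has_real_derivative ((l - C t) * fst (y t) - B t * snd (y t)) / A t) (at t)" for t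
    using bounded_linear.has_vector_derivative[OF bounded_linear_fst y(2), of t]
      bounded_linear.has_vector_derivative[OF bounded_linear_snd y(2), of t]
    by (simp_all add: F_def has_real_derivative_iff_has_vector_derivative)
  then show ?thesis
    using y(1) by (intro exI[of _ "\<lambda>t. fst (y t)"] exI[of _ "\<lambda>t. snd (y t)"]) (simp add: solves_def)
qed

text \<open>Gronwall with inhomogeneity 0, applied from \<open>x\<close> in both directions; the
  sign \<open>\<sigma>\<close> selects the direction.\<close>

lemma solves_zero:
  assumes "solves l u v" "u x = 0" "v x = 0"
  shows "u t = 0" "v t = 0"
proof -
  obtain m K where K: "K \<ge> 0"
    "\<And>t x y. norm (y, ((l - C t) * x - B t * y) / A t) \<le> K * norm (x, y)"
    using operator_bound[of l] by (metis abs_zero diff_self zero_le_one)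
  note D = assms(1)[unfolded solves_def, rule_format]
  have *: "(u (x + \<sigma> * s), v (x + \<sigma> * s)) = 0" if "s \<ge> 0" "\<sigma> = 1 \<or> \<sigma> = - 1" for s \<sigma>
  proof -
    let ?z = "\<lambda>s. (u (x + \<sigma> * s), v (x + \<sigma> * s))"
    let ?w = "\<lambda>s. ((l - C (x + \<sigma> * s)) * u (x + \<sigma> * s) - B (x + \<sigma> * s) * v (x + \<sigma> * s)) / A (x + \<sigma> * s)"
    have a: "((\<lambda>s. x + \<sigma> * s) has_real_derivative \<sigma>) (at s)" for s
      by (auto intro!: derivative_eq_intros)
    have d: "(?z has_vector_derivative (v (x + \<sigma> * s) * \<sigma>, ?w s * \<sigma>)) (at s)" for s
      by (rule has_vector_derivative_Pair_real) (rule DERIV_chain2[OF conjunct1[OF D] a] DERIV_chain2[OF conjunct2[OF D] a])+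
    have b: "norm (v (x + \<sigma> * s) * \<sigma>, ?w s * \<sigma>) \<le> K * norm (?z s) + 0" for s
    proof -
      have "(v (x + \<sigma> * s) * \<sigma>, ?w s * \<sigma>) = \<sigma> *\<^sub>R (v (x + \<sigma> * s), ?w s)"
        by (simp add: mult.commute)
      then have "norm (v (x + \<sigma> * s) * \<sigma>, ?w s * \<sigma>) = norm (v (x + \<sigma> * s), ?w s)"
        using that(2) by (auto simp only: norm_scaleR abs_one abs_minus_cancel mult_1)
      then show ?thesis
        using K(2)[of "v (x + \<sigma> * s)" "x + \<sigma> * s" "u (x + \<sigma> * s)"] by simp
    qed
    have "(norm (?z s))\<^sup>2 \<le> 0\<^sup>2 * s * exp ((2 * K + 1) * s)"
      by (rule gronwall_perturbation[OF d _ b K(1) that(1) order_refl]) (use assms in \<open>simp add: zero_prod_def\<close>)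
    then show ?thesis by simp
  qed
  have "(u t, v t) = 0"
    using *[of "t - x" 1] *[of "x - t" "-1"] by (cases "t \<ge> x") auto
  then show "u t = 0" "v t = 0" by (simp_all add: zero_prod_def)
qed

lemma solves_lincomb:
  assumes "solves l u v" "solves l u2 v2"
  shows "solves l (\<lambda>t. p * u t + q * u2 t) (\<lambda>t. p * v t + q * v2 t)"
  unfolding solves_def
proof (intro allI conjI)
  fix t
  note D = assms[unfolded solves_def, rule_format, of t]
  show "((\<lambda>t. p * u t + q * u2 t) has_real_derivative p * v t + q * v2 t) (at t)"
    using D by (auto intro!: derivative_eq_intros)
  have "((\<lambda>t. p * v t + q * v2 t) has_real_derivative
      p * (((l - C t) * u t - B t * v t) / A t) + q * (((l - C t) * u2 t - B t * v2 t) / A t)) (at t)"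
    using D by (intro DERIV_add DERIV_cmult) auto
  then show "((\<lambda>t. p * v t + q * v2 t) has_real_derivative
      ((l - C t) * (p * u t + q * u2 t) - B t * (p * v t + q * v2 t)) / A t) (at t)"
    by (rule DERIV_cong) (use A_pos[of t] in \<open>simp add: field_simps\<close>)
qed

lemma solves_unique:
  assumes "solves l u v" "solves l u2 v2" "u x = u2 x" "v x = v2 x"
  shows "u = u2" "v = v2"
  using solves_zero[OF solves_lincomb[OF assms(1,2), of 1 "-1"], of x] assms(3,4)
  by (auto simp: fun_eq_iff)

lemma solves_periodic:
  assumes "solves l u v" "u 1 = u 0" "v 1 = v 0"
  shows "periodic u" "periodic v"
proof -
  have "solves l (\<lambda>t. u (t + 1)) (\<lambda>t. v (t + 1))"
    unfolding solves_def
  proof (intro allI)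
    fix t
    have "A (t + 1) = A t" "B (t + 1) = B t" "C (t + 1) = C t"
      using per by (auto simp: periodic_def)
    then show "((\<lambda>t. u (t + 1)) has_real_derivative v (t + 1)) (at t) \<and>
       ((\<lambda>t. v (t + 1)) has_real_derivative ((l - C t) * u (t + 1) - B t * v (t + 1)) / A t) (at t)"
      using assms(1)[unfolded solves_def, rule_format, of "t + 1"] by (simp add: DERIV_shift)
  qed
  from solves_unique[OF this assms(1), of 0] assms(2,3)
  show "periodic u" "periodic v" by (auto simp: periodic_def fun_eq_iff)
qed

lemma solves_continuous:
  assumes "solves l u v"
  shows "continuous_on S u" "continuous_on S v"
  using assms unfolding solves_def
  by (meson DERIV_isCont continuous_at_imp_continuous_on)+

text \<open>The difference of two solutions with equal initial data solves the equation with the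
  inhomogeneity \<open>(l - L) * (u L s / A s)\<close>, which is bounded on the unit interval, so
  Gronwall applies. This makes the shooting quantities continuous in \<open>l\<close>.\<close>

lemma solves_lipschitz:
  assumes "\<And>l. solves l (u l) (v l)" "\<And>l. u l 0 = \<alpha>" "\<And>l. v l 0 = \<beta>"
  obtains G where "G > 0" "\<And>l t. \<bar>l - L\<bar> \<le> 1 \<Longrightarrow> 0 \<le> t \<Longrightarrow> t \<le> 1 \<Longrightarrow> \<bar>u l t - u L t\<bar> \<le> G * \<bar>l - L\<bar>"
    "\<And>l t. \<bar>l - L\<bar> \<le> 1 \<Longrightarrow> 0 \<le> t \<Longrightarrow> t \<le> 1 \<Longrightarrow> \<bar>v l t - v L t\<bar> \<le> G * \<bar>l - L\<bar>"
proof -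
  obtain m K where m: "m > 0" "K \<ge> 0" "\<And>t. m \<le> A t"
    and K: "\<And>l t x y. \<bar>l - L\<bar> \<le> 1 \<Longrightarrow> norm (y, ((l - C t) * x - B t * y) / A t) \<le> K * norm (x, y)"
    using operator_bound[of L] by metis
  have "compact (u L ` {0..1})"
    by (intro compact_continuous_image solves_continuous(1)[OF assms(1)]) auto
  then obtain U where U: "U > 0" "\<And>t. 0 \<le> t \<Longrightarrow> t \<le> 1 \<Longrightarrow> \<bar>u L t\<bar> \<le> U"
    using compact_imp_bounded bounded_pos[of "u L ` {0..1}"] by auto
  define G where "G = U / m * exp (2 * K + 1)"
  have main: "norm (u l t - u L t, v l t - v L t) \<le> G * \<bar>l - L\<bar>"
    if l: "\<bar>l - L\<bar> \<le> 1" and t: "0 \<le> t" "t \<le> 1" for l t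
  proof -
    let ?z = "\<lambda>s. (u l s - u L s, v l s - v L s)"
    let ?d = "\<lambda>s. (v l s - v L s, ((l - C s) * u l s - B s * v l s) / A s - ((L - C s) * u L s - B s * v L s) / A s)"
    note D = assms(1)[unfolded solves_def, rule_format]
    have d: "(?z has_vector_derivative ?d s) (at s)" for s
      using D[of l s] D[of L s] by (intro has_vector_derivative_Pair_real DERIV_diff) auto
    define g where "g = \<bar>l - L\<bar> * (U / m)"
    have b: "norm (?d s) \<le> K * norm (?z s) + g" if s: "0 \<le> s" "s \<le> t" for s
    proof -
      have "?d s = (v l s - v L s, ((l - C s) * (u l s - u L s) - B s * (v l s - v L s)) / A s)
          + (0, (l - L) * (u L s / A s))"
        using A_pos[of s] by (simp add: field_simps)
      then have "norm (?d s) \<le> norm (v l s - v L s, ((l - C s) * (u l s - u L s) - B s * (v l s - v L s)) / A s)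
          + norm (0::real, (l - L) * (u L s / A s))"
        using norm_triangle_ineq by metis
      moreover have "\<bar>l - L\<bar> * (\<bar>u L s\<bar> / A s) \<le> g"
        unfolding g_def using U(1) U(2)[of s] s t m by (intro mult_left_mono frac_le) auto
      ultimately show ?thesis
        using K[OF l, of "v l s - v L s" s "u l s - u L s"] A_pos[of s]
        by (simp add: abs_mult)
    qed
    have "(norm (?z t))\<^sup>2 \<le> g\<^sup>2 * t * exp ((2 * K + 1) * t)"
      by (rule gronwall_perturbation[OF d _ b m(2) t(1) order_refl]) (use assms in \<open>auto simp: zero_prod_def\<close>)
    also have "\<dots> \<le> g\<^sup>2 * 1 * exp (2 * K + 1)"
      using t m(2) by (intro mult_mono) (auto simp: mult_left_le)
    \<comment> \<open>Since \<open>exp (2 * K + 1)\<close> is at least 1, squaring it only enlarges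
      the bound and turns it into a perfect square.\<close>
    also have "\<dots> \<le> g\<^sup>2 * (exp (2 * K + 1))\<^sup>2"
      using m(2) by (simp add: mult_left_mono power2_eq_square)
    also have "\<dots> = (G * \<bar>l - L\<bar>)\<^sup>2"
      by (simp add: G_def g_def power_mult_distrib power_divide)
    finally show ?thesis
      by (rule power2_le_imp_le) (use U(1) m(1) in \<open>simp add: G_def\<close>)
  qed
  show ?thesis
  proof (rule that)
    show "G > 0" using U(1) m(1) by (simp add: G_def)
    fix l t assume l: "\<bar>l - L\<bar> \<le> 1" "0 \<le> t" "t \<le> (1::real)"
    have "\<bar>u l t - u L t\<bar> \<le> norm (u l t - u L t, v l t - v L t)" "\<bar>v l t - v L t\<bar> \<le> norm (u l t - u L t, v l t - v L t)"
      by (simp_all add: norm_Pair real_le_rsqrt)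
    with main[OF l] show "\<bar>u l t - u L t\<bar> \<le> G * \<bar>l - L\<bar>" "\<bar>v l t - v L t\<bar> \<le> G * \<bar>l - L\<bar>"
      by linarith+
  qed
qed

end

section \<open>A positive periodic eigenfunction\<close>

text \<open>If \<open>h\<close> were positive, \<open>g\<close> would be positive just to the right
  of its zero \<open>p\<close>, and \<open>f\<close> would rise above its maximum.\<close>

lemma second_derivative_local_max:
  fixes f g :: "real \<Rightarrow> real"
  assumes d: "d > 0" and f: "\<And>t. \<bar>t - p\<bar> < d \<Longrightarrow> (f has_real_derivative g t) (at t)"
    and g: "(g has_real_derivative h) (at p)"
    and max: "\<And>t. \<bar>t - p\<bar> < d \<Longrightarrow> f t \<le> f p"
  shows "g p = 0" "h \<le> 0"
proof -
  show g0: "g p = 0"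
    using DERIV_local_max[OF f d, of p] max d by (simp add: abs_minus_commute)
  show "h \<le> 0"
  proof (rule ccontr)
    assume "\<not> h \<le> 0"
    then obtain e where e: "e > 0" "\<And>s. 0 < s \<Longrightarrow> s < e \<Longrightarrow> g p < g (p + s)"
      using DERIV_pos_inc_right[OF g] by (metis not_le)
    define s where "s = min d e / 2"
    have s: "0 < s" "s < d" "s < e" using d e(1) by (auto simp: s_def)
    have "f p < f (p + s)"
    proof (rule DERIV_pos_imp_increasing_open[where f = f])
      show "p < p + s" using s by simp
    next
      fix x assume x: "p < x" "x < p + s"
      have "g x > 0" using e(2)[of "x - p"] x s g0 by simp
      then show "\<exists>y. (f has_real_derivative y) (at x) \<and> y > 0"
        using f[of x] x s by auto
    next
      show "continuous_on {p..p + s} f"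
        by (intro continuous_at_imp_continuous_on ballI DERIV_isCont[OF f]) (use s in auto)
    qed
    with max[of "p + s"] s show False by simp
  qed
qed

text \<open>At a contact point the first derivatives agree and the second derivatives are ordered.
  Scaling one of two positive functions until it touches the other turns this into a comparison of
  eigenvalues; all comparisons with eigenfunctions below have this form.\<close>

lemma operator_le_at_contact:
  fixes u w :: "real \<Rightarrow> real"
  assumes d: "d > 0"
    and u: "\<And>t. \<bar>t - p\<bar> < d \<Longrightarrow> (u has_real_derivative u1 t) (at t)" "(u1 has_real_derivative u2) (at p)"
    and w: "\<And>t. \<bar>t - p\<bar> < d \<Longrightarrow> (w has_real_derivative w1 t) (at t)" "(w1 has_real_derivative w2) (at p)"
    and contact: "u p = w p" and le: "\<And>t. \<bar>t - p\<bar> < d \<Longrightarrow> u t \<le> w t" and a: "a \<ge> 0"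
  shows "a * u2 + b * u1 p + c * u p \<le> a * w2 + b * w1 p + c * w p"
proof -
  have "u1 p - w1 p = 0" "u2 - w2 \<le> 0"
    using second_derivative_local_max[OF d, of p "\<lambda>t. u t - w t" "\<lambda>t. u1 t - w1 t" "u2 - w2"] assms
    by (auto intro!: DERIV_diff)
  then show ?thesis
    using a contact by (simp add: mult_left_mono)
qed

lemma continuous_attains_sup_interval:
  fixes f :: "real \<Rightarrow> real"
  assumes "a \<le> b" "continuous_on {a..b} f"
  obtains p where "a \<le> p" "p \<le> b" "\<And>t. a \<le> t \<Longrightarrow> t \<le> b \<Longrightarrow> f t \<le> f p"
  using continuous_attains_sup[of "{a..b}" f] assms by auto

context periodic_elliptic
begin

text \<open>Abel's factor: it absorbs the drift, so that \<open>E\<close> times the Wronskian of two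
  solutions for the same \<open>l\<close> is constant.\<close>

lemma integrating_factor:
  obtains E where "\<And>t. E t > 0" "\<And>t. (E has_real_derivative (B t / A t) * E t) (at t)"
proof -
  have "continuous_on UNIV (\<lambda>t. B t / A t)"
    using cont A_pos by (intro continuous_intros) (auto simp: less_imp_neq[symmetric])
  then obtain P where "\<And>t. (P has_real_derivative B t / A t) (at t)"
    using antiderivative_exists[of "\<lambda>t. B t / A t"]
    by (auto simp: has_real_derivative_iff_has_vector_derivative)
  then have "((\<lambda>t. exp (P t)) has_real_derivative (B t / A t) * exp (P t)) (at t)" for t
    using DERIV_fun_exp by (metis mult.commute)
  then show ?thesis using that[of "\<lambda>t. exp (P t)"] by simp
qed

lemma wronskian_pos:
  assumes "solves l u v" "solves l u2 v2" "u 0 * v2 0 - u2 0 * v 0 > 0"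
  shows "u t * v2 t - u2 t * v t > 0"
proof -
  obtain E where E: "\<And>t. E t > 0" "\<And>t. (E has_real_derivative (B t / A t) * E t) (at t)"
    using integrating_factor by metis
  let ?W = "\<lambda>t. E t * (u t * v2 t - u2 t * v t)"
  have "(?W has_real_derivative 0) (at t)" for t
  proof -
    note D = assms(1,2)[unfolded solves_def, rule_format, of t]
    have "(?W has_real_derivative E t * ((v t * v2 t + u t * (((l - C t) * u2 t - B t * v2 t) / A t))
         - (v2 t * v t + u2 t * (((l - C t) * u t - B t * v t) / A t)))
         + (B t / A t) * E t * (u t * v2 t - u2 t * v t)) (at t)"
      using D E(2)[of t] by (auto intro!: derivative_eq_intros simp: algebra_simps)
    then show ?thesis
      by (rule DERIV_cong) (use A_pos[of t] in \<open>simp add: field_simps\<close>)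
  qed
  then have "?W t = ?W 0"
    using DERIV_isconst_all[of ?W t 0] by blast
  also have "\<dots> > 0" using assms(3) E(1) by simp
  finally show ?thesis using E(1)[of t] by (simp add: zero_less_mult_iff)
qed

text \<open>Scale \<open>u\<close> by the largest value \<open>k\<close> of \<open>w / u\<close>. As
  \<open>w\<close> vanishes at both ends and is positive between them, this maximum is attained in
  the interior, where \<open>k u\<close> touches \<open>w\<close> from above; the operator at this
  contact yields \<open>m w < l w\<close>.\<close>

lemma subsolution_less:
  assumes sol: "solves l u v" and xy: "x < y" and u: "\<And>t. x \<le> t \<Longrightarrow> t \<le> y \<Longrightarrow> u t > 0"
    and w: "\<And>t. x < t \<Longrightarrow> t < y \<Longrightarrow> (w has_real_derivative w1 t) (at t)"
      "\<And>t. x < t \<Longrightarrow> t < y \<Longrightarrow> (w1 has_real_derivative w2 t) (at t)"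
    and wc: "continuous_on {x..y} w" and wb: "w x = 0" "w y = 0"
    and wp: "\<And>t. x < t \<Longrightarrow> t < y \<Longrightarrow> w t > 0"
    and sub: "\<And>t. x < t \<Longrightarrow> t < y \<Longrightarrow> m * w t < A t * w2 t + B t * w1 t + C t * w t"
  shows "m < l"
proof -
  have "continuous_on {x..y} (\<lambda>t. w t / u t)"
    using u by (intro continuous_intros wc solves_continuous(1)[OF sol]) force
  then obtain q where q: "x \<le> q" "q \<le> y" "\<And>t. x \<le> t \<Longrightarrow> t \<le> y \<Longrightarrow> w t / u t \<le> w q / u q"
    using continuous_attains_sup_interval[of x y "\<lambda>t. w t / u t"] xy by auto
  define k where "k = w q / u q"
  have mid: "x < (x + y) / 2" "(x + y) / 2 < y" using xy by auto
  have "0 < w ((x + y) / 2) / u ((x + y) / 2)"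
    using wp[OF mid] u mid by simp
  also have "\<dots> \<le> k" using q(3)[of "(x + y) / 2"] mid by (simp add: k_def)
  finally have k: "k > 0" .
  have q': "x < q" "q < y"
    using q(1,2) k wb by (auto simp: k_def less_le)
  have kq: "w q = k * u q" using u[of q] q(1,2) by (simp add: k_def)
  define d where "d = min (q - x) (y - q)"
  have d: "d > 0" "\<And>t. \<bar>t - q\<bar> < d \<Longrightarrow> x < t \<and> t < y" using q' by (auto simp: d_def)
  note D = sol[unfolded solves_def, rule_format]
  have "A q * w2 q + B q * w1 q + C q * w q
      \<le> A q * (k * (((l - C q) * u q - B q * v q) / A q)) + B q * (k * v q) + C q * (k * u q)"
  proof (rule operator_le_at_contact[OF d(1), where w = "\<lambda>t. k * u t" and ?w1.0 = "\<lambda>t. k * v t"])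
    show "w t \<le> k * u t" if "\<bar>t - q\<bar> < d" for t
      using q(3)[of t] u[of t] d(2)[OF that] by (simp add: k_def[symmetric] divide_le_eq mult.commute)
    show "((\<lambda>t. k * v t) has_real_derivative k * (((l - C q) * u q - B q * v q) / A q)) (at q)"
      by (rule DERIV_cmult[OF conjunct2[OF D]])
    show "((\<lambda>t. k * u t) has_real_derivative k * v t) (at t)" for t
      by (rule DERIV_cmult[OF conjunct1[OF D]])
  qed (use w d(2) q' kq A_pos[of q] in auto)
  also have "\<dots> = l * w q"
    using A_pos[of q] by (simp add: kq field_simps)
  finally have "m * w q < l * w q" using sub[OF q'] by linarith
  then show ?thesis using wp[OF q'] by simp
qed

lemma solution_pos_until_zero:
  assumes sol: "solves l u v" and init: "u 0 = 0" "v 0 > 0"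
    and nz: "\<And>x. 0 < x \<Longrightarrow> x \<le> y \<Longrightarrow> u x \<noteq> 0" and y: "0 < y"
  shows "u y > 0"
proof (rule ccontr)
  assume "\<not> u y > 0"
  obtain d where d: "d > 0" "\<And>h. 0 < h \<Longrightarrow> h < d \<Longrightarrow> 0 < u h"
    using DERIV_pos_inc_right[of u "v 0" 0] sol init unfolding solves_def by auto
  define h where "h = min y (d / 2)"
  have h: "0 < h" "h < d" "h \<le> y" using d(1) y by (auto simp: h_def)
  obtain x where "h \<le> x" "x \<le> y" "u x = 0"
    using IVT2'[of u y 0 h] d(2)[OF h(1,2)] \<open>\<not> u y > 0\<close> h solves_continuous(1)[OF sol] by force
  then show False using nz[of x] h by auto
qed

text \<open>A solution positive on \<open>[1/4, 3/4]\<close> would have its parameter above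
  \<open>m\<close>, by comparison with the Dirichlet subsolution \<open>?s^2\<close> on this
  interval. The interval stays away from 0, so the lemma also says something about the shooting
  solution that starts from the value 0.\<close>

lemma solution_has_zero:
  obtains m where "\<And>u v l. solves l u v \<Longrightarrow> l \<le> m \<Longrightarrow> \<exists>x. 1/4 \<le> x \<and> x \<le> 3/4 \<and> u x \<le> 0"
proof -
  obtain a M where a: "a > 0" "M > 0" "\<And>t. a \<le> A t" "\<And>t. \<bar>B t\<bar> \<le> M" "\<And>t. \<bar>C t\<bar> \<le> M"
    using coeff_bounds by metis
  obtain N where N: "N > 0" "\<And>t. \<bar>A t\<bar> \<le> N"
    using periodic_bounded[OF per(1) cont(1)] by metis
  \<comment> \<open>\<open>Q\<close> bounds the coefficient of the terms linear in \<open>?s\<close>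
    that have the wrong sign. The choice of \<open>m\<close> leaves \<open>Q^2 s^2 / a\<close>,
    which together with half of the constant term \<open>a / 2\<close> completes the square
    \<open>(Q s - a / 2)^2 / a\<close>; the other half gives strictness.\<close>
  define Q where "Q = 12 * N + M"
  define m where "m = - M - Q\<^sup>2 / a"
  let ?s = "\<lambda>t::real. 1/16 - (t - 1/2)\<^sup>2"
  have s_pos: "?s t > 0" if "1/4 < t" "t < 3/4" for t :: real
  proof -
    have "?s t = (t - 1/4) * (3/4 - t)" by (simp add: power2_eq_square field_simps)
    then show ?thesis using that by simp
  qed
  have key: "m * (?s t)\<^sup>2 < A t * (8 * (t - 1/2)\<^sup>2 - 4 * ?s t) + B t * (- 4 * ?s t * (t - 1/2)) + C t * (?s t)\<^sup>2"
    if t: "1/4 < t" "t < 3/4" for t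
  proof -
    define s where "s = ?s t"
    have s: "s > 0" using s_pos[OF t] by (simp add: s_def)
    have sq: "(t - 1/2)\<^sup>2 = 1/16 - s" by (simp add: s_def)
    have tb: "\<bar>t - 1/2\<bar> \<le> 1/4" unfolding abs_le_iff using t by simp
    have "12 * (A t * s) \<le> 12 * (N * s)"
      using N(2)[of t] s by (intro mult_left_mono mult_right_mono) auto
    moreover have "4 * s * (B t * (t - 1/2)) \<le> 4 * s * (M * (1/4))"
    proof (rule mult_left_mono)
      have "\<bar>B t * (t - 1/2)\<bar> \<le> M * (1/4)"
        unfolding abs_mult using a(4)[of t] tb a(2) by (intro mult_mono) auto
      then show "B t * (t - 1/2) \<le> M * (1/4)" by linarith
    qed (use s in simp)
    moreover have "(C t - m) * s\<^sup>2 \<ge> (Q\<^sup>2 / a) * s\<^sup>2"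
      using a(5)[of t] by (intro mult_right_mono) (auto simp: m_def)
    moreover have "(Q\<^sup>2 / a) * s\<^sup>2 + a / 4 - Q * s \<ge> 0"
    proof -
      have "(Q\<^sup>2 / a) * s\<^sup>2 + a / 4 - Q * s = (Q * s - a / 2)\<^sup>2 / a"
        using a(1) by (simp add: power2_eq_square field_simps)
      then show ?thesis using a(1) by simp
    qed
    moreover have "A t / 2 \<ge> a / 2" using a(3)[of t] by simp
    moreover have "A t * (8 * (t - 1/2)\<^sup>2 - 4 * s) + B t * (- 4 * s * (t - 1/2)) + C t * s\<^sup>2 - m * s\<^sup>2
       = A t / 2 - 12 * (A t * s) - 4 * s * (B t * (t - 1/2)) + (C t - m) * s\<^sup>2"
      unfolding sq by (simp add: algebra_simps)
    ultimately show ?thesis using a(1) unfolding Q_def s_def by (simp add: algebra_simps)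
  qed
  have "\<exists>x. 1/4 \<le> x \<and> x \<le> 3/4 \<and> u x \<le> 0" if "solves l u v" "l \<le> m" for u v l
  proof (rule ccontr)
    assume "\<not> ?thesis"
    then have pos: "\<And>t. 1/4 \<le> t \<Longrightarrow> t \<le> 3/4 \<Longrightarrow> u t > 0" by force
    have "m < l"
    proof (rule subsolution_less[OF that(1) _ pos, where w = "\<lambda>t. (?s t)\<^sup>2" and ?w1.0 = "\<lambda>t. - 4 * ?s t * (t - 1/2)"
        and ?w2.0 = "\<lambda>t. 8 * (t - 1/2)\<^sup>2 - 4 * ?s t"])
      show "((\<lambda>t. (?s t)\<^sup>2) has_real_derivative - 4 * ?s t * (t - 1/2)) (at t)" for t
        by (auto intro!: derivative_eq_intros simp: power2_eq_square field_simps)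
      show "((\<lambda>t. - 4 * ?s t * (t - 1/2)) has_real_derivative 8 * (t - 1/2)\<^sup>2 - 4 * ?s t) (at t)" for t
        by (auto intro!: derivative_eq_intros simp: power2_eq_square field_simps)
      show "continuous_on {1/4..3/4::real} (\<lambda>t. (?s t)\<^sup>2)" by (intro continuous_intros)
      show "0 < (?s t)\<^sup>2" if "1/4 < t" "t < 3/4" for t using s_pos[OF that] by simp
    qed (use key in \<open>auto simp: power2_eq_square\<close>)
    with that(2) show False by simp
  qed
  then show ?thesis using that by blast
qed

text \<open>Shooting: \<open>S\<close> and \<open>U\<close> are the fundamental solutions at 0, \<open>L\<close> is the largest parameter for which
  \<open>S\<close> vanishes in the half-open unit interval, and \<open>f\<close> is the characteristic polynomial of the
  monodromy matrix at 1. It is positive at \<open>L\<close> and nonpositive far above \<open>L\<close>; at a zero in between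
  the Floquet solution \<open>w\<close> is periodic, and \<open>w / S\<close> is decreasing, so \<open>w\<close> is positive.\<close>

lemma positive_periodic_solution:
  "\<exists>l u v. solves l u v \<and> periodic u \<and> (\<forall>t. u t > 0)"
proof -
  have "\<forall>l. \<exists>p. fst p 0 = 0 \<and> snd p 0 = 1 \<and> solves l (fst p) (snd p)"
    using solves_exists[of 0 1] by auto
  then obtain p where p: "\<And>l. fst (p l) 0 = 0" "\<And>l. snd (p l) 0 = 1" "\<And>l. solves l (fst (p l)) (snd (p l))"
    by metis
  define S where "S l = fst (p l)" for l
  define T where "T l = snd (p l)" for l
  have S: "solves l (S l) (T l)" "S l 0 = 0" "T l 0 = 1" for l using p by (auto simp: S_def T_def)
  have "\<forall>l. \<exists>p. fst p 0 = 1 \<and> snd p 0 = 0 \<and> solves l (fst p) (snd p)"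
    using solves_exists[of 1 0] by auto
  then obtain q where q: "\<And>l. fst (q l) 0 = 1" "\<And>l. snd (q l) 0 = 0" "\<And>l. solves l (fst (q l)) (snd (q l))"
    by metis
  define U where "U l = fst (q l)" for l
  define V where "V l = snd (q l)" for l
  have U: "solves l (U l) (V l)" "U l 0 = 1" "V l 0 = 0" for l using q by (auto simp: U_def V_def)
  note DS = S(1)[unfolded solves_def, rule_format]
  note cS = solves_continuous[OF S(1)]
  define Z where "Z = {l. \<exists>x. 0 < x \<and> x \<le> 1 \<and> S l x = 0}"
  have S_pos: "S l x > 0" if "l \<notin> Z" "0 < x" "x \<le> 1" for l x
    using solution_pos_until_zero[OF S(1), of l x] that S(2,3) by (auto simp: Z_def)
  obtain M where M: "M > 0" "\<And>t. \<bar>C t\<bar> \<le> M"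
    using periodic_bounded[OF per(3) cont(3)] by metis

  \<comment> \<open>Above \<open>max C\<close> the zeroth-order coefficient is negative, so positive interior maxima are impossible.\<close>
  have no_pos_max: "u x \<le> 0" if "l > M" "solves l u v" "d > 0" "\<And>t. \<bar>t - x\<bar> < d \<Longrightarrow> u t \<le> u x" for l u v d x
  proof -
    note D = that(2)[unfolded solves_def, rule_format]
    have "v x = 0" "((l - C x) * u x - B x * v x) / A x \<le> 0"
      using second_derivative_local_max[OF that(3) conjunct1[OF D] conjunct2[OF D] that(4)] by auto
    moreover have "l - C x > 0" using M(2)[of x] that(1) by linarith
    ultimately show ?thesis using A_pos[of x] by (auto simp: divide_le_0_iff mult_le_0_iff)
  qed
  have big: "l \<notin> Z" if l: "l > M" for l
  proof
    assume "l \<in> Z"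
    then obtain x where x: "0 < x" "x \<le> 1" "S l x = 0" by (auto simp: Z_def)
    obtain d where d: "d > 0" "\<And>h. 0 < h \<Longrightarrow> h < d \<Longrightarrow> 0 < S l h"
      using DERIV_pos_inc_right[OF conjunct1[OF DS[of l 0]]] S(2,3) by auto
    obtain c where c: "0 \<le> c" "c \<le> x" "\<And>t. 0 \<le> t \<Longrightarrow> t \<le> x \<Longrightarrow> S l t \<le> S l c"
      using continuous_attains_sup_interval[of 0 x "S l"] x cS by auto
    define h where "h = min x (d / 2)"
    have "0 < S l h" "S l h \<le> S l c" using d(1) x(1) by (auto simp: h_def intro!: d(2) c(3))
    then have pos: "S l c > 0" by simp
    then have c': "0 < c" "c < x" using c(1,2) x S(2)[of l] by (auto simp: less_le)
    have "S l c \<le> 0"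
      by (rule no_pos_max[OF l S(1), of "min c (x - c)"]) (use c' c(3) in auto)
    with pos show False by simp
  qed
  obtain m where m: "\<And>u v l. solves l u v \<Longrightarrow> l \<le> m \<Longrightarrow> \<exists>x. 1/4 \<le> x \<and> x \<le> 3/4 \<and> u x \<le> 0"
    using solution_has_zero by blast
  have ne: "m \<in> Z"
  proof (rule ccontr)
    assume mZ: "m \<notin> Z"
    obtain x where "1/4 \<le> x" "x \<le> 3/4" "S m x \<le> 0"
      using m[OF S(1) order_refl] by blast
    then show False using S_pos[OF mZ, of x] by simp
  qed
  have bdd: "bdd_above Z" using big by (meson bdd_aboveI not_le)
  define L where "L = Sup Z"
  have above: "l \<notin> Z" if "l > L" for l
    using cSup_upper[OF _ bdd, of l] that by (auto simp: L_def)
  obtain G where G: "G > 0" "\<And>l t. \<bar>l - L\<bar> \<le> 1 \<Longrightarrow> 0 \<le> t \<Longrightarrow> t \<le> 1 \<Longrightarrow> \<bar>S l t - S L t\<bar> \<le> G * \<bar>l - L\<bar>"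
    "\<And>l t. \<bar>l - L\<bar> \<le> 1 \<Longrightarrow> 0 \<le> t \<Longrightarrow> t \<le> 1 \<Longrightarrow> \<bar>T l t - T L t\<bar> \<le> G * \<bar>l - L\<bar>"
    using solves_lipschitz[OF S, of L] by metis
  have nonneg: "S L x \<ge> 0" if "0 < x" "x \<le> 1" for x
  proof (rule ccontr)
    assume "\<not> S L x \<ge> 0"
    define e where "e = min 1 (- S L x / G)"
    have e: "e > 0" "e \<le> 1" "G * e \<le> - S L x"
      using \<open>\<not> S L x \<ge> 0\<close> G(1) by (auto simp: e_def min_def field_simps)
    have "S (L + e) x > 0" by (rule S_pos) (use above[of "L + e"] e that in auto)
    moreover have "\<bar>S (L + e) x - S L x\<bar> \<le> G * e" using G(2)[of "L + e" x] e that by auto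
    ultimately show False using e by linarith
  qed
  \<comment> \<open>The supremum is attained. The danger is that zeros of \<open>S l\<close>, for
    \<open>l\<close> tending to \<open>L\<close>, drift to the excluded end point 0. Near 0 the
    slope of \<open>S L\<close> exceeds 1/2, so a nearby \<open>S l\<close> has no further zero
    there by the mean value theorem; away from 0, \<open>S L\<close> has a positive minimum.\<close>
  have "L \<in> Z"
  proof (rule ccontr)
    assume LZ: "L \<notin> Z"
    have "\<forall>\<^sub>F t in at 0. T L t > 1/2"
      using DERIV_isCont[OF conjunct2[OF DS[of L 0]]] S(3)[of L]
      by (intro order_tendstoD(1)[of _ 1]) (auto simp: isCont_def)
    then obtain d where d: "d > 0" "\<And>t. t \<noteq> 0 \<Longrightarrow> \<bar>t\<bar> < d \<Longrightarrow> T L t > 1/2"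
      by (auto simp: eventually_at dist_real_def)
    define h where "h = min 1 (d / 2)"
    have h: "0 < h" "h \<le> 1" "h < d" using d(1) by (auto simp: h_def)
    obtain c where c: "h \<le> c" "c \<le> 1" "\<And>t. h \<le> t \<Longrightarrow> t \<le> 1 \<Longrightarrow> - S L t \<le> - S L c"
      using continuous_attains_sup_interval[OF h(2) continuous_on_minus[OF cS(1)[of _ L]]] by blast
    have "S L c > 0" using S_pos[OF LZ, of c] c h by simp
    \<comment> \<open>For parameters within \<open>e\<close> of \<open>L\<close>, slopes move by at
      most 1/4 and values by at most half of the minimum \<open>S L c\<close> on
      \<open>[h, 1]\<close>.\<close>
    define e where "e = min 1 (min (1/4) (S L c / 2) / G)"
    have e: "e > 0" "e \<le> 1" using \<open>S L c > 0\<close> G(1) by (auto simp: e_def)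
    have "G * e \<le> G * (min (1/4) (S L c / 2) / G)"
      using G(1) by (intro mult_left_mono) (auto simp: e_def)
    then have e': "G * e \<le> 1/4" "G * e \<le> S L c / 2" using G(1) by auto
    obtain l where l: "l \<in> Z" "L - e < l"
      using less_cSup_iff[OF _ bdd, of "L - e"] ne e by (auto simp: L_def)
    have "l \<le> L" using above[of l] l(1) by force
    then have le: "\<bar>l - L\<bar> \<le> e" "\<bar>l - L\<bar> \<le> 1" using l e by auto
    have Ge: "G * \<bar>l - L\<bar> \<le> G * e" using le G(1) by simp
    obtain x where x: "0 < x" "x \<le> 1" "S l x = 0" using l by (auto simp: Z_def)
    show False
    proof (cases "h \<le> x")
      case True
      have "\<bar>S l x - S L x\<bar> \<le> S L c / 2" using G(2)[OF le(2), of x] x e' Ge by linarith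
      then show False using c(3)[OF True x(2)] x \<open>S L c > 0\<close> by linarith
    next
      case False
      obtain z where z: "0 < z" "z < x" "S l x - S l 0 = (x - 0) * T l z"
        using MVT2[OF x(1), of "S l" "T l"] DS by blast
      then have "T l z = 0" using x S(2) by simp
      moreover have "T L z > 1/2" using d(2)[of z] z False h by simp
      moreover have "\<bar>T l z - T L z\<bar> \<le> 1/4" using G(3)[OF le(2), of z] z x e' Ge by linarith
      ultimately show False by linarith
    qed
  qed
  then obtain x0 where x0: "0 < x0" "x0 \<le> 1" "S L x0 = 0" by (auto simp: Z_def)
  have simple: "T L x \<noteq> 0" if "S L x = 0" for x
    using solves_zero(2)[OF S(1) that, of 0] S(3) by auto
  \<comment> \<open>A zero before 1 would be an interior minimum of the nonnegative
    \<open>S L\<close>, hence a double zero, and by uniqueness \<open>S L\<close> would vanish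
    identically.\<close>
  have "x0 = 1"
  proof (rule ccontr)
    assume "x0 \<noteq> 1"
    then have "x0 < 1" using x0 by simp
    have "T L x0 = 0"
      by (rule DERIV_local_min[OF conjunct1[OF DS], of "min x0 (1 - x0)"])
         (use x0 \<open>x0 < 1\<close> in \<open>auto intro!: nonneg\<close>)
    then show False using simple x0 by blast
  qed
  then have S1: "S L 1 = 0" using x0 by simp
  have "\<not> T L 1 > 0"
  proof
    assume "T L 1 > 0"
    then obtain d where d: "d > 0" "\<And>h. 0 < h \<Longrightarrow> h < d \<Longrightarrow> S L (1 - h) < S L 1"
      using DERIV_pos_inc_left[OF conjunct1[OF DS]] by blast
    define h where "h = min (1/2) (d / 2)"
    have "S L (1 - h) < 0" "S L (1 - h) \<ge> 0" using d(1) S1 d(2)[of h] by (auto simp: h_def intro!: nonneg)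
    then show False by simp
  qed
  then have T1: "T L 1 < 0" using simple[OF S1] by linarith
  have "U L 1 * T L 1 - S L 1 * V L 1 > 0"
    by (rule wronskian_pos[OF U(1) S(1)]) (simp add: S U)
  then have U1: "U L 1 < 0" using S1 T1 by (simp add: zero_less_mult_iff)

  define f where "f l = 1 - U l 1 - T l 1 + U l 1 * T l 1 - V l 1 * S l 1" for l
  have fL: "f L > 0"
  proof -
    \<comment> \<open>At \<open>L\<close> the monodromy matrix is triangular because
      \<open>S L 1 = 0\<close>, and both diagonal entries are negative.\<close>
    have "f L = (1 - U L 1) * (1 - T L 1)" by (simp add: f_def S1 algebra_simps)
    then show ?thesis using U1 T1 by simp
  qed
  \<comment> \<open>For \<open>l\<close> outside \<open>Z\<close> this is the solution with value 1
    at both 0 and 1. Its slopes at the two ends differ by \<open>f l / S l 1\<close>, so it closes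
    up periodically exactly when \<open>f l = 0\<close>.\<close>
  define w where "w l t = 1 * U l t + (1 - U l 1) / S l 1 * S l t" for l t
  define w' where "w' l t = 1 * V l t + (1 - U l 1) / S l 1 * T l t" for l t
  have w: "solves l (w l) (w' l)" "w l 0 = 1" for l
    unfolding w_def w'_def by (rule solves_lincomb[OF U(1) S(1)]) (simp add: S U)
  have w1: "w l 1 = 1" "S l 1 * (w' l 0 - w' l 1) = f l" if "l \<notin> Z" for l
    using S_pos[OF that, of 1] S U by (auto simp: w_def w'_def f_def field_simps)
  define R where "R = max M L + 1"
  have R: "R > M" "R > L" "R \<notin> Z" using big[of R] by (auto simp: R_def)
  \<comment> \<open>At \<open>R\<close> the maximum principle gives \<open>w R <= 1\<close> on the
    unit interval. Since the value 1 is taken at both ends, the slope is nonpositive at 0 and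
    nonnegative at 1, which fixes the sign of \<open>f R\<close>.\<close>
  have fR: "f R \<le> 0"
  proof -
    note D = w(1)[unfolded solves_def, rule_format]
    obtain c where c: "0 \<le> c" "c \<le> 1" "\<And>t. 0 \<le> t \<Longrightarrow> t \<le> 1 \<Longrightarrow> w R t \<le> w R c"
      using continuous_attains_sup_interval[of 0 1 "w R"] solves_continuous[OF w(1)] by auto
    have "w R c \<le> 1"
    proof (rule ccontr)
      assume "\<not> w R c \<le> 1"
      then have c': "0 < c" "c < 1" using c(1,2) w(2)[of R] w1(1)[OF R(3)] by (auto simp: less_le)
      have "w R c \<le> 0"
        by (rule no_pos_max[OF R(1) w(1), of "min c (1 - c)"]) (use c' c(3) in auto)
      then show False using \<open>\<not> w R c \<le> 1\<close> by simp
    qed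
    then have le: "w R t \<le> 1" if "0 \<le> t" "t \<le> 1" for t using c(3)[OF that] by linarith
    have "\<not> w' R 0 > 0"
    proof
      assume "w' R 0 > 0"
      then obtain d where d: "d > 0" "\<And>h. 0 < h \<Longrightarrow> h < d \<Longrightarrow> w R 0 < w R (0 + h)"
        using DERIV_pos_inc_right[OF conjunct1[OF D]] by blast
      define h where "h = min 1 (d / 2)"
      have "0 < h" "h < d" "h \<le> 1" using d(1) by (auto simp: h_def)
      then show False using d(2)[of h] le[of h] w(2)[of R] by simp
    qed
    moreover have "\<not> w' R 1 < 0"
    proof
      assume "w' R 1 < 0"
      then obtain d where d: "d > 0" "\<And>h. 0 < h \<Longrightarrow> h < d \<Longrightarrow> w R 1 < w R (1 - h)"
        using DERIV_neg_dec_left[OF conjunct1[OF D]] by blast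
      define h where "h = min 1 (d / 2)"
      have "0 < h" "h < d" "h \<le> 1" using d(1) by (auto simp: h_def)
      then show False using d(2)[of h] le[of "1 - h"] w1(1)[OF R(3)] by simp
    qed
    moreover have "S R 1 > 0" using S_pos[OF R(3)] by simp
    ultimately show ?thesis using w1(2)[OF R(3)] by (simp flip: w1(2)[OF R(3)] add: mult_le_0_iff)
  qed
  have lip_cont: "isCont g l" if "G > 0" "\<And>k. \<bar>k - l\<bar> \<le> 1 \<Longrightarrow> \<bar>g k - g l\<bar> \<le> G * \<bar>k - l\<bar>" for g :: "real \<Rightarrow> real" and G l
    unfolding isCont_def
  proof (rule LIM_I)
    fix r :: real assume "r > 0"
    show "\<exists>s>0. \<forall>x. x \<noteq> l \<and> norm (x - l) < s \<longrightarrow> norm (g x - g l) < r"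
    proof (intro exI[of _ "min 1 (r / G)"] conjI allI impI)
      fix x assume x: "x \<noteq> l \<and> norm (x - l) < min 1 (r / G)"
      then have "G * \<bar>x - l\<bar> < r" using that(1) by (simp add: field_simps)
      then show "norm (g x - g l) < r" using that(2)[of x] x by simp
    qed (use \<open>r > 0\<close> that in auto)
  qed
  have "isCont f l" for l
  proof -
    have "isCont (\<lambda>l. S l 1) l" "isCont (\<lambda>l. T l 1) l"
      using solves_lipschitz[OF S, of l] lip_cont[of _ l] by (metis order_refl zero_le_one)+
    moreover have "isCont (\<lambda>l. U l 1) l" "isCont (\<lambda>l. V l 1) l"
      using solves_lipschitz[OF U, of l] lip_cont[of _ l] by (metis order_refl zero_le_one)+
    ultimately show ?thesis unfolding f_def by (intro continuous_intros)
  qed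
  then have "continuous_on {L..R} f" by (simp add: continuous_at_imp_continuous_on)
  then obtain l where l: "L \<le> l" "l \<le> R" "f l = 0"
    using IVT2'[of f R 0 L] fL fR R(2) by auto
  then have "l > L" using fL by (cases "l = L") auto
  then have lZ: "l \<notin> Z" using above by simp
  have Sl: "S l 1 > 0" using S_pos[OF lZ] by simp
  have w'l: "w' l 1 = w' l 0" using w1(2)[OF lZ] l(3) Sl by simp
  have perw: "periodic (w l)" "periodic (w' l)"
    using solves_periodic[OF w(1), of l] w(2) w1(1)[OF lZ] w'l by auto
  have W: "w l t * T l t - S l t * w' l t > 0" for t
    by (rule wronskian_pos[OF w(1) S(1)]) (simp add: w S)
  have pos: "w l t > 0" if t: "0 \<le> t" "t \<le> 1" for t
  proof (cases "t = 0 \<or> t = 1")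
    case True
    then show ?thesis using w(2) w1(1)[OF lZ] by auto
  next
    case False
    then have t': "0 < t" "t < 1" using t by auto
    have "w l t / S l t > w l 1 / S l 1"
    proof (rule DERIV_neg_imp_decreasing[OF t'(2), where f = "\<lambda>x. w l x / S l x"])
      fix x assume x: "t \<le> x" "x \<le> 1"
      have Sx: "S l x > 0" using S_pos[OF lZ, of x] x t' by simp
      have "((\<lambda>x. w l x / S l x) has_real_derivative (w' l x * S l x - w l x * T l x) / (S l x * S l x)) (at x)"
        using w(1)[of l] S(1)[of l] Sx unfolding solves_def by (intro DERIV_divide) auto
      moreover have "(w' l x * S l x - w l x * T l x) / (S l x * S l x) < 0"
        using W[of x] Sx by (simp add: divide_neg_pos mult.commute)
      ultimately show "\<exists>y. ((\<lambda>x. w l x / S l x) has_real_derivative y) (at x) \<and> y < 0" by blast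
    qed
    then have "w l t / S l t > 0" using w1(1)[OF lZ] Sl by (simp add: less_trans[rotated])
    then show ?thesis using S_pos[OF lZ, of t] t' by (simp add: zero_less_divide_iff)
  qed
  have "w l t > 0" for t
    using pos[of "frac t"] periodic_frac[OF perw(1), of t] frac_lt_1[of t] by simp
  then show ?thesis using w(1)[of l] perw by blast
qed

end

section \<open>The principal eigenvalue\<close>

context periodic_elliptic
begin

text \<open>Here \<open>w1 + i w2\<close> is an eigenfunction for the eigenvalue \<open>x + i y\<close>, written in real components.
  When \<open>x = l\<close>, the quotient \<open>|w|\<^sup>2 / u\<^sup>2\<close> is subharmonic: up to a positive factor its derivative is
  the nondecreasing function \<open>H\<close> below.\<close>

lemma eigenvalue_le_principal:
  assumes sol: "solves l u v" and pu: "periodic u" and u: "\<And>t. u t > 0"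
    and w: "\<And>t. (w1 has_real_derivative p1 t) (at t)" "\<And>t. (w2 has_real_derivative p2 t) (at t)"
      "\<And>t. (p1 has_real_derivative q1 t) (at t)" "\<And>t. (p2 has_real_derivative q2 t) (at t)"
    and pw: "periodic w1" "periodic w2"
    and eq: "\<And>t. A t * q1 t + B t * p1 t + C t * w1 t = x * w1 t - y * w2 t"
      "\<And>t. A t * q2 t + B t * p2 t + C t * w2 t = x * w2 t + y * w1 t"
    and nz: "w1 s \<noteq> 0 \<or> w2 s \<noteq> 0"
  shows "x \<le> l" "x = l \<Longrightarrow> y = 0"
proof -
  note D = sol[unfolded solves_def, rule_format]
  define f where "f t = ((w1 t)\<^sup>2 + (w2 t)\<^sup>2) / (u t)\<^sup>2" for t
  have "continuous_on UNIV f"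
    unfolding f_def using w(1,2) u solves_continuous(1)[OF sol, of UNIV]
    by (intro continuous_intros)
       (auto intro!: continuous_at_imp_continuous_on DERIV_isCont simp: less_imp_neq[symmetric])
  moreover have per_f: "periodic f" using pu pw by (simp add: f_def periodic_def)
  ultimately obtain p where p: "\<And>t. f t \<le> f p"
    using periodic_attains_sup by metis
  have "0 < f s" using nz u[of s] by (auto simp: f_def sum_power2_gt_zero_iff)
  then have fp: "f p > 0" using p[of s] by simp
  have fu: "(w1 t)\<^sup>2 + (w2 t)\<^sup>2 = f t * (u t)\<^sup>2" for t
    using u[of t] by (simp add: f_def)
  \<comment> \<open>This is the real part of \<open>w\<close> times the conjugate of
    \<open>w p\<close>. It depends linearly on \<open>w\<close>, so the contact lemma applies to it,
    and Cauchy-Schwarz puts it below a multiple of \<open>u\<close> with equality at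
    \<open>p\<close>. At \<open>p\<close> the terms with \<open>y\<close> cancel.\<close>
  let ?h = "\<lambda>t. w1 p * w1 t + w2 p * w2 t"
  have h_le: "?h t \<le> (f p * u p) * u t" for t
  proof (rule power2_le_imp_le)
    have "(?h t)\<^sup>2 \<le> ((w1 p)\<^sup>2 + (w2 p)\<^sup>2) * ((w1 t)\<^sup>2 + (w2 t)\<^sup>2)"
      using zero_le_power2[of "w1 p * w2 t - w2 p * w1 t"] by (simp add: power2_eq_square algebra_simps)
    also have "\<dots> \<le> (f p * (u p)\<^sup>2) * (f p * (u t)\<^sup>2)"
      unfolding fu using p[of t] fp by (intro mult_left_mono mult_right_mono) auto
    finally show "(?h t)\<^sup>2 \<le> (f p * u p * u t)\<^sup>2" by (simp add: power2_eq_square mult_ac)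
    show "0 \<le> f p * u p * u t" using fp u[of p] u[of t] by simp
  qed
  have hp: "?h p = f p * u p * u p" using fu[of p] by (simp add: power2_eq_square)
  have "A p * (w1 p * q1 p + w2 p * q2 p) + B p * (w1 p * p1 p + w2 p * p2 p) + C p * ?h p
      \<le> A p * ((f p * u p) * (((l - C p) * u p - B p * v p) / A p)) + B p * ((f p * u p) * v p) + C p * ((f p * u p) * u p)"
  proof (rule operator_le_at_contact[OF zero_less_one, where u = ?h and w = "\<lambda>t. f p * u p * u t"
        and ?u1.0 = "\<lambda>t. w1 p * p1 t + w2 p * p2 t" and ?w1.0 = "\<lambda>t. f p * u p * v t"])
    show "(?h has_real_derivative w1 p * p1 t + w2 p * p2 t) (at t)" for t
      by (intro DERIV_add DERIV_cmult w)
    show "((\<lambda>t. w1 p * p1 t + w2 p * p2 t) has_real_derivative w1 p * q1 p + w2 p * q2 p) (at p)"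
      by (intro DERIV_add DERIV_cmult w)
    show "((\<lambda>t. f p * u p * u t) has_real_derivative f p * u p * v t) (at t)" for t
      by (rule DERIV_cmult[OF conjunct1[OF D]])
    show "((\<lambda>t. f p * u p * v t) has_real_derivative f p * u p * (((l - C p) * u p - B p * v p) / A p)) (at p)"
      by (rule DERIV_cmult[OF conjunct2[OF D]])
  qed (use h_le hp A_pos[of p] in auto)
  also have "\<dots> = l * (f p * u p * u p)"
    using A_pos[of p] by (simp add: field_simps)
  also have "A p * (w1 p * q1 p + w2 p * q2 p) + B p * (w1 p * p1 p + w2 p * p2 p) + C p * ?h p
      = w1 p * (A p * q1 p + B p * p1 p + C p * w1 p) + w2 p * (A p * q2 p + B p * p2 p + C p * w2 p)"
    by (simp add: algebra_simps)
  also have "\<dots> = x * ?h p"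
    unfolding eq by (simp add: algebra_simps)
  finally show "x \<le> l"
    using fp u[of p] unfolding hp by simp

  assume xl: "x = l"
  obtain E where E: "\<And>t. E t > 0" "\<And>t. (E has_real_derivative (B t / A t) * E t) (at t)"
    using integrating_factor by metis
  \<comment> \<open>\<open>W1 / u^2\<close> and \<open>W2 / u^2\<close> are the derivatives of
    \<open>w1 / u\<close> and \<open>w2 / u\<close>.\<close>
  define W1 where "W1 t = p1 t * u t - w1 t * v t" for t
  define W2 where "W2 t = p2 t * u t - w2 t * v t" for t
  have dW: "(W1 has_real_derivative - (B t * W1 t + y * w2 t * u t) / A t) (at t)"
    "(W2 has_real_derivative - (B t * W2 t - y * w1 t * u t) / A t) (at t)" for t
  proof -
    have q: "q1 t = (x * w1 t - y * w2 t - B t * p1 t - C t * w1 t) / A t"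
      "q2 t = (x * w2 t + y * w1 t - B t * p2 t - C t * w2 t) / A t"
      using eq[of t] A_pos[of t] by (simp_all add: field_simps)
    have "(W1 has_real_derivative (q1 t * u t + v t * p1 t) - (p1 t * v t + ((l - C t) * u t - B t * v t) / A t * w1 t)) (at t)"
      "(W2 has_real_derivative (q2 t * u t + v t * p2 t) - (p2 t * v t + ((l - C t) * u t - B t * v t) / A t * w2 t)) (at t)"
      unfolding W1_def W2_def
      by (intro DERIV_diff DERIV_mult w conjunct1[OF D] conjunct2[OF D])+
    then show "(W1 has_real_derivative - (B t * W1 t + y * w2 t * u t) / A t) (at t)"
      "(W2 has_real_derivative - (B t * W2 t - y * w1 t * u t) / A t) (at t)"
      using A_pos[of t] unfolding q xl W1_def W2_def
      by (auto elim!: DERIV_cong simp: field_simps)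
  qed
  have df: "(f has_real_derivative 2 * (w1 t * W1 t + w2 t * W2 t) / u t ^ 3) (at t)" for t
  proof -
    have "(f has_real_derivative
        ((2 * w1 t * p1 t + 2 * w2 t * p2 t) * (u t)\<^sup>2 - ((w1 t)\<^sup>2 + (w2 t)\<^sup>2) * (2 * u t * v t)) / ((u t)\<^sup>2 * (u t)\<^sup>2)) (at t)"
      unfolding f_def using u[of t] D[of t] w(1,2)[of t]
      by (auto intro!: derivative_eq_intros simp: power2_eq_square)
    then show ?thesis
      by (rule DERIV_cong) (use u[of t] in \<open>simp add: W1_def W2_def field_simps power2_eq_square power3_eq_cube\<close>)
  qed
  \<comment> \<open>\<open>H\<close> equals \<open>E * u^2 / 2\<close> times the derivative of
    \<open>f\<close>.\<close>
  define H where "H t = E t * (w1 t * W1 t + w2 t * W2 t) / u t" for t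
  have dH: "(H has_real_derivative E t * ((W1 t)\<^sup>2 + (W2 t)\<^sup>2) / (u t)\<^sup>2) (at t)" for t
  proof -
    let ?N = "w1 t * W1 t + w2 t * W2 t"
    have "((\<lambda>t. E t * (w1 t * W1 t + w2 t * W2 t)) has_real_derivative
        (B t / A t) * E t * ?N + ((p1 t * W1 t + - (B t * W1 t + y * w2 t * u t) / A t * w1 t) + (p2 t * W2 t + - (B t * W2 t - y * w1 t * u t) / A t * w2 t)) * E t) (at t)"
      by (intro DERIV_mult DERIV_add w E dW)
    from DERIV_divide[OF this conjunct1[OF D]] u[of t]
    have "(H has_real_derivative
       (((B t / A t) * E t * ?N + ((p1 t * W1 t + - (B t * W1 t + y * w2 t * u t) / A t * w1 t) + (p2 t * W2 t + - (B t * W2 t - y * w1 t * u t) / A t * w2 t)) * E t) * u t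
        - E t * ?N * v t) / (u t * u t)) (at t)"
      unfolding H_def by simp
    moreover have "((B t / A t) * E t * ?N + ((p1 t * W1 t + - (B t * W1 t + y * w2 t * u t) / A t * w1 t) + (p2 t * W2 t + - (B t * W2 t - y * w1 t * u t) / A t * w2 t)) * E t)
       = E t * (p1 t * W1 t + p2 t * W2 t)"
      using A_pos[of t] by (simp add: field_simps)
    moreover have "E t * (p1 t * W1 t + p2 t * W2 t) * u t - E t * ?N * v t = E t * ((W1 t)\<^sup>2 + (W2 t)\<^sup>2)"
      by (simp add: W1_def W2_def power2_eq_square algebra_simps)
    ultimately show ?thesis by (simp add: power2_eq_square)
  qed
  have N0: "w1 r * W1 r + w2 r * W2 r = 0" if "f r = f p" for r
  proof -
    have "2 * (w1 r * W1 r + w2 r * W2 r) / u r ^ 3 = 0"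
      by (rule DERIV_local_max[OF df zero_less_one]) (use p that in auto)
    then show ?thesis using u[of r] by simp
  qed
  have "f (p + 1) = f p" using per_f by (simp add: periodic_def)
  \<comment> \<open>Both ends of the period \<open>[p, p + 1]\<close> are maxima of
    \<open>f\<close>, so the nondecreasing \<open>H\<close> vanishes between them. Hence
    \<open>W1\<close> and \<open>W2\<close> vanish there, and their own equations then force
    \<open>y * w1\<close> and \<open>y * w2\<close> to be zero.\<close>
  then have H0: "H p = 0" "H (p + 1) = 0" using N0[of p] N0[of "p + 1"] by (auto simp: H_def)
  have mono: "H r \<le> H t" if "r \<le> t" for r t
    by (rule DERIV_nonneg_imp_nondecreasing[OF that])
       (intro exI conjI, rule dH, simp add: less_imp_le[OF E(1)])
  have Hz: "H t = 0" if "p \<le> t" "t \<le> p + 1" for t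
    using mono[of p t] mono[of t "p + 1"] that H0 by simp
  have Wz: "W1 t = 0" "W2 t = 0" if "p < t" "t < p + 1" for t
  proof -
    have "E t * ((W1 t)\<^sup>2 + (W2 t)\<^sup>2) / (u t)\<^sup>2 = 0"
      by (rule DERIV_local_const[OF dH, of "min (t - p) (p + 1 - t)"]) (use that in \<open>auto simp: Hz\<close>)
    then have "(W1 t)\<^sup>2 + (W2 t)\<^sup>2 = 0" using E(1)[of t] u[of t] by simp
    then show "W1 t = 0" "W2 t = 0" by (simp_all add: sum_power2_eq_zero_iff)
  qed
  define r where "r = p + 1/2"
  have rp: "p < r" "r < p + 1" by (simp_all add: r_def)
  have near: "p < t \<and> t < p + 1" if "\<bar>r - t\<bar> < 1/2" for t
    using that unfolding r_def by linarith
  have "f r = f p"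
  proof (rule DERIV_isconst_end[of p r f])
    show "p < r" by (simp add: r_def)
    show "continuous_on {p..r} f" using \<open>continuous_on UNIV f\<close> continuous_on_subset by blast
    show "(f has_real_derivative 0) (at t)" if "p < t" "t < r" for t
      using df[of t] Wz[of t] that by (simp add: r_def)
  qed
  then have "w1 r \<noteq> 0 \<or> w2 r \<noteq> 0" using fp fu[of r] u[of r] by auto
  moreover have "y * w2 r = 0"
  proof -
    have "- (B r * W1 r + y * w2 r * u r) / A r = 0"
      by (rule DERIV_local_const[OF dW(1), of "1/2"]) (use near in \<open>auto simp: Wz rp\<close>)
    then show ?thesis using A_pos[of r] u[of r] Wz(1)[OF rp] by simp
  qed
  moreover have "y * w1 r = 0"
  proof -
    have "- (B r * W2 r - y * w1 r * u r) / A r = 0"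
      by (rule DERIV_local_const[OF dW(2), of "1/2"]) (use near in \<open>auto simp: Wz rp\<close>)
    then show ?thesis using A_pos[of r] u[of r] Wz(2)[OF rp] by simp
  qed
  ultimately show "y = 0" by auto
qed

end

section \<open>Passage between functions on the circle and periodic functions on the line\<close>

lemma circle_lift:
  assumes "periodic U"
  obtains u where "\<And>t. u (abs_circle t) = U t"
proof
  fix t
  have "rep_circle (abs_circle t) - t \<in> \<int>"
    by (simp flip: abs_circle_eq_iff)
  then show "(U \<circ> rep_circle) (abs_circle t) = U t"
    using periodic_add_Ints[OF assms, of "rep_circle (abs_circle t) - t" t] by simp
qed

lemma circle_deriv_eq:
  "((\<lambda>s. f (abs_circle s)) has_vector_derivative D) (at t) \<Longrightarrow> circle_deriv f (abs_circle t) = D"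
  by (simp add: circle_deriv_abs vector_derivative_at)

lemma circle_all: "(\<forall>p. P p) \<longleftrightarrow> (\<forall>t. P (abs_circle t))"
  by (metis abs_rep_circle)

lemma C_1_circleD:
  assumes "C_k_circle 1 f"
  shows "((\<lambda>s. f (abs_circle s)) has_vector_derivative circle_deriv f (abs_circle t)) (at t)"
    and "continuous_on UNIV (circle_deriv f)"
  using assms by (auto simp: C_k_circle_def circle_deriv_abs vector_derivative_works[symmetric])

lemma C_2_circleD:
  assumes "C_k_circle 2 f"
  shows "((\<lambda>s. f (abs_circle s)) has_vector_derivative circle_deriv f (abs_circle t)) (at t)"
    and "((\<lambda>s. circle_deriv f (abs_circle s)) has_vector_derivative (circle_deriv ^^ 2) f (abs_circle t)) (at t)"
proof -
  have 2: "(circle_deriv ^^ 2) f = circle_deriv (circle_deriv f)"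
    by (simp add: numeral_2_eq_2)
  have *: "(\<lambda>s. f (abs_circle s)) differentiable (at t)" "(\<lambda>s. circle_deriv f (abs_circle s)) differentiable (at t)" for t
    using assms[unfolded C_k_circle_def, THEN conjunct1, rule_format, of 0 t]
      assms[unfolded C_k_circle_def, THEN conjunct1, rule_format, of 1 t] by auto
  show "((\<lambda>s. f (abs_circle s)) has_vector_derivative circle_deriv f (abs_circle t)) (at t)"
    "((\<lambda>s. circle_deriv f (abs_circle s)) has_vector_derivative (circle_deriv ^^ 2) f (abs_circle t)) (at t)"
    unfolding 2 circle_deriv_abs[of _ t] using * by (auto simp: vector_derivative_works[symmetric])
qed

lemma C_2_circleI:
  assumes "\<And>t. ((\<lambda>s. f (abs_circle s)) has_vector_derivative D1 t) (at t)"
    and "\<And>t. (D1 has_vector_derivative D2 t) (at t)" and "continuous_on UNIV D2"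
  shows "C_k_circle 2 f" "circle_deriv f (abs_circle t) = D1 t" "(circle_deriv ^^ 2) f (abs_circle t) = D2 t"
proof -
  have 1: "circle_deriv f (abs_circle t) = D1 t" for t
    using circle_deriv_eq assms(1) by blast
  have 2: "(circle_deriv ^^ 2) f (abs_circle t) = D2 t" for t
    using circle_deriv_eq[of "circle_deriv f"] assms(2) by (simp add: 1 numeral_2_eq_2)
  show "circle_deriv f (abs_circle t) = D1 t" "(circle_deriv ^^ 2) f (abs_circle t) = D2 t"
    by (fact 1 2)+
  show "C_k_circle 2 f"
    unfolding C_k_circle_def continuous_on_circle_iff
    using assms by (auto simp: 2 1 less_2_cases_iff intro: differentiableI_vector)
qed

text \<open>A positive eigenfunction identifies the principal eigenvalue: every eigenvalue has real
  part at most \<open>l\<close>, and equality forces it to be \<open>l\<close> itself. The second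
  fact provides the uniqueness on which the definite description rests.\<close>

lemma principal_eigenvalue_eq:
  fixes a b c :: "circle \<Rightarrow> real"
  assumes ell: "periodic_elliptic (\<lambda>t. \<epsilon> * a (abs_circle t)) (\<lambda>t. b (abs_circle t)) (\<lambda>t. c (abs_circle t))"
    and sol: "periodic_elliptic.solves (\<lambda>t. \<epsilon> * a (abs_circle t)) (\<lambda>t. b (abs_circle t)) (\<lambda>t. c (abs_circle t)) l u v"
    and pu: "periodic u" and u: "\<And>t. u t > 0"
  shows "principal_eigenvalue a b c \<epsilon> = of_real l"
proof -
  interpret periodic_elliptic "\<lambda>t. \<epsilon> * a (abs_circle t)" "\<lambda>t. b (abs_circle t)" "\<lambda>t. c (abs_circle t)"
    by (rule ell)
  note D = sol[unfolded solves_def, rule_format]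
  have ev: "circle_eigenvalue a b c \<epsilon> (of_real l)"
  proof -
    have "periodic (\<lambda>t. complex_of_real (u t))" using pu by (simp add: periodic_def)
    then obtain \<phi> where \<phi>: "\<And>t. \<phi> (abs_circle t) = complex_of_real (u t)"
      using circle_lift by metis
    define v' where "v' t = ((l - c (abs_circle t)) * u t - b (abs_circle t) * v t) / (\<epsilon> * a (abs_circle t))" for t
    have nz: "\<epsilon> * a (abs_circle t) \<noteq> 0" for t using A_pos[of t] by linarith
    have cv': "continuous_on UNIV v'"
      unfolding v'_def by (intro continuous_intros cont solves_continuous[OF sol] ballI nz)
    have d: "((\<lambda>t. \<phi> (abs_circle t)) has_vector_derivative complex_of_real (v t)) (at t)"
      "((\<lambda>t. complex_of_real (v t)) has_vector_derivative complex_of_real (v' t)) (at t)" for t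
    proof -
      have "(u has_real_derivative v t) (at t)" "(v has_real_derivative v' t) (at t)"
        using D[of t] by (simp_all add: v'_def)
      then show "((\<lambda>t. \<phi> (abs_circle t)) has_vector_derivative complex_of_real (v t)) (at t)"
        "((\<lambda>t. complex_of_real (v t)) has_vector_derivative complex_of_real (v' t)) (at t)"
        unfolding \<phi> by (auto intro!: has_vector_derivative_of_real)
    qed
    note C = C_2_circleI[OF d continuous_on_of_real[OF cv']]
    show ?thesis
      unfolding circle_eigenvalue_def
    proof (intro exI[of _ \<phi>] conjI)
      show "\<exists>p. \<phi> p \<noteq> 0" using \<phi>[of 0] u[of 0] by (intro exI[of _ "abs_circle 0"]) simp
      have "\<epsilon> * a (abs_circle t) * v' t + b (abs_circle t) * v t + c (abs_circle t) * u t = l * u t" for t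
        using nz[of t] by (simp add: v'_def field_simps)
      then have "complex_of_real (\<epsilon> * a (abs_circle t) * v' t + b (abs_circle t) * v t + c (abs_circle t) * u t) = of_real (l * u t)" for t
        by simp
      then show "\<forall>p. complex_of_real (\<epsilon> * a p) * (circle_deriv ^^ 2) \<phi> p + complex_of_real (b p) * circle_deriv \<phi> p
          + complex_of_real (c p) * \<phi> p = complex_of_real l * \<phi> p"
        unfolding circle_all[of "\<lambda>p. _ p = _ p"] C \<phi> by simp
    qed (rule C)
  qed
  have le: "Re z \<le> l \<and> (Re z = l \<longrightarrow> z = of_real l)" if ez: "circle_eigenvalue a b c \<epsilon> z" for z
  proof -
    obtain w :: "circle \<Rightarrow> complex" where w: "C_k_circle 2 w" "\<exists>p. w p \<noteq> 0"
      "\<And>p. of_real (\<epsilon> * a p) * (circle_deriv ^^ 2) w p + of_real (b p) * circle_deriv w p + of_real (c p) * w p = z * w p"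
      using ez unfolding circle_eigenvalue_def by auto
    obtain s where s: "w (abs_circle s) \<noteq> 0" using w(2) by (metis abs_rep_circle)
    note W = C_2_circleD[OF w(1)]
    let ?w = "\<lambda>t. w (abs_circle t)" and ?p = "\<lambda>t. circle_deriv w (abs_circle t)"
      and ?q = "\<lambda>t. (circle_deriv ^^ 2) w (abs_circle t)"
    have Re: "((\<lambda>t. Re (g t)) has_real_derivative Re g') (at t)"
      and Im: "((\<lambda>t. Im (g t)) has_real_derivative Im g') (at t)"
      if "(g has_vector_derivative g') (at t)" for g g' t
      using bounded_linear.has_vector_derivative[OF bounded_linear_Re that]
        bounded_linear.has_vector_derivative[OF bounded_linear_Im that]
      by (simp_all add: has_real_derivative_iff_has_vector_derivative)
    have eq: "\<epsilon> * a (abs_circle t) * Re (?q t) + b (abs_circle t) * Re (?p t) + c (abs_circle t) * Re (?w t)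
        = Re z * Re (?w t) - Im z * Im (?w t)"
      "\<epsilon> * a (abs_circle t) * Im (?q t) + b (abs_circle t) * Im (?p t) + c (abs_circle t) * Im (?w t)
        = Re z * Im (?w t) + Im z * Re (?w t)" for t
      using arg_cong[OF w(3)[of "abs_circle t"], of Re] arg_cong[OF w(3)[of "abs_circle t"], of Im]
      by simp_all
    have "Re (?w s) \<noteq> 0 \<or> Im (?w s) \<noteq> 0"
      using s by (auto simp: complex_eq_iff)
    note L = eigenvalue_le_principal[OF sol pu u Re[OF W(1)] Im[OF W(1)] Re[OF W(2)] Im[OF W(2)]
        periodic_circle[of "\<lambda>p. Re (w p)"] periodic_circle[of "\<lambda>p. Im (w p)"] eq this]
    show ?thesis using L by (auto simp: complex_eq_iff)
  qed
  show ?thesis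
    unfolding principal_eigenvalue_def
  proof (rule the_equality)
    show "circle_eigenvalue a b c \<epsilon> (of_real l) \<and> (\<forall>w. circle_eigenvalue a b c \<epsilon> w \<longrightarrow> Re w \<le> Re (of_real l))"
      using ev le unfolding Re_complex_of_real by blast
    show "z = of_real l" if "circle_eigenvalue a b c \<epsilon> z \<and> (\<forall>w. circle_eigenvalue a b c \<epsilon> w \<longrightarrow> Re w \<le> Re z)" for z
    proof -
      have "Re (of_real l) \<le> Re z" using that ev by blast
      then have "l \<le> Re z" by simp
      then show ?thesis using le[of z] that by (simp add: order.antisym)
    qed
  qed
qed

section \<open>Small diffusion: comparison functions\<close>

text \<open>A smooth switch replacing the indicator of the positive reals. That its values lie
  strictly between 0 and 1 keeps \<open>\<theta> (1 - \<theta>)\<close> positive in the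
  supersolution.\<close>

definition logistic :: "real \<Rightarrow> real"
  where "logistic x = 1 / (1 + exp (- x))"

lemma logistic_pos: "0 < logistic x" and logistic_less_1: "logistic x < 1"
  by (simp_all add: logistic_def add_pos_pos)

lemma logistic_minus: "logistic (- x) = 1 - logistic x"
  by (simp add: logistic_def exp_minus field_simps add_nonneg_eq_0_iff)

lemma logistic_has_derivative:
  "(logistic has_real_derivative logistic x * (1 - logistic x)) (at x)"
proof -
  have "1 + exp (- x) \<noteq> 0" by (simp add: add_nonneg_eq_0_iff)
  then show ?thesis
    unfolding logistic_def
    by (auto intro!: derivative_eq_intros simp: field_simps power2_eq_square)
qed

lemma continuous_on_logistic [continuous_intros]:
  assumes "continuous_on S f"
  shows "continuous_on S (\<lambda>x. logistic (f x))"
  unfolding logistic_def by (intro continuous_intros assms) (simp add: add_nonneg_eq_0_iff)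

lemma logistic_le_exp: "logistic x \<le> exp x"
proof -
  have "1 / (1 + exp (- x)) \<le> 1 / exp (- x)"
    by (intro divide_left_mono) (auto simp: add_pos_pos)
  then show ?thesis by (simp add: logistic_def exp_minus divide_inverse)
qed

lemma mult_exp_minus_le:
  fixes K y :: real
  assumes "K > 0"
  shows "y * exp (- (K * y)) \<le> 1 / K"
proof -
  have "K * y \<le> exp (K * y)" using exp_ge_add_one_self[of "K * y"] by linarith
  then show ?thesis using assms by (simp add: exp_minus field_simps)
qed

text \<open>For \<open>x\<close> up to \<open>\<eta>\<close> the bound 1 on the switch suffices.
  Beyond, the switch decays at least like \<open>exp (- K (x - \<eta>))\<close>, which beats the
  linear growth of \<open>x - \<eta>\<close> and leaves at most \<open>1 / K\<close>.\<close>

lemma logistic_mult_small: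
  assumes x: "x \<ge> 0" and q: "\<bar>q - x\<bar> \<le> \<eta>" and K: "K > 0"
  shows "logistic (- (K * q)) * x \<le> \<eta> + 1 / K"
proof (cases "x \<le> \<eta>")
  case True
  have "logistic (- (K * q)) * x \<le> 1 * x"
    using x logistic_less_1 by (intro mult_right_mono) (auto simp: less_imp_le)
  then show ?thesis using True K by (simp add: add_increasing2)
next
  case False
  have "logistic (- (K * q)) \<le> exp (- (K * q))" by (rule logistic_le_exp)
  also have "\<dots> \<le> exp (- (K * (x - \<eta>)))" using q K by (auto simp: abs_le_iff)
  finally have "logistic (- (K * q)) * (x - \<eta>) \<le> exp (- (K * (x - \<eta>))) * (x - \<eta>)"
    using False by (intro mult_right_mono) auto
  also have "\<dots> \<le> 1 / K" using mult_exp_minus_le[OF K, of "x - \<eta>"] by (simp add: mult.commute)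
  finally have 1: "logistic (- (K * q)) * (x - \<eta>) \<le> 1 / K" .
  have "\<eta> \<ge> 0" using q by linarith
  then have "logistic (- (K * q)) * \<eta> \<le> 1 * \<eta>"
    using logistic_less_1 by (intro mult_right_mono) (auto simp: less_imp_le)
  with 1 show ?thesis by (simp add: algebra_simps)
qed

text \<open>The product nearly reaches the positive part of \<open>x\<close> although the switch
  sees only the approximation \<open>q\<close>. The reflection formula treats \<open>x >= 0\<close>;
  for negative \<open>x\<close> the previous bound is applied to \<open>- x\<close> and
  \<open>- q\<close>.\<close>

lemma logistic_mult_ge:
  assumes q: "\<bar>q - x\<bar> \<le> \<eta>" and K: "K > 0"
  shows "max 0 x - (\<eta> + 1 / K) \<le> logistic (K * q) * x"
proof (cases "x \<ge> 0")
  case True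
  then show ?thesis
    using logistic_mult_small[OF True q K] by (simp add: logistic_minus algebra_simps)
next
  case False
  have "\<bar>(- q) - (- x)\<bar> \<le> \<eta>" using q by linarith
  from logistic_mult_small[OF _ this K] False show ?thesis by simp
qed

text \<open>On the compact set where \<open>F\<close> is at least \<open>M\<close>, the penalty
  \<open>D\<close> has a positive minimum, so \<open>D / \<epsilon>\<close> uniformly exceeds the
  largest possible excess of \<open>F\<close> over \<open>M\<close> once \<open>\<epsilon>\<close>
  is small.\<close>

lemma penalty:
  fixes F D :: "real \<Rightarrow> real"
  assumes S: "compact S" and c: "continuous_on S F" "continuous_on S D"
    and D: "\<And>t. t \<in> S \<Longrightarrow> D t \<ge> 0" and F: "\<And>t. t \<in> S \<Longrightarrow> D t = 0 \<Longrightarrow> F t < M"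
  obtains e where "e > 0" "\<And>\<epsilon> t. 0 < \<epsilon> \<Longrightarrow> \<epsilon> < e \<Longrightarrow> t \<in> S \<Longrightarrow> F t - D t / \<epsilon> \<le> M"
proof (cases "S \<inter> F -` {M..} = {}")
  case True
  have "F t - D t / \<epsilon> \<le> M" if "0 < \<epsilon>" "t \<in> S" for \<epsilon> t
  proof -
    have "D t / \<epsilon> \<ge> 0" using D that by simp
    moreover have "F t < M" using True that(2) by force
    ultimately show ?thesis by linarith
  qed
  then show ?thesis using that[of 1] by simp
next
  case False
  let ?K = "S \<inter> F -` {M..}"
  have "compact ?K"
    using S c(1) by (metis closed_atLeast compact_Int_closed compact_imp_closed
        continuous_closed_preimage inf.left_idem)
  then obtain z where z: "z \<in> ?K" "\<And>t. t \<in> ?K \<Longrightarrow> D z \<le> D t"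
    using continuous_attains_inf[of ?K D] False c(2) continuous_on_subset by (metis inf_le1)
  obtain w where w: "w \<in> S" "\<And>t. t \<in> S \<Longrightarrow> F t \<le> F w"
    using continuous_attains_sup[OF S _ c(1)] False by blast
  have Dz: "D z > 0" using D[of z] F[of z] z(1) by force
  define e where "e = D z / (\<bar>F w - M\<bar> + 1)"
  have "F t - D t / \<epsilon> \<le> M" if \<epsilon>: "0 < \<epsilon>" "\<epsilon> < e" and t: "t \<in> S" for \<epsilon> t
  proof (cases "F t \<ge> M")
    case True
    have "\<bar>F w - M\<bar> + 1 \<le> D z / \<epsilon>"
      using \<epsilon> Dz by (simp add: e_def field_simps)
    also have "\<dots> \<le> D t / \<epsilon>"
      using z(2)[of t] t True \<epsilon> by (intro divide_right_mono) auto
    finally show ?thesis using w(2)[OF t] by linarith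
  next
    case False
    have "D t / \<epsilon> \<ge> 0" using D that by simp
    then show ?thesis using False by linarith
  qed
  then show ?thesis using that[of e] Dz by (simp add: e_def)
qed

text \<open>Scale \<open>w\<close> by the largest value \<open>k\<close> of \<open>u / w\<close>,
  which is attained by periodicity; then \<open>k w\<close> touches \<open>u\<close> from above and
  the operator is compared at the contact point.\<close>

lemma (in periodic_elliptic) supersolution_ge:
  assumes sol: "solves l u v" and pu: "periodic u" and u: "\<And>t. u t > 0"
    and w: "\<And>t. (w has_real_derivative w1 t) (at t)" "\<And>t. (w1 has_real_derivative w2 t) (at t)"
    and pw: "periodic w" and wp: "\<And>t. w t > 0"
    and sup: "\<And>t. A t * w2 t + B t * w1 t + C t * w t \<le> m * w t"
  shows "l \<le> m"
proof -
  have "continuous_on UNIV w" using w(1) by (meson DERIV_isCont continuous_at_imp_continuous_on)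
  then have "continuous_on UNIV (\<lambda>t. u t / w t)"
    using wp by (intro continuous_intros solves_continuous(1)[OF sol]) (auto simp: less_imp_neq[symmetric])
  moreover have "periodic (\<lambda>t. u t / w t)" using pu pw by (simp add: periodic_def)
  ultimately obtain p where p: "\<And>t. u t / w t \<le> u p / w p"
    using periodic_attains_sup[of "\<lambda>t. u t / w t"] by blast
  define k where "k = u p / w p"
  have k: "k > 0" using u[of p] wp[of p] by (simp add: k_def)
  have kp: "u p = k * w p" using wp[of p] by (simp add: k_def)
  note D = sol[unfolded solves_def, rule_format]
  have "A p * (((l - C p) * u p - B p * v p) / A p) + B p * v p + C p * u p
      \<le> A p * (k * w2 p) + B p * (k * w1 p) + C p * (k * w p)"
  proof (rule operator_le_at_contact[OF zero_less_one, where u = u and w = "\<lambda>t. k * w t"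
        and ?u1.0 = v and ?w1.0 = "\<lambda>t. k * w1 t"])
    show "u t \<le> k * w t" for t
      using p[of t] wp[of t] by (simp add: k_def[symmetric] divide_le_eq)
    show "((\<lambda>t. k * w t) has_real_derivative k * w1 t) (at t)" for t by (rule DERIV_cmult[OF w(1)])
    show "((\<lambda>t. k * w1 t) has_real_derivative k * w2 p) (at p)" by (rule DERIV_cmult[OF w(2)])
    show "(u has_real_derivative v t) (at t)" for t using D by blast
    show "(v has_real_derivative ((l - C p) * u p - B p * v p) / A p) (at p)" using D by blast
  qed (use kp less_imp_le[OF A_pos[of p]] in auto)
  also have "\<dots> = k * (A p * w2 p + B p * w1 p + C p * w p)" by (simp add: algebra_simps)
  also have "\<dots> \<le> k * (m * w p)" using k sup[of p] by (intro mult_left_mono) auto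
  finally have "((l - C p) * u p - B p * v p) + B p * v p + C p * u p \<le> k * (m * w p)"
    using A_pos[of p] by simp
  then have "l * u p \<le> m * u p"
    by (simp add: kp algebra_simps)
  then show ?thesis using u[of p] by simp
qed

text \<open>\<open>\<alpha>\<close> and \<open>\<beta>\<close> are the lifts of the coefficients \<open>a\<close> and \<open>b\<close> to the real line.\<close>

locale small_diffusion =
  fixes \<alpha> \<alpha>' \<beta> \<beta>' :: "real \<Rightarrow> real"
  assumes d\<alpha>: "\<And>t. (\<alpha> has_real_derivative \<alpha>' t) (at t)" and c\<alpha>': "continuous_on UNIV \<alpha>'"
    and d\<beta>: "\<And>t. (\<beta> has_real_derivative \<beta>' t) (at t)" and c\<beta>': "continuous_on UNIV \<beta>'"
    and per\<alpha>: "periodic \<alpha>" and per\<beta>: "periodic \<beta>" and \<alpha>_pos: "\<And>t. \<alpha> t > 0"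
begin

lemma c\<alpha>: "continuous_on UNIV \<alpha>" and c\<beta>: "continuous_on UNIV \<beta>"
  using d\<alpha> d\<beta> by (meson DERIV_isCont continuous_at_imp_continuous_on)+

lemma nz\<alpha>: "\<alpha> t \<noteq> 0" using \<alpha>_pos[of t] by simp

lemma elliptic:
  assumes "continuous_on UNIV \<gamma>" "periodic \<gamma>" "\<epsilon> > 0"
  shows "periodic_elliptic (\<lambda>t. \<epsilon> * \<alpha> t) \<beta> \<gamma>"
  by unfold_locales
     (use assms c\<alpha> c\<beta> per\<alpha> per\<beta> \<alpha>_pos in \<open>auto simp: periodic_def intro: continuous_intros\<close>)

lemma \<alpha>_lower:
  obtains m where "m > 0" "\<And>t. m \<le> \<alpha> t"
proof -
  obtain p where p: "\<And>t. - \<alpha> t \<le> - \<alpha> p"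
    by (rule periodic_attains_sup[of "\<lambda>t. - \<alpha> t"])
       (use c\<alpha> per\<alpha> in \<open>auto simp: periodic_def intro: continuous_intros\<close>)
  show ?thesis using that[of "\<alpha> p"] \<alpha>_pos p by simp
qed

lemma difference_quotient_close:
  assumes "\<eta> > 0"
  obtains h where "h > 0" "\<And>t. \<bar>(\<beta> (t + h) - \<beta> t) / h - \<beta>' t\<bar> \<le> \<eta>"
proof -
  \<comment> \<open>The interval \<open>[0, 2]\<close> leaves room for \<open>t + h\<close> when
    \<open>t\<close> is in the unit interval and \<open>h\<close> is at most 1.\<close>
  have "uniformly_continuous_on {0..2} \<beta>'"
    using c\<beta>' continuous_on_subset by (intro compact_uniformly_continuous) blast+
  then obtain d where d: "d > 0" "\<And>x y. x \<in> {0..2} \<Longrightarrow> y \<in> {0..2} \<Longrightarrow> \<bar>y - x\<bar> < d \<Longrightarrow> \<bar>\<beta>' y - \<beta>' x\<bar> < \<eta>"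
    using assms unfolding uniformly_continuous_on_def dist_real_def by metis
  define h where "h = min 1 (d / 2)"
  have h: "h > 0" "h \<le> 1" "h < d" using d(1) by (auto simp: h_def)
  let ?g = "\<lambda>t. \<bar>(\<beta> (t + h) - \<beta> t) / h - \<beta>' t\<bar>"
  have "?g t \<le> \<eta>" if t: "0 \<le> t" "t \<le> 1" for t
  proof -
    obtain z where z: "t < z" "z < t + h" "\<beta> (t + h) - \<beta> t = (t + h - t) * \<beta>' z"
      using MVT2[of t "t + h" \<beta> \<beta>'] h d\<beta> by auto
    have "\<bar>\<beta>' z - \<beta>' t\<bar> < \<eta>" by (rule d(2)) (use z t h in auto)
    then show ?thesis using z h by simp
  qed
  note near = this
  have gp: "periodic ?g"
  proof -
    have "\<beta> (t + 1 + h) = \<beta> (t + h)" for t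
      using per\<beta>[unfolded periodic_def, rule_format, of "t + h"] by (simp add: algebra_simps)
    moreover have "\<beta> (t + 1) = \<beta> t" "\<beta>' (t + 1) = \<beta>' t" for t
      using per\<beta> periodic_has_derivative[OF per\<beta> d\<beta>] unfolding periodic_def by blast+
    ultimately show ?thesis by (simp add: periodic_def)
  qed
  have "?g t \<le> \<eta>" for t
  proof -
    have "?g (frac t) \<le> \<eta>" by (rule near) (simp_all add: less_imp_le[OF frac_lt_1])
    then show ?thesis by (rule subst[OF periodic_frac[OF gp, of t], where P = "\<lambda>x. x \<le> \<eta>"])
  qed
  then show ?thesis using that h by blast
qed

lemma balance_continuous:
  assumes r: "continuous_on UNIV r"
  shows "continuous_on UNIV (\<lambda>s. integral {0..1} (\<lambda>t. logistic (r t + s * \<beta> t) * \<beta> t / \<alpha> t))"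
proof -
  have "continuous_on (UNIV \<times> cbox 0 1) (\<lambda>(s, t). logistic (r t + s * \<beta> t) * \<beta> t / \<alpha> t)"
    unfolding case_prod_beta
    by (intro continuous_intros continuous_on_compose2[OF r] continuous_on_compose2[OF c\<beta>]
        continuous_on_compose2[OF c\<alpha>]) (auto simp: nz\<alpha>)
  from integral_continuous_on_param[OF this] show ?thesis by simp
qed

text \<open>For large \<open>s\<close> the switch approaches the indicator of
  \<open>\<beta> > 0\<close>. Quantitatively, where \<open>\<beta>\<close> is nonnegative the switch
  is at least \<open>1 / (1 + exp Q)\<close>, and where \<open>\<beta>\<close> is negative the loss
  is of order \<open>1 / s\<close>.\<close>

lemma balance_pos:
  assumes r: "continuous_on UNIV r" "periodic r" and pos: "\<beta> t0 > 0"
  obtains s where "integral {0..1} (\<lambda>t. logistic (r t + s * \<beta> t) * \<beta> t / \<alpha> t) > 0"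
proof -
  obtain Q where Q: "\<And>t. \<bar>r t\<bar> \<le> Q" using periodic_bounded[OF r(2,1)] by metis
  obtain m where m: "m > 0" "\<And>t. m \<le> \<alpha> t" using \<alpha>_lower by metis
  let ?g = "\<lambda>t. max 0 (\<beta> t) / ((1 + exp Q) * \<alpha> t)"
  have e: "1 + exp Q > 0" by (simp add: add_pos_pos)
  have cg: "continuous_on {0..1} ?g"
    by (intro continuous_intros continuous_on_subset[OF c\<beta>] continuous_on_subset[OF c\<alpha>])
       (use nz\<alpha> e in auto)
  have g0: "?g t \<ge> 0" for t using e \<alpha>_pos[of t] by simp
  have "?g (frac t0) > 0"
    using pos periodic_frac[OF per\<beta>, of t0] e \<alpha>_pos[of "frac t0"] by simp
  then have gt: "?g (frac t0) \<noteq> 0" by (rule less_imp_neq[symmetric])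
  have "integral {0..1} ?g \<noteq> 0"
  proof
    assume "integral {0..1} ?g = 0"
    then have "\<forall>x\<in>{0..1}. ?g x = 0" using integral_eq_0_iff[OF cg zero_less_one g0] by blast
    then have "?g (frac t0) = 0" by (rule bspec) (simp add: less_imp_le[OF frac_lt_1])
    with gt show False by blast
  qed
  moreover have "integral {0..1} ?g \<ge> 0"
    using g0 by (intro Henstock_Kurzweil_Integration.integral_nonneg integrable_continuous_real cg)
  ultimately have I: "integral {0..1} ?g > 0" by simp
  \<comment> \<open>With this \<open>s\<close> the loss \<open>exp Q / (s * m)\<close> is half of
    the integral of \<open>?g\<close>.\<close>
  define s where "s = 2 * exp Q / (m * integral {0..1} ?g)"
  have s: "s > 0" using I m by (simp add: s_def)
  let ?f = "\<lambda>t. logistic (r t + s * \<beta> t) * \<beta> t / \<alpha> t"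
  have cf: "continuous_on {0..1} ?f"
    by (intro continuous_intros continuous_on_subset[OF c\<beta>] continuous_on_subset[OF c\<alpha>]
        continuous_on_subset[OF r(1)]) (use nz\<alpha> in auto)
  have fg: "?g t - exp Q / (s * m) \<le> ?f t" for t
  proof (cases "\<beta> t \<ge> 0")
    case True
    have "s * \<beta> t \<ge> 0" using True s by simp
    then have "- (r t + s * \<beta> t) \<le> Q" using Q[of t] by linarith
    then have "exp (- (r t + s * \<beta> t)) \<le> exp Q" by (simp only: exp_le_cancel_iff)
    then have "1 / (1 + exp Q) \<le> logistic (r t + s * \<beta> t)"
      unfolding logistic_def using e by (intro divide_left_mono) (auto simp: add_pos_pos)
    then have "1 / (1 + exp Q) * (\<beta> t / \<alpha> t) \<le> logistic (r t + s * \<beta> t) * (\<beta> t / \<alpha> t)"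
      using True \<alpha>_pos[of t] by (intro mult_right_mono) auto
    moreover have "exp Q / (s * m) \<ge> 0" using s m by simp
    moreover have "?g t = 1 / (1 + exp Q) * (\<beta> t / \<alpha> t)" using True by (simp add: max_def)
    moreover have "?f t = logistic (r t + s * \<beta> t) * (\<beta> t / \<alpha> t)" by simp
    ultimately show ?thesis by linarith
  next
    case False
    have "logistic (r t + s * \<beta> t) * - \<beta> t \<le> exp (r t + s * \<beta> t) * - \<beta> t"
      using False by (intro mult_right_mono logistic_le_exp) auto
    also have "\<dots> = exp (r t) * (- \<beta> t * exp (- (s * - \<beta> t)))" by (simp add: exp_add)
    also have "\<dots> \<le> exp Q * (1 / s)"
      using Q[of t] mult_exp_minus_le[OF s, of "- \<beta> t"] False by (intro mult_mono) (auto simp: abs_le_iff mult_nonpos_nonneg)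
    finally have "logistic (r t + s * \<beta> t) * - \<beta> t / \<alpha> t \<le> exp Q * (1 / s) / m"
      using m s \<alpha>_pos[of t] by (intro frac_le) auto
    moreover have "?g t = 0" using False by (simp add: max_def)
    moreover have "exp Q * (1 / s) / m = exp Q / (s * m)" by simp
    moreover have "?f t = - (logistic (r t + s * \<beta> t) * - \<beta> t / \<alpha> t)" by simp
    ultimately show ?thesis by linarith
  qed
  have "integral {0..1} (\<lambda>t. ?g t - exp Q / (s * m)) = integral {0..1} ?g - exp Q / (s * m)"
    using Henstock_Kurzweil_Integration.integral_diff[OF integrable_continuous_real[OF cg]
        integrable_continuous_real[OF continuous_on_const], of "exp Q / (s * m)"] by simp
  moreover have "exp Q / (s * m) = integral {0..1} ?g / 2"
    using m I by (simp add: s_def field_simps)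
  ultimately have "integral {0..1} (\<lambda>t. ?g t - exp Q / (s * m)) > 0" using I by linarith
  also have "integral {0..1} (\<lambda>t. ?g t - exp Q / (s * m)) \<le> integral {0..1} ?f"
    by (rule Henstock_Kurzweil_Integration.integral_le[OF integrable_continuous_real[OF continuous_on_diff[OF cg continuous_on_const]]
          integrable_continuous_real[OF cf] fg])
  finally show ?thesis using that by blast
qed

end

text \<open>Makes the exponent of the supersolution below periodic. This is where both signs of the drift
  are needed.\<close>

lemma (in small_diffusion) balance_exists:
  assumes r: "continuous_on UNIV r" "periodic r" and pos: "\<beta> t0 > 0" and neg: "\<beta> t1 < 0"
  obtains s where "integral {0..1} (\<lambda>t. logistic (r t + s * \<beta> t) * \<beta> t / \<alpha> t) = 0"
proof -
  let ?I = "\<lambda>s. integral {0..1} (\<lambda>t. logistic (r t + s * \<beta> t) * \<beta> t / \<alpha> t)"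
  obtain s1 where s1: "?I s1 > 0" using balance_pos[OF r pos] by metis
  \<comment> \<open>For the negated drift, \<open>balance_pos\<close> yields a positive integral at
    \<open>s2\<close>; moving the sign onto \<open>s2\<close> gives a negative integral for the
    original drift at \<open>- s2\<close>.\<close>
  interpret m: small_diffusion \<alpha> \<alpha>' "\<lambda>t. - \<beta> t" "\<lambda>t. - \<beta>' t"
    by unfold_locales (use d\<alpha> c\<alpha>' d\<beta> c\<beta>' per\<alpha> per\<beta> \<alpha>_pos in
        \<open>auto simp: periodic_def intro: continuous_intros DERIV_minus\<close>)
  obtain s2 where s2: "integral {0..1} (\<lambda>t. logistic (r t + s2 * - \<beta> t) * - \<beta> t / \<alpha> t) > 0"
    using m.balance_pos[OF r, of t1] neg by auto
  have "(\<lambda>t. logistic (r t + s2 * - \<beta> t) * - \<beta> t / \<alpha> t) = (\<lambda>t. - (logistic (r t + (- s2) * \<beta> t) * \<beta> t / \<alpha> t))"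
    by auto
  with s2 have s2: "?I (- s2) < 0" by simp
  have c: "continuous_on {a..b} ?I" for a b
    using balance_continuous[OF r(1)] continuous_on_subset by blast
  show ?thesis
  proof (cases "- s2 \<le> s1")
    case True
    then show ?thesis using IVT'[OF _ _ True c, of 0] s1 s2 that by auto
  next
    case False
    then show ?thesis using IVT2'[OF _ _ _ c, of "- s2" 0 s1] s1 s2 that by auto
  qed
qed

text \<open>The function \<open>s\<^sup>2\<close> is a Dirichlet subsolution on the interval of radius \<open>sqrt (P \<epsilon>)\<close> around
  \<open>p\<close>; the two factors next to \<open>\<epsilon> * \<alpha> t\<close> and \<open>D t\<close> are its second and first derivatives.\<close>

lemma quartic_subsolution:
  fixes \<alpha> D :: "real \<Rightarrow> real"
  assumes m: "m > 0" "\<And>t. m \<le> \<alpha> t" and N: "\<And>t. \<alpha> t \<le> N"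
    and D: "D p = 0" "(D has_real_derivative D1) (at p)" "D1 \<le> 0" and \<delta>: "\<delta> > 0"
  shows "\<exists>P e. P > 0 \<and> e > 0 \<and> (\<forall>\<epsilon> t s. 0 < \<epsilon> \<longrightarrow> \<epsilon> < e \<longrightarrow> (t - p)\<^sup>2 < P * \<epsilon> \<longrightarrow>
      s = 1 - (t - p)\<^sup>2 / (P * \<epsilon>) \<longrightarrow>
      - \<delta> * s\<^sup>2 < \<epsilon> * \<alpha> t * ((8 - 12 * s) / (P * \<epsilon>)) + D t * (- 4 * (t - p) * s / (P * \<epsilon>)))"
proof -
  \<comment> \<open>In \<open>Q\<close>, the part \<open>12 * N\<close> comes from the second
    derivative and 4 from the drift remainder. \<open>P\<close> is chosen such that
    \<open>(8 * m - Q * s) / P + \<delta> * s^2\<close> becomes the sum of squares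
    \<open>\<delta> * ((s - 8 * m / Q)^2 + (8 * m / Q)^2)\<close>.\<close>
  define Q where "Q = 12 * N + 4"
  have "N > 0" using m(1) m(2)[of p] N[of p] by linarith
  then have Q: "Q > 0" by (simp add: Q_def)
  define P where "P = Q\<^sup>2 / (16 * m * \<delta>)"
  have P: "P > 0" using Q m(1) \<delta> by (simp add: P_def)
  \<comment> \<open>Near \<open>p\<close> the nonlinear remainder of the drift is at most
    \<open>|t - p| / P\<close>, so it costs at most \<open>4 * s / P\<close>; the linear part has
    the favourable sign because \<open>D1\<close> is nonpositive.\<close>
  have "\<exists>r>0. \<forall>t. norm (t - p) < r \<longrightarrow> norm (D t - D p - D1 * (t - p)) \<le> (1 / P) * norm (t - p)"
    using D(2)[unfolded has_field_derivative_def has_derivative_at_alt, THEN conjunct2, rule_format, of "1 / P"] P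
    by simp
  then obtain r where r: "r > 0" "\<And>t. \<bar>t - p\<bar> < r \<Longrightarrow> \<bar>D t - D1 * (t - p)\<bar> \<le> (1 / P) * \<bar>t - p\<bar>"
    using D(1) by auto
  have main: "- \<delta> * s\<^sup>2 < \<epsilon> * \<alpha> t * ((8 - 12 * s) / (P * \<epsilon>)) + D t * (- 4 * (t - p) * s / (P * \<epsilon>))"
    if \<epsilon>: "0 < \<epsilon>" "\<epsilon> < r\<^sup>2 / P" and t: "(t - p)\<^sup>2 < P * \<epsilon>" and s: "s = 1 - (t - p)\<^sup>2 / (P * \<epsilon>)" for \<epsilon> t s
  proof -
    have w: "P * \<epsilon> > 0" using P \<epsilon> by simp
    have s0: "s > 0" "s \<le> 1" using t w by (simp_all add: s)
    have ts: "(t - p)\<^sup>2 / (P * \<epsilon>) = 1 - s" by (simp add: s)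
    have "P * \<epsilon> < r\<^sup>2" using \<epsilon>(2) P by (simp add: field_simps)
    then have "\<bar>t - p\<bar>\<^sup>2 < r\<^sup>2" using t by simp
    then have "\<bar>t - p\<bar> < r" using r(1) by (meson less_imp_le power2_less_imp_less)
    have "(D t - D1 * (t - p)) * (t - p) \<le> \<bar>D t - D1 * (t - p)\<bar> * \<bar>t - p\<bar>"
      by (simp flip: abs_mult)
    also have "\<dots> \<le> (1 / P) * \<bar>t - p\<bar> * \<bar>t - p\<bar>"
      by (rule mult_right_mono[OF r(2)[OF \<open>\<bar>t - p\<bar> < r\<close>]]) simp
    also have "(1 / P) * \<bar>t - p\<bar> * \<bar>t - p\<bar> = (1 / P) * (t - p)\<^sup>2"
      by (simp add: power2_eq_square)
    finally have "D t * (t - p) \<le> (1 / P) * (t - p)\<^sup>2 + D1 * (t - p)\<^sup>2"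
      by (simp add: algebra_simps power2_eq_square)
    moreover have "D1 * (t - p)\<^sup>2 \<le> 0" using D(3) by (simp add: mult_nonpos_nonneg)
    ultimately have "D t * (t - p) \<le> (1 / P) * (t - p)\<^sup>2" by linarith
    then have "(4 * s / (P * \<epsilon>)) * (D t * (t - p)) \<le> (4 * s / (P * \<epsilon>)) * ((1 / P) * (t - p)\<^sup>2)"
      using s0 w by (intro mult_left_mono) auto
    also have "\<dots> = 4 * (1 / P) * s * ((t - p)\<^sup>2 / (P * \<epsilon>))" by simp
    also have "\<dots> = 4 * (1 / P) * s * (1 - s)" by (simp only: ts)
    also have "\<dots> \<le> 4 * (1 / P) * s * 1" using s0 P by (intro mult_left_mono) auto
    also have "(4 * s / (P * \<epsilon>)) * (D t * (t - p)) = - (D t * (- 4 * (t - p) * s / (P * \<epsilon>)))"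
    proof -
      have "(4 * s / w) * (d * x) = - (d * (- 4 * x * s / w))" for d x w :: real
        by (simp add: mult_ac)
      then show ?thesis by blast
    qed
    finally have 1: "D t * (- 4 * (t - p) * s / (P * \<epsilon>)) \<ge> - (4 * (1 / P) * s)"
      by linarith
    have "12 * (\<alpha> t * s) \<le> 12 * (N * s)" using N[of t] s0 by simp
    then have "8 * m - 12 * (N * s) \<le> \<alpha> t * (8 - 12 * s)"
      using m(2)[of t] by (simp add: algebra_simps)
    then have "(8 * m - 12 * (N * s)) / P \<le> \<alpha> t * (8 - 12 * s) / P" using P by (simp add: divide_right_mono)
    also have "\<dots> = \<epsilon> * \<alpha> t * ((8 - 12 * s) / (P * \<epsilon>))" using \<epsilon> P by (simp add: field_simps)
    finally have 2: "(8 * m - 12 * (N * s)) / P \<le> \<epsilon> * \<alpha> t * ((8 - 12 * s) / (P * \<epsilon>))" .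
    have "(8 * m - 12 * (N * s)) / P - 4 * (1 / P) * s + \<delta> * s\<^sup>2 = (8 * m - Q * s) / P + \<delta> * s\<^sup>2"
      using P by (simp add: Q_def field_simps)
    also have "\<dots> = \<delta> * ((s - 8 * m / Q)\<^sup>2 + (8 * m / Q)\<^sup>2)"
      using Q m(1) \<delta> by (simp add: P_def field_simps power2_eq_square)
    also have "\<dots> > 0"
    proof -
      have "(8 * m / Q)\<^sup>2 > 0" using Q m(1) by simp
      then show ?thesis using \<delta> by (intro mult_pos_pos add_nonneg_pos) auto
    qed
    finally show ?thesis using 1 2 by linarith
  qed
  show ?thesis
    by (intro exI[of _ P] exI[of _ "r\<^sup>2 / P"] conjI allI impI main) (use P r(1) in auto)
qed

context small_diffusion
begin

lemma drift_ratio_has_derivative: "((\<lambda>t. \<theta> t * \<beta> t / \<alpha> t) has_real_derivative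
     (\<theta>' * \<beta> t + \<theta> t * \<beta>' t) / \<alpha> t - \<theta> t * \<beta> t * \<alpha>' t / (\<alpha> t)\<^sup>2) (at t)"
  if "(\<theta> has_real_derivative \<theta>') (at t)"
proof -
  have "((\<lambda>t. \<theta> t * \<beta> t) has_real_derivative \<theta>' * \<beta> t + \<beta>' t * \<theta> t) (at t)"
    by (rule DERIV_mult[OF that d\<beta>])
  from DERIV_divide[OF this d\<alpha> nz\<alpha>] show ?thesis
    by (rule DERIV_cong) (use nz\<alpha>[of t] in \<open>simp add: field_simps power2_eq_square\<close>)
qed

text \<open>The exponent \<open>\<theta>\<close> approximates the indicator of \<open>\<beta>' > 0\<close> at the zeros of \<open>\<beta>\<close>; the difference quotient
  \<open>q\<close> replaces \<open>\<beta>'\<close> because \<open>\<theta>\<close> has to be differentiable.\<close>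

lemma principal_upper:
  assumes \<gamma>: "continuous_on UNIV \<gamma>" "periodic \<gamma>"
    and pos: "\<beta> t0 > 0" and neg: "\<beta> t1 < 0"
    and M: "\<And>t. \<beta> t = 0 \<Longrightarrow> \<gamma> t - max 0 (\<beta>' t) \<le> M" and \<delta>: "\<delta> > 0"
  obtains e where "e > 0" "\<And>\<epsilon> l u v. 0 < \<epsilon> \<Longrightarrow> \<epsilon> < e \<Longrightarrow>
    periodic_elliptic.solves (\<lambda>t. \<epsilon> * \<alpha> t) \<beta> \<gamma> l u v \<Longrightarrow> periodic u \<Longrightarrow> (\<And>t. u t > 0) \<Longrightarrow> l \<le> M + \<delta>"
proof -
  \<comment> \<open>This makes \<open>1 / K\<close> equal to \<open>\<delta> / 8\<close>, the error
    allowed for the difference quotient; the two losses together stay below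
    \<open>\<delta>\<close>.\<close>
  define K where "K = 8 / \<delta>"
  have K: "K > 0" using \<delta> by (simp add: K_def)
  obtain h where h: "h > 0" "\<And>t. \<bar>(\<beta> (t + h) - \<beta> t) / h - \<beta>' t\<bar> \<le> \<delta> / 8"
    using difference_quotient_close[OF divide_pos_pos[OF \<delta>, of 8]] by auto
  define q where "q t = (\<beta> (t + h) - \<beta> t) / h" for t
  define q' where "q' t = (\<beta>' (t + h) - \<beta>' t) / h" for t
  have per': "periodic \<alpha>'" "periodic \<beta>'"
    using periodic_has_derivative per\<alpha> per\<beta> d\<alpha> d\<beta> by blast+
  have dq: "(q has_real_derivative q' t) (at t)" for t
  proof -
    have "((\<lambda>s. \<beta> (s + h)) has_real_derivative \<beta>' (t + h)) (at t)"
      using d\<beta>[of "t + h"] by (simp add: DERIV_shift)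
    from DERIV_cdivide[OF DERIV_diff[OF this d\<beta>], of h] show ?thesis
      by (simp add: q_def[abs_def] q'_def)
  qed
  have cq': "continuous_on UNIV q'"
    unfolding q'_def by (intro continuous_intros c\<beta>' continuous_on_compose2[OF c\<beta>']) (use h in auto)
  have cq: "continuous_on UNIV q" using dq by (meson DERIV_isCont continuous_at_imp_continuous_on)
  have shift: "\<alpha> (t + 1) = \<alpha> t" "\<alpha>' (t + 1) = \<alpha>' t" "\<beta> (t + 1) = \<beta> t" "\<beta>' (t + 1) = \<beta>' t" "\<gamma> (t + 1) = \<gamma> t" for t
    using per\<alpha> per\<beta> per' \<gamma>(2) unfolding periodic_def by blast+
  have shiftq: "q (t + 1) = q t" "q' (t + 1) = q' t" for t
  proof -
    have "t + 1 + h = t + h + 1" by simp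
    then show "q (t + 1) = q t" "q' (t + 1) = q' t" by (simp_all only: q_def q'_def shift)
  qed
  have Kq: "continuous_on UNIV (\<lambda>t. K * q t)" "periodic (\<lambda>t. K * q t)"
    using cq shiftq by (auto simp: periodic_def intro!: continuous_intros)
  obtain s where s: "integral {0..1} (\<lambda>t. logistic (K * q t + s * \<beta> t) * \<beta> t / \<alpha> t) = 0"
    using balance_exists[OF Kq pos neg] by blast
  define \<theta> where "\<theta> t = logistic (K * q t + s * \<beta> t)" for t
  define \<theta>' where "\<theta>' t = \<theta> t * (1 - \<theta> t) * (K * q' t + s * \<beta>' t)" for t
  have d\<theta>: "(\<theta> has_real_derivative \<theta>' t) (at t)" for t
    unfolding \<theta>_def \<theta>'_def
    by (rule DERIV_chain2[OF logistic_has_derivative]) (intro DERIV_add DERIV_cmult dq d\<beta>)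
  have c\<theta>: "continuous_on UNIV \<theta>" using d\<theta> by (meson DERIV_isCont continuous_at_imp_continuous_on)
  have \<theta>01: "0 < \<theta> t" "\<theta> t < 1" for t by (simp_all add: \<theta>_def logistic_pos logistic_less_1)
  define g where "g t = \<theta> t * \<beta> t / \<alpha> t" for t
  define g' where "g' t = (\<theta>' t * \<beta> t + \<theta> t * \<beta>' t) / \<alpha> t - \<theta> t * \<beta> t * \<alpha>' t / (\<alpha> t)\<^sup>2" for t
  have dg: "(g has_real_derivative g' t) (at t)" for t
    using drift_ratio_has_derivative[OF d\<theta>, of t] by (simp add: g_def[abs_def] g'_def)
  have cg: "continuous_on UNIV g" using dg by (meson DERIV_isCont continuous_at_imp_continuous_on)
  obtain \<Theta> where d\<Theta>: "\<And>t. (\<Theta> has_real_derivative g t) (at t)"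
    using antiderivative_exists[OF cg] by (auto simp: has_real_derivative_iff_has_vector_derivative)
  have "(g has_integral (\<Theta> 1 - \<Theta> 0)) {0..1}"
    by (rule fundamental_theorem_of_calculus)
       (use d\<Theta> in \<open>auto simp: has_real_derivative_iff_has_vector_derivative intro: has_vector_derivative_at_within\<close>)
  then have \<Theta>01: "\<Theta> 1 = \<Theta> 0" using s by (simp add: g_def[abs_def] \<theta>_def integral_unique)
  have shiftg: "g (t + 1) = g t" "g' (t + 1) = g' t" "\<theta> (t + 1) = \<theta> t" for t
    by (simp_all add: g_def g'_def \<theta>_def \<theta>'_def shift shiftq)
  have per\<Theta>: "\<Theta> (t + 1) = \<Theta> t" for t
  proof -
    have "((\<lambda>t. \<Theta> (t + 1) - \<Theta> t) has_real_derivative 0) (at t)" for t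
    proof -
      have "((\<lambda>t. \<Theta> (t + 1)) has_real_derivative g t) (at t)"
        using d\<Theta>[of "t + 1"] by (simp add: DERIV_shift shiftg)
      from DERIV_diff[OF this d\<Theta>] show ?thesis by simp
    qed
    then have "\<Theta> (t + 1) - \<Theta> t = \<Theta> (0 + 1) - \<Theta> 0"
      using DERIV_isconst_all[of "\<lambda>t. \<Theta> (t + 1) - \<Theta> t" t 0] by blast
    then show ?thesis using \<Theta>01 by simp
  qed
  \<comment> \<open>\<open>F - D / \<epsilon>\<close> is the operator applied to the supersolution,
    divided by the supersolution. \<open>D\<close> carries the singular part and vanishes only at
    the zeros of \<open>\<beta>\<close>.\<close>
  define F where "F t = \<gamma> t - \<alpha> t * g' t" for t
  define D where "D t = \<theta> t * (1 - \<theta> t) * (\<beta> t)\<^sup>2 / \<alpha> t" for t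
  have cF: "continuous_on {0..1} F"
  proof -
    have "continuous_on UNIV F"
      unfolding F_def g'_def \<theta>'_def
      by (intro continuous_intros \<gamma> c\<alpha> c\<beta> c\<alpha>' c\<beta>' c\<theta> cq cq') (auto simp: nz\<alpha>)
    then show ?thesis using continuous_on_subset by blast
  qed
  have cD: "continuous_on {0..1} D"
  proof -
    have "continuous_on UNIV D"
      unfolding D_def by (intro continuous_intros c\<alpha> c\<beta> c\<theta>) (auto simp: nz\<alpha>)
    then show ?thesis using continuous_on_subset by blast
  qed
  have D0: "D t \<ge> 0" for t
    using \<theta>01[of t] \<alpha>_pos[of t] by (simp add: D_def)
  have F_zero: "F t < M + \<delta>" if "D t = 0" for t
  proof -
    have b: "\<beta> t = 0" using that \<theta>01[of t] nz\<alpha>[of t] by (simp add: D_def)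
    have "F t = \<gamma> t - logistic (K * q t) * \<beta>' t"
      using nz\<alpha>[of t] b by (simp add: F_def g'_def \<theta>_def)
    moreover have "max 0 (\<beta>' t) - (\<delta> / 8 + 1 / K) \<le> logistic (K * q t) * \<beta>' t"
      by (rule logistic_mult_ge[OF _ K]) (use h(2)[of t] in \<open>simp add: q_def\<close>)
    moreover have "1 / K = \<delta> / 8" by (simp add: K_def)
    ultimately show ?thesis using M[OF b] \<delta> by linarith
  qed
  obtain e where e: "e > 0" "\<And>\<epsilon> t. 0 < \<epsilon> \<Longrightarrow> \<epsilon> < e \<Longrightarrow> t \<in> {0..1} \<Longrightarrow> F t - D t / \<epsilon> \<le> M + \<delta>"
    using penalty[OF compact_Icc cF cD D0 F_zero] by blast
  have "l \<le> M + \<delta>" if \<epsilon>: "0 < \<epsilon>" "\<epsilon> < e"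
    and sol: "periodic_elliptic.solves (\<lambda>t. \<epsilon> * \<alpha> t) \<beta> \<gamma> l u v" "periodic u" "\<And>t. u t > 0" for \<epsilon> l u v
  proof -
    interpret E: periodic_elliptic "\<lambda>t. \<epsilon> * \<alpha> t" \<beta> \<gamma> by (rule elliptic[OF \<gamma> \<epsilon>(1)])
    let ?w = "\<lambda>t. exp (- (\<Theta> t / \<epsilon>))"
    have d1: "(?w has_real_derivative - (g t / \<epsilon>) * ?w t) (at t)" for t
      using DERIV_fun_exp[OF DERIV_minus[OF DERIV_cdivide[OF d\<Theta>, of \<epsilon>]], of t] by (simp only: mult.commute)
    have d2: "((\<lambda>t. - (g t / \<epsilon>) * ?w t) has_real_derivative ((g t / \<epsilon>)\<^sup>2 - g' t / \<epsilon>) * ?w t) (at t)" for t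
      by (rule DERIV_cong[OF DERIV_mult[OF DERIV_minus[OF DERIV_cdivide[OF dg]] d1]])
         (simp add: algebra_simps power2_eq_square)
    have le: "F t - D t / \<epsilon> \<le> M + \<delta>" for t
    proof -
      have p: "periodic (\<lambda>t. F t - D t / \<epsilon>)"
        by (simp add: periodic_def F_def D_def shift shiftg)
      have "F (frac t) - D (frac t) / \<epsilon> \<le> M + \<delta>"
        by (rule e(2)[OF \<epsilon>]) (simp add: less_imp_le[OF frac_lt_1])
      then show ?thesis by (rule subst[OF periodic_frac[OF p, of t], where P = "\<lambda>x. x \<le> M + \<delta>"])
    qed
    show ?thesis
    proof (rule E.supersolution_ge[OF sol d1 d2])
      show "periodic ?w" by (simp add: periodic_def per\<Theta>)
      show "\<epsilon> * \<alpha> t * (((g t / \<epsilon>)\<^sup>2 - g' t / \<epsilon>) * ?w t) + \<beta> t * (- (g t / \<epsilon>) * ?w t) + \<gamma> t * ?w t \<le> (M + \<delta>) * ?w t" for t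
      proof -
        have "\<epsilon> * \<alpha> t * ((g t / \<epsilon>)\<^sup>2 - g' t / \<epsilon>) + \<beta> t * - (g t / \<epsilon>) + \<gamma> t = F t - D t / \<epsilon>"
          using nz\<alpha>[of t] \<epsilon>(1) by (simp add: F_def D_def g_def field_simps power2_eq_square)
        moreover have "\<epsilon> * \<alpha> t * (((g t / \<epsilon>)\<^sup>2 - g' t / \<epsilon>) * ?w t) + \<beta> t * (- (g t / \<epsilon>) * ?w t) + \<gamma> t * ?w t
            = (\<epsilon> * \<alpha> t * ((g t / \<epsilon>)\<^sup>2 - g' t / \<epsilon>) + \<beta> t * - (g t / \<epsilon>) + \<gamma> t) * ?w t"
          by (simp only: distrib_right mult.assoc)
        ultimately have "\<epsilon> * \<alpha> t * (((g t / \<epsilon>)\<^sup>2 - g' t / \<epsilon>) * ?w t) + \<beta> t * (- (g t / \<epsilon>) * ?w t) + \<gamma> t * ?w t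
            = (F t - D t / \<epsilon>) * ?w t"
          by (simp only:)
        also have "\<dots> \<le> (M + \<delta>) * ?w t" by (rule mult_right_mono[OF le]) simp
        finally show ?thesis .
      qed
    qed simp
  qed
  then show ?thesis using that[OF e(1)] by blast
qed

text \<open>Where \<open>\<beta>' p > 0\<close>, conjugating by \<open>exp (- \<Theta> / \<epsilon>)\<close> reverses the drift and subtracts \<open>\<beta>' p\<close> from the
  potential, which reduces to the case of nonpositive \<open>\<beta>' p\<close>.\<close>

lemma principal_lower:
  assumes \<gamma>: "continuous_on UNIV \<gamma>" "periodic \<gamma>" and p: "\<beta> p = 0" and \<delta>: "\<delta> > 0"
  obtains e where "e > 0" "\<And>\<epsilon> l u v. 0 < \<epsilon> \<Longrightarrow> \<epsilon> < e \<Longrightarrow>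
    periodic_elliptic.solves (\<lambda>t. \<epsilon> * \<alpha> t) \<beta> \<gamma> l u v \<Longrightarrow> (\<And>t. u t > 0) \<Longrightarrow>
    \<gamma> p - max 0 (\<beta>' p) - \<delta> < l"
proof -
  obtain m where m: "m > 0" "\<And>t. m \<le> \<alpha> t" using \<alpha>_lower by metis
  obtain N where N: "\<And>t. \<bar>\<alpha> t\<bar> \<le> N" using periodic_bounded[OF per\<alpha> c\<alpha>] by metis
  \<comment> \<open>Conjugation by the exponential produces a zeroth-order term \<open>(\<theta>^2 -
    \<theta>) * \<beta>^2 / (\<epsilon> * \<alpha>)\<close>. It vanishes because
    \<open>\<theta>\<close> is 0 or 1, and the identity \<open>\<theta>2\<close> lets both cases
    share one computation.\<close>
  define \<theta> :: real where "\<theta> = (if \<beta>' p > 0 then 1 else 0)"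
  have \<theta>2: "\<theta> * \<theta> = \<theta>" by (simp add: \<theta>_def)
  have \<theta>p: "\<theta> * \<beta>' p = max 0 (\<beta>' p)" by (simp add: \<theta>_def max_def)
  define D where "D t = (1 - 2 * \<theta>) * \<beta> t" for t
  have dD: "(D has_real_derivative (1 - 2 * \<theta>) * \<beta>' p) (at p)"
    using DERIV_cmult[OF d\<beta>] by (simp add: D_def[abs_def])
  have Dp: "D p = 0" using p by (simp add: D_def)
  have D1: "(1 - 2 * \<theta>) * \<beta>' p \<le> 0" by (simp add: \<theta>_def)
  have N': "\<alpha> t \<le> N" for t using N[of t] by simp
  have \<delta>2: "\<delta> / 2 > 0" using \<delta> by simp
  have "\<exists>P e. P > 0 \<and> e > 0 \<and> (\<forall>\<epsilon> t s. 0 < \<epsilon> \<longrightarrow> \<epsilon> < e \<longrightarrow> (t - p)\<^sup>2 < P * \<epsilon> \<longrightarrow>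
      s = 1 - (t - p)\<^sup>2 / (P * \<epsilon>) \<longrightarrow>
      - (\<delta> / 2) * s\<^sup>2 < \<epsilon> * \<alpha> t * ((8 - 12 * s) / (P * \<epsilon>)) + D t * (- 4 * (t - p) * s / (P * \<epsilon>)))"
    by (rule quartic_subsolution[OF m(1) _ _ Dp dD D1 \<delta>2]) (rule m(2) N')+
  then obtain P e where P: "P > 0" "e > 0" and all: "\<forall>\<epsilon> t s. 0 < \<epsilon> \<longrightarrow> \<epsilon> < e \<longrightarrow> (t - p)\<^sup>2 < P * \<epsilon> \<longrightarrow>
      s = 1 - (t - p)\<^sup>2 / (P * \<epsilon>) \<longrightarrow>
      - (\<delta> / 2) * s\<^sup>2 < \<epsilon> * \<alpha> t * ((8 - 12 * s) / (P * \<epsilon>)) + D t * (- 4 * (t - p) * s / (P * \<epsilon>))"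
    by (elim exE conjE) (rule that)
  note quartic = all[rule_format]
  define g where "g t = \<beta> t / \<alpha> t" for t
  define g' where "g' t = \<beta>' t / \<alpha> t - \<beta> t * \<alpha>' t / (\<alpha> t)\<^sup>2" for t
  have dg: "(g has_real_derivative g' t) (at t)" for t
    using drift_ratio_has_derivative[of "\<lambda>_. 1" 0 t] by (simp add: g_def[abs_def] g'_def)
  have cg: "continuous_on UNIV g" using dg by (meson DERIV_isCont continuous_at_imp_continuous_on)
  obtain \<Theta> where d\<Theta>: "\<And>t. (\<Theta> has_real_derivative g t) (at t)"
    using antiderivative_exists[OF cg] by (auto simp: has_real_derivative_iff_has_vector_derivative)
  define \<Gamma> where "\<Gamma> t = \<gamma> t - \<theta> * (\<alpha> t * g' t)" for t
  have \<Gamma>p: "\<Gamma> p = \<gamma> p - max 0 (\<beta>' p)"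
    using nz\<alpha>[of p] p by (simp add: \<Gamma>_def g'_def flip: \<theta>p)
  have "continuous_on UNIV \<Gamma>"
    unfolding \<Gamma>_def g'_def by (intro continuous_intros \<gamma> c\<alpha> c\<beta> c\<alpha>' c\<beta>') (auto simp: nz\<alpha>)
  then have "isCont \<Gamma> p" by (simp add: continuous_on_eq_continuous_at)
  from this[unfolded continuous_at_eps_delta, rule_format, OF \<delta>2]
  obtain r where r: "r > 0" "\<And>t. \<bar>t - p\<bar> < r \<Longrightarrow> \<bar>\<Gamma> t - \<Gamma> p\<bar> < \<delta> / 2"
    by (auto simp: dist_real_def)
  \<comment> \<open>The second bound puts the interval of radius
    \<open>sqrt (P * \<epsilon>)\<close> inside the region where \<open>\<Gamma>\<close> varies by
    less than \<open>\<delta> / 2\<close>; the other half of \<open>\<delta>\<close> pays for the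
    Dirichlet cost.\<close>
  define e' where "e' = min e (r\<^sup>2 / P)"
  have "\<gamma> p - max 0 (\<beta>' p) - \<delta> < l" if \<epsilon>: "0 < \<epsilon>" "\<epsilon> < e'"
    and sol: "periodic_elliptic.solves (\<lambda>t. \<epsilon> * \<alpha> t) \<beta> \<gamma> l u v" and u: "\<And>t. u t > 0" for \<epsilon> l u v
  proof -
    interpret E: periodic_elliptic "\<lambda>t. \<epsilon> * \<alpha> t" \<beta> \<gamma> by (rule elliptic[OF \<gamma> \<epsilon>(1)])
    have \<epsilon>': "\<epsilon> < e" "P * \<epsilon> < r\<^sup>2" using \<epsilon> P by (auto simp: e'_def field_simps)
    define W where "W = P * \<epsilon>"
    have W: "W > 0" using P \<epsilon> by (simp add: W_def)
    define \<rho> where "\<rho> = sqrt W"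
    have \<rho>: "\<rho> > 0" "\<rho>\<^sup>2 = W" using W by (simp_all add: \<rho>_def)
    define s where "s t = 1 - (t - p)\<^sup>2 / W" for t
    let ?c = "\<lambda>t. (s t)\<^sup>2" and ?c1 = "\<lambda>t. - 4 * (t - p) * s t / W" and ?c2 = "\<lambda>t. (8 - 12 * s t) / W"
    have ds: "(s has_real_derivative - 2 * (t - p) / W) (at t)" for t
      unfolding s_def using W by (auto intro!: derivative_eq_intros simp: field_simps)
    have dc: "(?c has_real_derivative ?c1 t) (at t)" for t
      by (rule DERIV_cong[OF DERIV_power[OF ds, where n = 2]]) (use W in \<open>simp add: field_simps\<close>)
    have dc1: "(?c1 has_real_derivative ?c2 t) (at t)" for t
    proof -
      have "((\<lambda>t. - 4 * (t - p) * s t / W) has_real_derivative (- 4 * 1 * s t + - 2 * (t - p) / W * (- 4 * (t - p))) / W) (at t)"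
        by (intro DERIV_cdivide DERIV_mult ds) (auto intro!: derivative_eq_intros)
      moreover have "- 4 * 1 * s t + - 2 * (t - p) / W * (- 4 * (t - p)) = 8 - 12 * s t"
        using W by (simp add: s_def field_simps power2_eq_square)
      ultimately show ?thesis by (simp only:)
    qed
    let ?E = "\<lambda>t. exp (- (\<theta> * (\<Theta> t / \<epsilon>)))"
    have dE: "(?E has_real_derivative - (\<theta> * (g t / \<epsilon>)) * ?E t) (at t)" for t
      using DERIV_fun_exp[OF DERIV_minus[OF DERIV_cmult[OF DERIV_cdivide[OF d\<Theta>, of \<epsilon>], of \<theta>]], of t]
      by (simp only: mult.commute)
    let ?w = "\<lambda>t. ?E t * ?c t"
    let ?w1 = "\<lambda>t. ?E t * (?c1 t - \<theta> * (g t / \<epsilon>) * ?c t)"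
    let ?w2 = "\<lambda>t. ?E t * (?c2 t - 2 * \<theta> * (g t / \<epsilon>) * ?c1 t + \<theta> * ((g t / \<epsilon>)\<^sup>2 - g' t / \<epsilon>) * ?c t)"
    have dw: "(?w has_real_derivative ?w1 t) (at t)" for t
      by (rule DERIV_cong[OF DERIV_mult[OF dE dc]]) (simp add: algebra_simps)
    have dw1: "(?w1 has_real_derivative ?w2 t) (at t)" for t
    proof -
      let ?k = "g t / \<epsilon>" and ?k' = "g' t / \<epsilon>"
      have "(?w1 has_real_derivative - (\<theta> * ?k) * ?E t * (?c1 t - \<theta> * ?k * ?c t)
          + (?c2 t - ((\<theta> * ?k') * ?c t + ?c1 t * (\<theta> * ?k))) * ?E t) (at t)"
        by (intro DERIV_mult DERIV_diff dE dc dc1 DERIV_cmult DERIV_cdivide dg)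
      moreover have "- (\<theta> * k) * x * (c1 - \<theta> * k * c) + (c2 - ((\<theta> * k') * c + c1 * (\<theta> * k))) * x
          = x * (c2 - 2 * \<theta> * k * c1 + \<theta> * (k\<^sup>2 - k') * c)" for k k' x c c1 c2 :: real
      proof -
        have "- (\<theta> * k) * x * (c1 - \<theta> * k * c) + (c2 - ((\<theta> * k') * c + c1 * (\<theta> * k))) * x
          = x * (c2 - 2 * \<theta> * k * c1 + ((\<theta> * \<theta>) * k\<^sup>2 - \<theta> * k') * c)"
          by (simp add: algebra_simps power2_eq_square)
        then show ?thesis unfolding \<theta>2 by (simp only: right_diff_distrib)
      qed
      ultimately show ?thesis by (rule DERIV_cong)
    qed
    have inside: "(t - p)\<^sup>2 < W" if "p - \<rho> < t" "t < p + \<rho>" for t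
    proof -
      have "\<bar>t - p\<bar> < \<rho>" using that \<rho>(1) by linarith
      from power_strict_mono[OF this abs_ge_zero, of 2] show ?thesis using \<rho>(2) by simp
    qed
    have sp: "s t > 0" if "p - \<rho> < t" "t < p + \<rho>" for t
      using inside[OF that] W by (simp add: s_def)
    have "\<Gamma> p - \<delta> < l"
    proof (rule E.subsolution_less[OF sol, of "p - \<rho>" "p + \<rho>" ?w ?w1 ?w2])
      show "continuous_on {p - \<rho>..p + \<rho>} ?w"
        using dw by (meson DERIV_isCont continuous_at_imp_continuous_on)
      show "?w (p - \<rho>) = 0" "?w (p + \<rho>) = 0" using \<rho>(2) W by (simp_all add: s_def)
      show "p - \<rho> < p + \<rho>" using \<rho>(1) by simp
      show "u t > 0" for t by (rule u)
      fix t assume t: "p - \<rho> < t" "t < p + \<rho>"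
      show "(?w has_real_derivative ?w1 t) (at t)" "(?w1 has_real_derivative ?w2 t) (at t)" by (rule dw dw1)+
      show "?w t > 0" using sp[OF t] by simp
      show "(\<Gamma> p - \<delta>) * ?w t < \<epsilon> * \<alpha> t * ?w2 t + \<beta> t * ?w1 t + \<gamma> t * ?w t"
      proof -
        have "\<bar>t - p\<bar>\<^sup>2 < r\<^sup>2" using inside[OF t] \<epsilon>'(2) by (simp add: W_def)
        then have "\<bar>t - p\<bar> < r" using r(1) by (meson less_imp_le power2_less_imp_less)
        then have "\<Gamma> t > \<Gamma> p - \<delta> / 2" using r(2)[of t] by linarith
        then have "(\<Gamma> p - \<delta> / 2) * ?c t < \<Gamma> t * ?c t" using sp[OF t] by simp
        moreover have "- (\<delta> / 2) * ?c t < \<epsilon> * \<alpha> t * ?c2 t + D t * ?c1 t"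
          using quartic[OF \<epsilon>(1) \<epsilon>'(1), of t "s t"] inside[OF t] by (simp add: W_def s_def)
        ultimately have "(\<Gamma> p - \<delta>) * ?c t < \<epsilon> * \<alpha> t * ?c2 t + D t * ?c1 t + \<Gamma> t * ?c t"
          by (simp add: algebra_simps)
        then have "?E t * ((\<Gamma> p - \<delta>) * ?c t) < ?E t * (\<epsilon> * \<alpha> t * ?c2 t + D t * ?c1 t + \<Gamma> t * ?c t)"
          by (intro mult_strict_left_mono) auto
        also have "\<dots> = \<epsilon> * \<alpha> t * ?w2 t + \<beta> t * ?w1 t + \<gamma> t * ?w t"
        proof -
          have "x * (\<epsilon> * al * c2 + ((1 - 2 * \<theta>) * be) * c1 + (ga - \<theta> * (al * k')) * c)
            = \<epsilon> * al * (x * (c2 - 2 * \<theta> * (be / al / \<epsilon>) * c1 + \<theta> * ((be / al / \<epsilon>)\<^sup>2 - k' / \<epsilon>) * c))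
              + be * (x * (c1 - \<theta> * (be / al / \<epsilon>) * c)) + ga * (x * c)"
            if "al > 0" for x al be ga c c1 c2 k' :: real
            using that \<epsilon>(1) by (simp add: field_simps power2_eq_square)
          from this[OF \<alpha>_pos] show ?thesis unfolding \<Gamma>_def g_def D_def by blast
        qed
        finally show ?thesis by (simp add: mult_ac)
      qed
    qed
    then show ?thesis by (simp add: \<Gamma>p)
  qed
  moreover have "e' > 0" using P r(1) by (simp add: e'_def)
  ultimately show ?thesis using that by blast
qed

end

section \<open>The limit functional\<close>

text \<open>The two claims together say that the limit is the least upper bound of the values on the
  zero set. They follow by squeezing the principal eigenvalue between \<open>principal_lower\<close>
  and \<open>principal_upper\<close>.\<close>

lemma Lambda_limit_bounds:
  fixes a b c :: "circle \<Rightarrow> real"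
  assumes a: "C_k_circle 2 a" "\<And>p. a p > 0" and b: "C_k_circle 1 b"
    and sgn: "\<exists>p. b p > 0" "\<exists>p. b p < 0" and c: "continuous_on UNIV c"
  shows "p \<in> zero_set b \<Longrightarrow> c p - max 0 (circle_deriv b p) \<le> Lambda_limit a b c"
    and "(\<And>p. p \<in> zero_set b \<Longrightarrow> c p - max 0 (circle_deriv b p) \<le> M) \<Longrightarrow> Lambda_limit a b c \<le> M"
proof -
  let ?\<alpha> = "\<lambda>t. a (abs_circle t)" and ?\<alpha>' = "\<lambda>t. circle_deriv a (abs_circle t)"
  let ?\<beta> = "\<lambda>t. b (abs_circle t)" and ?\<beta>' = "\<lambda>t. circle_deriv b (abs_circle t)"
  let ?\<gamma> = "\<lambda>t. c (abs_circle t)"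
  have \<gamma>: "continuous_on UNIV ?\<gamma>" "periodic ?\<gamma>"
    using c periodic_circle by (auto simp: continuous_on_circle_iff)
  interpret small_diffusion ?\<alpha> ?\<alpha>' ?\<beta> ?\<beta>'
  proof
    show "(?\<alpha> has_real_derivative ?\<alpha>' t) (at t)" "(?\<beta> has_real_derivative ?\<beta>' t) (at t)" for t
      using C_2_circleD(1)[OF a(1)] C_1_circleD(1)[OF b]
      by (simp_all add: has_real_derivative_iff_has_vector_derivative)
    show "continuous_on UNIV ?\<alpha>'"
      using C_2_circleD(2)[OF a(1)]
      by (intro continuous_at_imp_continuous_on ballI has_vector_derivative_continuous)
    show "continuous_on UNIV ?\<beta>'"
      using C_1_circleD(2)[OF b] by (simp add: continuous_on_circle_iff)
  qed (use a(2) in \<open>auto intro: periodic_circle\<close>)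
  obtain t0 t1 where t0: "?\<beta> t0 > 0" and t1: "?\<beta> t1 < 0"
    using sgn by (metis abs_rep_circle)
  obtain s where s: "?\<beta> s = 0"
  proof (cases "t1 \<le> t0")
    case True
    then show ?thesis
      using IVT'[of ?\<beta> t1 0 t0] t0 t1 continuous_on_subset[OF c\<beta>] that by fastforce
  next
    case False
    then show ?thesis
      using IVT2'[of ?\<beta> t1 0 t0] t0 t1 continuous_on_subset[OF c\<beta>] that by fastforce
  qed
  define V where "V = (\<lambda>p. c p - max 0 (circle_deriv b p)) ` zero_set b"
  have ne: "V \<noteq> {}" using s by (auto simp: V_def zero_set_def)
  obtain B where B: "\<And>t. \<bar>?\<gamma> t\<bar> \<le> B" using periodic_bounded[OF \<gamma>(2,1)] by blast
  have cB: "c p \<le> B" for p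
    using B[of "rep_circle p"] by simp
  have bdd: "bdd_above V"
  proof (rule bdd_aboveI)
    fix y assume "y \<in> V"
    then obtain p where "y = c p - max 0 (circle_deriv b p)" by (auto simp: V_def)
    then show "y \<le> B" using cB[of p] by linarith
  qed
  let ?L = "Sup V"
  have "((\<lambda>\<epsilon>. Re (principal_eigenvalue a b c \<epsilon>)) \<longlongrightarrow> ?L) (at_right 0)"
  proof (rule tendstoI)
    fix \<delta> :: real assume "\<delta> > 0"
    then have \<delta>2: "\<delta> / 2 > 0" by simp
    have "?\<gamma> t - max 0 (?\<beta>' t) \<le> ?L" if "?\<beta> t = 0" for t
      by (rule cSup_upper[OF _ bdd]) (use that in \<open>auto simp: V_def zero_set_def\<close>)
    from principal_upper[OF \<gamma> t0 t1 this \<delta>2]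
    obtain e1 where e1: "e1 > 0" "\<And>\<epsilon> l u v. 0 < \<epsilon> \<Longrightarrow> \<epsilon> < e1 \<Longrightarrow>
      periodic_elliptic.solves (\<lambda>t. \<epsilon> * ?\<alpha> t) ?\<beta> ?\<gamma> l u v \<Longrightarrow> periodic u \<Longrightarrow> (\<And>t. u t > 0) \<Longrightarrow> l \<le> ?L + \<delta> / 2"
      by metis
    \<comment> \<open>The threshold of \<open>principal_lower\<close> depends on the chosen zero, so
      one zero whose value is within \<open>\<delta> / 2\<close> of the supremum is fixed before
      \<open>\<epsilon>\<close>.\<close>
    obtain y where y: "y \<in> V" "?L - \<delta> / 2 < y"
      using less_cSup_iff[OF ne bdd, of "?L - \<delta> / 2"] \<delta>2 by auto
    then obtain p where p: "b p = 0" "y = c p - max 0 (circle_deriv b p)"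
      by (auto simp: V_def zero_set_def)
    have p': "?\<beta> (rep_circle p) = 0" "y = ?\<gamma> (rep_circle p) - max 0 (?\<beta>' (rep_circle p))"
      using p by simp_all
    from principal_lower[OF \<gamma> p'(1) \<delta>2]
    obtain e2 where e2: "e2 > 0" "\<And>\<epsilon> l u v. 0 < \<epsilon> \<Longrightarrow> \<epsilon> < e2 \<Longrightarrow>
      periodic_elliptic.solves (\<lambda>t. \<epsilon> * ?\<alpha> t) ?\<beta> ?\<gamma> l u v \<Longrightarrow> (\<And>t. u t > 0) \<Longrightarrow> y - \<delta> / 2 < l"
      unfolding p'(2)[symmetric] by metis
    have "dist (Re (principal_eigenvalue a b c \<epsilon>)) ?L < \<delta>" if \<epsilon>: "0 < \<epsilon>" "\<epsilon> < min e1 e2" for \<epsilon>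
    proof -
      note ell = elliptic[OF \<gamma> \<epsilon>(1)]
      obtain l u v where l: "periodic_elliptic.solves (\<lambda>t. \<epsilon> * ?\<alpha> t) ?\<beta> ?\<gamma> l u v" "periodic u" "\<And>t. u t > 0"
        using periodic_elliptic.positive_periodic_solution[OF ell] by (elim exE conjE) (rule that, auto)
      have "principal_eigenvalue a b c \<epsilon> = of_real l"
        by (rule principal_eigenvalue_eq[OF ell l])
      moreover have "l \<le> ?L + \<delta> / 2" using e1(2)[OF \<epsilon>(1) _ l] \<epsilon>(2) by simp
      moreover have "y - \<delta> / 2 < l" using e2(2)[OF \<epsilon>(1) _ l(1,3)] \<epsilon>(2) by simp
      ultimately show ?thesis using y(2) \<open>\<delta> > 0\<close> by (simp add: dist_real_def abs_if)
    qed
    then show "\<forall>\<^sub>F \<epsilon> in at_right 0. dist (Re (principal_eigenvalue a b c \<epsilon>)) ?L < \<delta>"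
      using e1(1) e2(1) by (intro eventually_at_rightI[of 0 "min e1 e2"]) auto
  qed
  then have L: "Lambda_limit a b c = ?L"
    unfolding Lambda_limit_def by (intro tendsto_Lim) simp_all
  show "c p - max 0 (circle_deriv b p) \<le> Lambda_limit a b c" if "p \<in> zero_set b"
    unfolding L by (rule cSup_upper[OF _ bdd]) (use that in \<open>auto simp: V_def\<close>)
  show "Lambda_limit a b c \<le> M" if "\<And>p. p \<in> zero_set b \<Longrightarrow> c p - max 0 (circle_deriv b p) \<le> M"
    unfolding L by (rule cSup_least[OF ne]) (use that in \<open>auto simp: V_def\<close>)
qed

section \<open>Supports, integrals and closed sets on the circle\<close>

lemma open_circle_vimage: "open U \<Longrightarrow> open (abs_circle -` U)"
  by (simp add: open_circle_def)

text \<open>The circle has no second-countability instance, so the Lindelof property is pulled back from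
  the real line.\<close>

lemma complement_support_null:
  fixes \<mu> :: "circle measure"
  assumes "sets \<mu> = sets borel"
  shows "- measure_support \<mu> \<in> null_sets \<mu>"
proof -
  define F where "F = {U. open U \<and> emeasure \<mu> U = 0}"
  have "\<And>S. S \<in> (-`) abs_circle ` F \<Longrightarrow> open S"
    by (auto simp: F_def open_circle_vimage)
  then obtain G where G: "G \<subseteq> (-`) abs_circle ` F" "countable G" "\<Union>G = \<Union>((-`) abs_circle ` F)"
    using Lindelof by blast
  obtain F' where F': "F' \<subseteq> F" "countable F'" "G = (-`) abs_circle ` F'"
    using G(1,2) countable_subset_image by metis
  have "\<Union>F' = \<Union>F"
  proof (rule set_eqI)
    fix p :: circle
    obtain t where t: "p = abs_circle t" by (metis abs_rep_circle)
    have "p \<in> \<Union>F' \<longleftrightarrow> t \<in> \<Union>G" by (auto simp: t F'(3))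
    also have "\<dots> \<longleftrightarrow> p \<in> \<Union>F" by (auto simp: t G(3))
    finally show "p \<in> \<Union>F' \<longleftrightarrow> p \<in> \<Union>F" .
  qed
  moreover have "- measure_support \<mu> = \<Union>F"
    by (auto simp: measure_support_def F_def)
  moreover have "(\<Union>U\<in>F'. U) \<in> null_sets \<mu>"
    by (rule null_sets_UN'[OF F'(2)]) (use F'(1) assms in \<open>auto simp: F_def null_sets_def\<close>)
  ultimately show ?thesis by simp
qed

lemma circle_prob_integrable:
  fixes f :: "circle \<Rightarrow> real"
  assumes \<mu>: "circle_prob \<mu>" and f: "continuous_on UNIV f"
  shows "integrable \<mu> f"
proof -
  interpret prob_space \<mu> using \<mu> by (simp add: circle_prob_def)
  have "f \<in> borel_measurable \<mu>"
    using borel_measurable_continuous_onI[OF f] \<mu> measurable_cong_sets[of \<mu> borel borel borel]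
    by (auto simp: circle_prob_def)
  moreover obtain B where B: "\<And>t. \<bar>f (abs_circle t)\<bar> \<le> B"
    using periodic_bounded[OF periodic_circle] f by (metis continuous_on_circle_iff)
  then have "norm (f p) \<le> B" for p
    using B[of "rep_circle p"] by simp
  ultimately show ?thesis
    by (intro integrable_const_bound[of _ B]) auto
qed

text \<open>The preimage on the line is a translate of the integers. Closedness makes single points
  measurable, so that their masses can be computed.\<close>

lemma closed_circle_singleton: "closed {p :: circle}"
proof -
  obtain t where t: "p = abs_circle t" by (metis abs_rep_circle)
  have "closed ((\<lambda>s. s - t) -` \<int>)"
    by (intro closed_vimage closed_Ints continuous_intros)
  then have "open (- ((\<lambda>s. s - t) -` \<int>))" by (rule open_Compl)
  also have "- ((\<lambda>s. s - t) -` \<int>) = abs_circle -` (- {p})"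
    by (auto simp: t abs_circle_eq_iff)
  finally show ?thesis by (simp add: closed_def open_circle_def)
qed

text \<open>Every point of a nondegenerate interval, end points included, is a limit point of it, so
  the derivative is determined by the values within the interval, where \<open>b\<close>
  vanishes.\<close>

lemma circle_deriv_zero_on_interval:
  assumes b: "C_k_circle 1 b" and I: "nondegenerate_interval I" "I \<subseteq> zero_set b" and p: "p \<in> I"
  shows "circle_deriv b p = 0"
proof -
  obtain S s0 t0 where S: "is_interval S" "s0 \<in> S" "t0 \<in> S" "s0 < t0" "I = abs_circle ` S"
    using I(1) by (auto simp: nondegenerate_interval_def)
  obtain s where s: "s \<in> S" "p = abs_circle s" using p S(5) by auto
  have "\<And>x. S \<noteq> {x}" using S(2-4) by auto
  then have "s islimpt S"
    using connected_imp_perfect[of S s] S(1) s(1) by (simp add: is_interval_connected)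
  then have nb: "at s within S \<noteq> bot" by (simp add: trivial_limit_within)
  have zero: "b (abs_circle t) = 0" if "t \<in> S" for t
    using I(2) S(5) that by (auto simp: zero_set_def)
  have "((\<lambda>t. b (abs_circle t)) has_vector_derivative circle_deriv b p) (at s within S)"
    using C_1_circleD(1)[OF b, of s] s(2) by (simp add: has_vector_derivative_at_within)
  moreover have "((\<lambda>t. b (abs_circle t)) has_vector_derivative 0) (at s within S)"
    by (rule has_vector_derivative_transform[OF s(1) _ has_vector_derivative_const[of 0]]) (simp add: zero)
  ultimately show ?thesis
    by (rule vector_derivative_unique_within[OF nb])
qed

lemma C_1_circle_continuous: "C_k_circle 1 f \<Longrightarrow> continuous_on UNIV f"
  unfolding continuous_on_circle_iff
  by (intro continuous_at_imp_continuous_on ballI, rule has_vector_derivative_continuous,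
      rule C_1_circleD(1))

lemma closed_zero_set:
  assumes "continuous_on UNIV b"
  shows "closed (zero_set b)"
proof -
  have "closed (b -` {0})" by (rule closed_vimage[OF _ assms]) simp
  then show ?thesis by (simp add: zero_set_def vimage_def)
qed

section \<open>Evaluation of the functional\<close>

context
  fixes a b :: "circle \<Rightarrow> real"
  assumes a: "C_k_circle 2 a" "\<And>p. a p > 0" and b: "C_k_circle 1 b"
    and sgn: "\<exists>p. b p > 0" "\<exists>p. b p < 0"
begin

text \<open>The inequality \<open>c - ?g <= Lambda_limit a b c\<close> holds at every zero;
  integrating it against a measure carried by the zeros bounds all competitors at once. For
  \<open>c = ?g\<close> the limit is at most 0, so the bound is reached.\<close>

lemma J_functional_zero_set:
  assumes \<mu>: "circle_prob \<mu>" and Z: "AE p in \<mu>. p \<in> zero_set b"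
  shows "J_functional a b \<mu> = ereal (\<integral>p. max 0 (circle_deriv b p) \<partial>\<mu>)"
proof -
  interpret prob_space \<mu> using \<mu> by (simp add: circle_prob_def)
  let ?g = "\<lambda>p. max 0 (circle_deriv b p)"
  have cg: "continuous_on UNIV ?g"
    by (intro continuous_intros C_1_circleD(2)[OF b])
  show ?thesis
    unfolding J_functional_def
  proof (rule antisym)
    show "(SUP c\<in>{c. continuous_on UNIV c}. ereal ((\<integral>p. c p \<partial>\<mu>) - Lambda_limit a b c)) \<le> ereal (\<integral>p. ?g p \<partial>\<mu>)"
    proof (rule SUP_least)
      fix c :: "circle \<Rightarrow> real" assume "c \<in> {c. continuous_on UNIV c}"
      then have c: "continuous_on UNIV c" by simp
      have "(\<integral>p. c p \<partial>\<mu>) \<le> (\<integral>p. ?g p + Lambda_limit a b c \<partial>\<mu>)"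
      proof (rule integral_mono_AE)
        show "AE p in \<mu>. c p \<le> ?g p + Lambda_limit a b c"
          using Z
        proof eventually_elim
          case (elim p)
          show ?case using Lambda_limit_bounds(1)[OF a b sgn c elim] by linarith
        qed
        show "integrable \<mu> c" by (rule circle_prob_integrable[OF \<mu> c])
        show "integrable \<mu> (\<lambda>p. ?g p + Lambda_limit a b c)"
          by (rule circle_prob_integrable[OF \<mu>]) (intro continuous_intros cg)
      qed
      also have "\<dots> = (\<integral>p. ?g p \<partial>\<mu>) + Lambda_limit a b c"
        using circle_prob_integrable[OF \<mu> cg] by (simp add: prob_space)
      finally show "ereal ((\<integral>p. c p \<partial>\<mu>) - Lambda_limit a b c) \<le> ereal (\<integral>p. ?g p \<partial>\<mu>)" by simp
    qed
    have "Lambda_limit a b ?g \<le> 0"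
      by (rule Lambda_limit_bounds(2)[OF a b sgn cg]) simp
    then have "ereal (\<integral>p. ?g p \<partial>\<mu>) \<le> ereal ((\<integral>p. ?g p \<partial>\<mu>) - Lambda_limit a b ?g)" by simp
    also have "\<dots> \<le> (SUP c\<in>{c. continuous_on UNIV c}. ereal ((\<integral>p. c p \<partial>\<mu>) - Lambda_limit a b c))"
      by (rule SUP_upper) (rule CollectI, rule cg)
    finally show "ereal (\<integral>p. ?g p \<partial>\<mu>) \<le> (SUP c\<in>{c. continuous_on UNIV c}. ereal ((\<integral>p. c p \<partial>\<mu>) - Lambda_limit a b c))" .
  qed
qed

lemma J_functional_infinite:
  assumes \<mu>: "circle_prob \<mu>" and supp: "\<not> measure_support \<mu> \<subseteq> zero_set b"
  shows "J_functional a b \<mu> = \<infinity>"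
proof -
  interpret prob_space \<mu> using \<mu> by (simp add: circle_prob_def)
  have cb: "continuous_on UNIV (\<lambda>p. K * (b p)\<^sup>2)" for K
    by (intro continuous_intros C_1_circle_continuous b)
  have int: "integrable \<mu> (\<lambda>p. (b p)\<^sup>2)" using circle_prob_integrable[OF \<mu> cb[of 1]] by simp
  obtain p where p: "p \<in> measure_support \<mu>" "b p \<noteq> 0" using supp by (auto simp: zero_set_def)
  have op: "open (- zero_set b)"
    by (intro open_Compl closed_zero_set C_1_circle_continuous b)
  define I where "I = (\<integral>p. (b p)\<^sup>2 \<partial>\<mu>)"
  have "I \<noteq> 0"
  proof
    assume "I = 0"
    then have "AE p in \<mu>. (b p)\<^sup>2 = 0"
      using integral_nonneg_eq_0_iff_AE[OF int] by (simp add: I_def)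
    then have "AE p in \<mu>. p \<notin> - zero_set b" by (simp add: zero_set_def)
    moreover have "- zero_set b \<in> sets \<mu>" using op \<mu> by (simp add: circle_prob_def)
    ultimately have "emeasure \<mu> (- zero_set b) = 0"
      by (simp add: AE_iff_null_sets null_setsD1 del: Compl_iff)
    then show False using p op by (force simp: measure_support_def zero_set_def)
  qed
  moreover have "I \<ge> 0" unfolding I_def by (rule integral_nonneg_AE) simp
  ultimately have I: "I > 0" by simp
  show ?thesis
  proof (rule ereal_top)
    fix B
    \<comment> \<open>Normalised to have integral exactly \<open>B\<close>. The sign of
      \<open>B\<close> does not matter for the limit, because \<open>b^2\<close> vanishes on the
      zero set.\<close>
    let ?c = "\<lambda>p. (B / I) * (b p)\<^sup>2"
    have "Lambda_limit a b ?c \<le> 0"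
      by (rule Lambda_limit_bounds(2)[OF a b sgn cb]) (simp add: zero_set_def)
    moreover have "(\<integral>p. ?c p \<partial>\<mu>) = B" using I int by (simp add: I_def)
    ultimately have "ereal B \<le> ereal ((\<integral>p. ?c p \<partial>\<mu>) - Lambda_limit a b ?c)" by simp
    also have "\<dots> \<le> J_functional a b \<mu>"
      unfolding J_functional_def by (rule SUP_upper) (rule CollectI, rule cb)
    finally show "ereal B \<le> J_functional a b \<mu>" .
  qed
qed

end

text \<open>Since \<open>g\<close> vanishes on every \<open>I j\<close>, it agrees almost everywhere
  with a finite combination of indicators of the points \<open>x i\<close>. Only the masses of these
  points enter, and they can be read off from the identity \<open>mix\<close> for sets.\<close>

lemma integral_mixture:
  fixes g :: "circle \<Rightarrow> real" and x :: "nat \<Rightarrow> circle" and I :: "nat \<Rightarrow> circle set"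
  assumes \<mu>: "circle_prob \<mu>" and g: "continuous_on UNIV g"
    and inj: "inj_on x {1..n}" and Z: "Z = x ` {1..n} \<union> (\<Union>j\<in>{1..m}. I j)" "closed Z"
    and gI: "\<And>j p. j \<in> {1..m} \<Longrightarrow> p \<in> I j \<Longrightarrow> g p = 0"
    and \<nu>: "\<And>j. j \<in> {1..m} \<Longrightarrow> circle_prob (\<nu> j) \<and> measure_support (\<nu> j) \<subseteq> I j"
    and mix: "\<And>A. A \<in> sets borel \<Longrightarrow> measure \<mu> A =
      (\<Sum>i=1..n. \<alpha> i * measure (return borel (x i)) A) + (\<Sum>j=1..m. \<beta> j * measure (\<nu> j) A)"
  shows "AE p in \<mu>. p \<in> Z" and "(\<integral>p. g p \<partial>\<mu>) = (\<Sum>i=1..n. \<alpha> i * g (x i))"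
proof -
  interpret prob_space \<mu> using \<mu> by (simp add: circle_prob_def)
  have sets: "sets \<mu> = sets borel" using \<mu> by (simp add: circle_prob_def)
  have \<nu>0: "measure (\<nu> j) A = 0" if "j \<in> {1..m}" "A \<inter> I j = {}" for j A
  proof -
    have "- measure_support (\<nu> j) \<in> null_sets (\<nu> j)"
      using \<nu>[OF that(1)] by (intro complement_support_null) (simp add: circle_prob_def)
    moreover have "A \<subseteq> - measure_support (\<nu> j)" using \<nu>[OF that(1)] that(2) by auto
    ultimately have "emeasure (\<nu> j) A = 0"
      using emeasure_mono[of A "- measure_support (\<nu> j)" "\<nu> j"] by (auto simp: null_sets_def)
    then show ?thesis by (simp add: measure_def)
  qed
  have ret: "measure (return borel q) A = indicator A q" if "A \<in> sets borel" for q :: circle and A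
    using that by (simp add: measure_return)
  have Zm: "- Z \<in> sets borel" using Z(2) by (simp add: open_Compl)
  have "measure (return borel (x i)) (- Z) = 0" if "i \<in> {1..n}" for i
  proof -
    have "x i \<in> Z" using that by (auto simp: Z(1))
    then show ?thesis by (simp add: ret[OF Zm])
  qed
  then have 1: "(\<Sum>i=1..n. \<alpha> i * measure (return borel (x i)) (- Z)) = 0"
    by (intro sum.neutral) simp
  have "measure (\<nu> j) (- Z) = 0" if "j \<in> {1..m}" for j
    using that by (intro \<nu>0) (auto simp: Z(1))
  then have 2: "(\<Sum>j=1..m. \<beta> j * measure (\<nu> j) (- Z)) = 0"
    by (intro sum.neutral) simp
  have "measure \<mu> (- Z) = 0"
    unfolding mix[OF Zm] 1 2 by simp
  then have "- Z \<in> null_sets \<mu>"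
    using Zm by (simp add: null_sets_def sets emeasure_eq_measure)
  from AE_not_in[OF this] show AE: "AE p in \<mu>. p \<in> Z" by simp
  have single: "{q} \<in> sets borel" for q :: circle
    by (simp add: borel_closed closed_circle_singleton)
  have "(\<integral>p. g p \<partial>\<mu>) = (\<integral>p. (\<Sum>i=1..n. g (x i) * indicator {x i} p) \<partial>\<mu>)"
  proof (rule integral_cong_AE)
    show "g \<in> borel_measurable \<mu>" by (rule borel_measurable_integrable[OF circle_prob_integrable[OF \<mu> g]])
    show "(\<lambda>p. \<Sum>i=1..n. g (x i) * indicator {x i} p) \<in> borel_measurable \<mu>"
      by (intro borel_measurable_sum borel_measurable_times borel_measurable_const borel_measurable_indicator)
         (simp add: sets single)
    show "AE p in \<mu>. g p = (\<Sum>i=1..n. g (x i) * indicator {x i} p)"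
      using AE
    proof eventually_elim
      case (elim p)
      show ?case
      proof (cases "p \<in> x ` {1..n}")
        case True
        then obtain k where k: "k \<in> {1..n}" "p = x k" by auto
        have "g (x i) * indicator {x i} p = (if i = k then g (x k) else 0)" if "i \<in> {1..n}" for i
          using inj_on_eq_iff[OF inj that k(1)] k(2) by (auto simp: indicator_def)
        then have "(\<Sum>i=1..n. g (x i) * indicator {x i} p) = (\<Sum>i=1..n. if i = k then g (x k) else 0)"
          by (rule sum.cong[OF refl])
        then show ?thesis using k by simp
      next
        case False
        then have "g p = 0" using elim gI by (auto simp: Z(1))
        moreover have "(\<Sum>i=1..n. g (x i) * indicator {x i} p) = 0"
          using False by (intro sum.neutral) (auto simp: indicator_def)
        ultimately show ?thesis by simp
      qed
    qed
  qed
  also have "\<dots> = (\<Sum>i=1..n. g (x i) * measure \<mu> {x i})"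
    by (subst Bochner_Integration.integral_sum)
       (auto simp: sets single emeasure_eq_measure intro!: integrable_mult_right integrable_real_indicator)
  also have "\<dots> = (\<Sum>i=1..n. \<alpha> i * g (x i))"
  proof (rule sum.cong[OF refl])
    fix i assume i: "i \<in> {1..n}"
    show "g (x i) * measure \<mu> {x i} = \<alpha> i * g (x i)"
    \<comment> \<open>A point with nonzero \<open>g (x i)\<close> lies in no \<open>I j\<close>, so
      no \<open>\<nu> j\<close> charges it; if \<open>g (x i) = 0\<close>, both sides vanish
      whatever the mass of the point.\<close>
    proof (cases "g (x i) = 0")
      case False
      have "\<alpha> k * measure (return borel (x k)) {x i} = (if k = i then \<alpha> i else 0)" if "k \<in> {1..n}" for k
        using inj_on_eq_iff[OF inj that i] by (auto simp: ret[OF single] indicator_def)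
      then have "(\<Sum>k=1..n. \<alpha> k * measure (return borel (x k)) {x i}) = (\<Sum>k=1..n. if k = i then \<alpha> i else 0)"
        by (rule sum.cong[OF refl])
      moreover have "(\<Sum>j=1..m. \<beta> j * measure (\<nu> j) {x i}) = 0"
        using False gI by (intro sum.neutral) (auto intro!: \<nu>0)
      ultimately show ?thesis using i by (simp add: mix[OF single])
    qed simp
  qed
  finally show "(\<integral>p. g p \<partial>\<mu>) = (\<Sum>i=1..n. \<alpha> i * g (x i))" .
qed

theorem theorem5p4:
  fixes a b :: "circle \<Rightarrow> real"
    and n m :: nat
    and x :: "nat \<Rightarrow> circle"
    and I :: "nat \<Rightarrow> circle set"
  assumes "C_k_circle 2 a" and "\<And>p. a p > 0"
    and "C_k_circle 1 b"
    and "\<exists>p. b p > 0" and "\<exists>p. b p < 0"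
    and "bij_betw x {1..n} (isolated_zeros b)"
    and "bij_betw I {1..m} (zero_intervals b)"
    and "zero_set b = x ` {1..n} \<union> (\<Union>j\<in>{1..m}. I j)"
  shows "(\<forall>(\<mu> :: circle measure) (\<alpha> :: nat \<Rightarrow> real) (\<beta> :: nat \<Rightarrow> real) (\<nu> :: nat \<Rightarrow> circle measure).
            circle_prob \<mu> \<and>
            (\<forall>i\<in>{1..n}. \<alpha> i \<ge> 0) \<and> (\<forall>j\<in>{1..m}. \<beta> j \<ge> 0) \<and>
            (\<Sum>i=1..n. \<alpha> i) + (\<Sum>j=1..m. \<beta> j) = 1 \<and>
            (\<forall>j\<in>{1..m}. circle_prob (\<nu> j) \<and> measure_support (\<nu> j) \<subseteq> I j) \<and>
            (\<forall>A\<in>sets borel. measure \<mu> A =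
               (\<Sum>i=1..n. \<alpha> i * measure (return borel (x i)) A) + (\<Sum>j=1..m. \<beta> j * measure (\<nu> j) A))
            \<longrightarrow> J_functional a b \<mu> = ereal (\<Sum>i=1..n. \<alpha> i * max 0 (circle_deriv b (x i))))
       \<and> (\<forall>\<mu> :: circle measure.
            circle_prob \<mu> \<and> \<not> measure_support \<mu> \<subseteq> zero_set b
            \<longrightarrow> J_functional a b \<mu> = \<infinity>)"
proof (intro conjI allI impI; (elim conjE)?)
  note ab = assms(1-5)
  fix \<mu> :: "circle measure" and \<alpha> \<beta> :: "nat \<Rightarrow> real" and \<nu> :: "nat \<Rightarrow> circle measure"
  assume \<mu>: "circle_prob \<mu>"
    and \<nu>: "\<forall>j\<in>{1..m}. circle_prob (\<nu> j) \<and> measure_support (\<nu> j) \<subseteq> I j"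
    and mix: "\<forall>A\<in>sets borel. measure \<mu> A =
      (\<Sum>i=1..n. \<alpha> i * measure (return borel (x i)) A) + (\<Sum>j=1..m. \<beta> j * measure (\<nu> j) A)"
  let ?g = "\<lambda>p. max 0 (circle_deriv b p)"
  have g: "continuous_on UNIV ?g"
    by (intro continuous_intros C_1_circleD(2)[OF assms(3)])
  have inj: "inj_on x {1..n}" using assms(6) by (rule bij_betw_imp_inj_on)
  have cl: "closed (zero_set b)"
    by (intro closed_zero_set C_1_circle_continuous assms)
  have gI: "?g p = 0" if "j \<in> {1..m}" "p \<in> I j" for j p
  proof -
    have "I j \<in> zero_intervals b" using assms(7) that(1) by (auto simp: bij_betw_def)
    then have "nondegenerate_interval (I j)" "I j \<subseteq> zero_set b" by (auto simp: zero_intervals_def)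
    then show ?thesis using circle_deriv_zero_on_interval[OF assms(3) _ _ that(2)] by simp
  qed
  note M = integral_mixture[OF \<mu> g inj assms(8) cl gI \<nu>[rule_format] mix[rule_format]]
  show "J_functional a b \<mu> = ereal (\<Sum>i=1..n. \<alpha> i * ?g (x i))"
    using J_functional_zero_set[OF ab \<mu> M(1)] M(2) by simp
next
  fix \<mu> :: "circle measure"
  assume "circle_prob \<mu>" "\<not> measure_support \<mu> \<subseteq> zero_set b"
  then show "J_functional a b \<mu> = \<infinity>" by (rule J_functional_infinite[OF assms(1-5)])
qed

end
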